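(* Let $N\ge 3$, $l\ge1$, $s_1,\dots,s_l\in(0,2]$ and $P_1,\dots,P_l\in\partial\mathbb R^N_+$ (i.e. $P_i=(P_i',0)$ with $P_i'\in\mathbb R^{N-1}$). Let $u\ge0$ with $u\in L^\infty(\mathbb R^N_+)\cap H^1_{loc}(\overline{\mathbb R^N_+})$ be a solution of $$\Delta u-\sum_{i=1}^l\frac{u^{2^*(s_i)-1}}{|x-P_i|^{s_i}}+u^{\frac{N+2}{N-2}}=0\ \text{ in }\mathbb R^N_+,\qquad u=0\ \text{ on }\partial\mathbb R^N_+ .$$ Then $u\equiv 0$.
   Context: $\mathbb R^N_+=\{x\in\mathbb R^N: x_N>0\}$; $2^*(s)=\frac{2(N-s)}{N-2}$. *)

theory Defs
  imports "HOL-Analysis.Analysis"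
begin

definition pderiv_dir :: "('a::euclidean_space \<Rightarrow> real) \<Rightarrow> 'a \<Rightarrow> 'a \<Rightarrow> real" where
  "pderiv_dir f b x = frechet_derivative f (at x) b"

definition grad :: "('a::euclidean_space \<Rightarrow> real) \<Rightarrow> 'a \<Rightarrow> 'a" where
  "grad f x = (\<Sum>b\<in>Basis. pderiv_dir f b x *\<^sub>R b)"

definition smooth_fun :: "('a::euclidean_space \<Rightarrow> real) \<Rightarrow> bool" where
  "smooth_fun f \<longleftrightarrow> (\<exists>F. f \<in> F \<and>
      (\<forall>g\<in>F. (\<forall>x. g differentiable (at x)) \<and> (\<forall>b\<in>Basis. pderiv_dir g b \<in> F)))"

definition support_of :: "('a::euclidean_space \<Rightarrow> real) \<Rightarrow> 'a set" where
  "support_of f = closure {x. f x \<noteq> 0}"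

definition test_fun :: "('a::euclidean_space \<Rightarrow> real) \<Rightarrow> 'a set \<Rightarrow> bool" where
  "test_fun \<phi> U \<longleftrightarrow> smooth_fun \<phi> \<and> compact (support_of \<phi>) \<and> support_of \<phi> \<subseteq> U"

definition loc_integrable :: "('a::euclidean_space \<Rightarrow> real) \<Rightarrow> 'a set \<Rightarrow> bool" where
  "loc_integrable f U \<longleftrightarrow> (\<forall>K. compact K \<and> K \<subseteq> U \<longrightarrow> set_integrable lborel K f)"

definition has_weak_gradient :: "('a::euclidean_space \<Rightarrow> real) \<Rightarrow> ('a \<Rightarrow> 'a) \<Rightarrow> 'a set \<Rightarrow> bool" where
  "has_weak_gradient u G U \<longleftrightarrow> loc_integrable u U \<and>
     (\<forall>b\<in>Basis. loc_integrable (\<lambda>x. G x \<bullet> b) U) \<and>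
     (\<forall>\<phi>. test_fun \<phi> U \<longrightarrow> (\<forall>b\<in>Basis.
        (\<integral>x. u x * pderiv_dir \<phi> b x \<partial>lborel) = - (\<integral>x. (G x \<bullet> b) * \<phi> x \<partial>lborel)))"

definition H1_loc :: "('a::euclidean_space \<Rightarrow> real) \<Rightarrow> ('a \<Rightarrow> 'a) \<Rightarrow> 'a set \<Rightarrow> bool" where
  "H1_loc u G U \<longleftrightarrow> has_weak_gradient u G U \<and>
     loc_integrable (\<lambda>x. (u x)\<^sup>2) U \<and> loc_integrable (\<lambda>x. (norm (G x))\<^sup>2) U"

definition half_space :: "'n::finite \<Rightarrow> (real^'n) set" where
  "half_space k = {x. x $ k > 0}"

definition crit_exp :: "nat \<Rightarrow> real \<Rightarrow> real" where
  "crit_exp N s = 2 * (real N - s) / (real N - 2)"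

end

theory Submission
  imports Defs
begin

text \<open>
  The right-hand side of \<open>-\<Delta>u = u\<^sup>p - \<Sum> u\<^bsup>q i\<^esup> / |x - P i|\<^bsup>s i\<^esup>\<close> increases with the height \<open>x\<^sub>N\<close>,
  because the \<open>P i\<close> lie on the boundary, so moving planes in the direction \<open>e\<^sub>N\<close> show that \<open>u\<close> increases
  with \<open>x\<^sub>N\<close>; at infinity in the tangential directions compactness is replaced by a quantitative
  Harnack chain. The limit \<open>v = lim u(x + t e\<^sub>N)\<close> solves \<open>-\<Delta>v = v\<^sup>p\<close> in the whole space and does not depend
  on \<open>x\<^sub>N\<close>, and \<open>v - u > 0\<close> is a supersolution of the linearised equation, which makes \<open>v\<close> stable.
  Testing stability with \<open>v \<eta>\<close> bounds \<open>\<integral> v\<^bsup>p+1\<^esup>\<close> over the whole space, which is impossible for a nonzero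
  function that is constant in one direction.

  Derivatives of \<open>u\<close> are avoided throughout. With kernels \<open>\<rho>\<close>, \<open>\<Theta>\<close> such that \<open>y \<rho>(y) = -\<nabla>\<Theta>(y)\<close>, the averages
  \<open>A\<^sub>t u(x) = \<integral> u(x + t y) \<rho>(y) dy\<close> satisfy \<open>\<partial>\<^sub>t A\<^sub>t u(x) = t \<integral> \<Delta>u(x + t y) \<Theta>(y) dy\<close> already for distributional
  Laplacians, so the continuous representative, the maximum principle, the Harnack inequality and
  Picone's inequality are all expressed through \<open>A\<^sub>t\<close>.
\<close>

section \<open>Smooth test functions\<close>

text \<open>Near the boundary the weights are unbounded, so the equation gives no two-sided control
  there. Their terms have a favourable sign, however: the zero extension satisfies -\<Delta>U \<le>
  M^p across the boundary, and this one-sided bound together with the vanishing below already forces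
  continuity up to the boundary. In the interior all constants are taken at heights \<ge> h, where
  the weights are at most h^(-s).

  The same sign governs the reflected difference w: where w < 0 only the potential p u^(p-1) acts,
  and it is small wherever u is small. A failure of the moving plane therefore shows up at a point
  where u is not small, hence at a definite height, and only there is Harnack's inequality needed.

  The exponent matters at the end. Since p - 1 = 4/(N - 2), the term v^2/S^2 left by the cutoff at
  scale S is absorbed by v^(p+1) except where v is below a multiple of S^(-(N-2)/2); there it
  contributes a multiple of S^(-N) per unit volume, which stays bounded when summed over a ball of
  radius 3S.\<close>

definition flat :: "real poly \<Rightarrow> real \<Rightarrow> real" where
  "flat q t = (if t > 0 then poly q (1/t) * exp (-(1/t)) else 0)"

text \<open>Both terms of the chain rule for q(1/t) exp(-1/t) carry the factor 1/t^2, so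
  differentiation stays inside the family \<open>flat\<close> and only changes the
  polynomial.\<close>

definition flat_deriv :: "real poly \<Rightarrow> real poly" where
  "flat_deriv q = [:0, 0, 1:] * (q - pderiv q)"

lemma tendsto_poly_exp: "((\<lambda>s::real. poly q s * exp (-s)) \<longlongrightarrow> 0) at_top"
proof -
  have "((\<lambda>s::real. (\<Sum>i\<le>degree q. coeff q i * (s ^ i / exp s))) \<longlongrightarrow> (\<Sum>i\<le>degree q. coeff q i * 0)) at_top"
    by (intro tendsto_sum tendsto_mult_left tendsto_power_div_exp_0)
  moreover have "poly q s * exp (-s) = (\<Sum>i\<le>degree q. coeff q i * (s ^ i / exp s))" for s
    unfolding poly_altdef sum_distrib_right by (rule sum.cong) (simp_all add: exp_minus divide_inverse)
  ultimately show ?thesis by simp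
qed

lemma tendsto_flat_at_right: "(flat q \<longlongrightarrow> 0) (at_right 0)"
proof -
  have "((\<lambda>t. poly q (inverse t) * exp (-(inverse t))) \<longlongrightarrow> 0) (at_right (0::real))"
    using filterlim_compose[OF tendsto_poly_exp filterlim_inverse_at_top_right] .
  moreover have "\<forall>\<^sub>F t in at_right (0::real). poly q (inverse t) * exp (-(inverse t)) = flat q t"
    using eventually_at_right_less[of 0]
    by eventually_elim (simp add: flat_def divide_inverse)
  ultimately show ?thesis by (rule Lim_transform_eventually)
qed

lemma DERIV_flat: "(flat q has_real_derivative flat (flat_deriv q) t) (at t)"
proof -
  consider "t > 0" | "t < 0" | "t = 0" by linarith
  then show ?thesis
  proof cases
    case 1
    have "((\<lambda>t. poly q (1/t) * exp (-(1/t))) has_real_derivative flat (flat_deriv q) t) (at t)"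
      using 1 by (auto intro!: derivative_eq_intros poly_DERIV[THEN DERIV_chain2]
          simp: flat_def flat_deriv_def power2_eq_square algebra_simps divide_simps)
    then show ?thesis
      by (rule has_field_derivative_transform_within_open[where S="{0<..}"]) (use 1 in \<open>auto simp: flat_def\<close>)
  next
    case 2
    have "((\<lambda>t. 0) has_real_derivative flat (flat_deriv q) t) (at t)"
      using 2 by (auto simp: flat_def)
    then show ?thesis
      by (rule has_field_derivative_transform_within_open[where S="{..<0}"]) (use 2 in \<open>auto simp: flat_def\<close>)
  next
    case 3
    \<comment> \<open>Multiplying \<open>q\<close> by the monomial turns the difference quotient
      flat q y / y at 0 into another member of the family.\<close>
    have "((\<lambda>y. flat ([:0,1:] * q) y) \<longlongrightarrow> 0) (at_right 0)"
      by (rule tendsto_flat_at_right)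
    then have R: "((\<lambda>y. (flat q y - flat q 0) / (y - 0)) \<longlongrightarrow> 0) (at_right 0)"
      by (rule Lim_transform_eventually)
         (use eventually_at_right_less[of 0] in eventually_elim, simp add: flat_def)
    have L: "((\<lambda>y. (flat q y - flat q 0) / (y - 0)) \<longlongrightarrow> 0) (at_left 0)"
      by (rule tendsto_eventually) (auto simp: flat_def eventually_at_left_field intro: exI[of _ "-1"])
    have "(flat q has_real_derivative 0) (at 0)"
      unfolding has_field_derivative_iff by (rule filterlim_split_at[OF L R])
    then show ?thesis using 3 by (simp add: flat_def)
  qed
qed

lemma continuous_on_flat [continuous_intros]:
  "continuous_on S f \<Longrightarrow> continuous_on S (\<lambda>x. flat q (f x))"
proof -
  have "continuous_on UNIV (flat q)"
    by (intro continuous_at_imp_continuous_on ballI DERIV_isCont[OF DERIV_flat])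
  then show "continuous_on S f \<Longrightarrow> ?thesis"
    using continuous_on_compose2[of UNIV "flat q" S f] by auto
qed

text \<open>\<open>smooth_fun\<close> asks for a family of differentiable functions closed under
  partial derivatives. This class is such a family, with closure available by rule induction, and
  everything inserted into the weak formulation is taken from it. \<open>flat\<close> enters with
  all polynomials because differentiation changes \<open>q\<close>.\<close>

inductive_set smooth_class :: "('a::euclidean_space \<Rightarrow> real) set" where
  const: "(\<lambda>_. c) \<in> smooth_class"
| coord: "(\<lambda>x. x \<bullet> a) \<in> smooth_class"
| add: "f \<in> smooth_class \<Longrightarrow> g \<in> smooth_class \<Longrightarrow> (\<lambda>x. f x + g x) \<in> smooth_class"
| mult: "f \<in> smooth_class \<Longrightarrow> g \<in> smooth_class \<Longrightarrow> (\<lambda>x. f x * g x) \<in> smooth_class"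
| flat: "f \<in> smooth_class \<Longrightarrow> (\<lambda>x. flat q (f x)) \<in> smooth_class"

lemma pderiv_dir_eqI: "(f has_derivative f') (at x) \<Longrightarrow> pderiv_dir f b x = f' b"
  unfolding pderiv_dir_def using frechet_derivative_at by metis

lemma has_derivative_flat:
  assumes "(f has_derivative f') (at x)"
  shows "((\<lambda>x. flat q (f x)) has_derivative (\<lambda>v. flat (flat_deriv q) (f x) * f' v)) (at x)"
  using has_derivative_compose[OF assms, of "flat q" "\<lambda>v. flat (flat_deriv q) (f x) * v"]
    DERIV_flat[of q "f x"] by (simp add: has_field_derivative_def)

lemma smooth_class_derivative:
  assumes "f \<in> smooth_class"
  shows "(\<forall>x. f differentiable (at x)) \<and> (\<forall>b. pderiv_dir f b \<in> smooth_class)"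
  using assms
proof induction
  case (const c)
  have "pderiv_dir (\<lambda>_. c) b = (\<lambda>_. 0)" for b :: 'a
    by (rule ext, rule pderiv_dir_eqI) (rule has_derivative_const)
  then show ?case by (auto intro: smooth_class.const)
next
  case (coord a)
  have D: "((\<lambda>x. x \<bullet> a) has_derivative (\<lambda>v. v \<bullet> a)) (at x)" for x :: 'a
    by (auto intro!: derivative_eq_intros)
  have "pderiv_dir (\<lambda>x. x \<bullet> a) b = (\<lambda>_. b \<bullet> a)" for b :: 'a
    by (rule ext, rule pderiv_dir_eqI[OF D])
  then show ?case using D by (auto intro: smooth_class.const simp: differentiable_def)
next
  case (add f g)
  have D: "((\<lambda>x. f x + g x) has_derivative
      (\<lambda>v. frechet_derivative f (at x) v + frechet_derivative g (at x) v)) (at x)" for x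
    using add by (intro has_derivative_add) (auto simp: frechet_derivative_works)
  have "pderiv_dir (\<lambda>x. f x + g x) b = (\<lambda>x. pderiv_dir f b x + pderiv_dir g b x)" for b
    by (rule ext, subst pderiv_dir_eqI[OF D]) (simp add: pderiv_dir_def)
  then show ?case using D add by (auto intro: smooth_class.add simp: differentiable_def)
next
  case (mult f g)
  have D: "((\<lambda>x. f x * g x) has_derivative
      (\<lambda>v. f x * frechet_derivative g (at x) v + frechet_derivative f (at x) v * g x)) (at x)" for x
    using mult by (intro has_derivative_mult) (auto simp: frechet_derivative_works)
  have "pderiv_dir (\<lambda>x. f x * g x) b = (\<lambda>x. f x * pderiv_dir g b x + pderiv_dir f b x * g x)" for b
    by (rule ext, subst pderiv_dir_eqI[OF D]) (simp add: pderiv_dir_def)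
  then show ?case using D mult by (auto intro!: smooth_class.add smooth_class.mult simp: differentiable_def)
next
  case (flat f q)
  have D: "((\<lambda>x. flat q (f x)) has_derivative
      (\<lambda>v. flat (flat_deriv q) (f x) * frechet_derivative f (at x) v)) (at x)" for x
    using flat by (intro has_derivative_flat) (auto simp: frechet_derivative_works)
  have "pderiv_dir (\<lambda>x. flat q (f x)) b = (\<lambda>x. flat (flat_deriv q) (f x) * pderiv_dir f b x)" for b
    by (rule ext, subst pderiv_dir_eqI[OF D]) (simp add: pderiv_dir_def)
  then show ?case using D flat by (auto intro!: smooth_class.mult smooth_class.flat simp: differentiable_def)
qed

lemma smooth_class_smooth_fun: "f \<in> smooth_class \<Longrightarrow> smooth_fun f"
  unfolding smooth_fun_def using smooth_class_derivative
  by (intro exI[of _ smooth_class]) auto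

lemma smooth_class_has_derivative:
  "f \<in> smooth_class \<Longrightarrow> (f has_derivative (\<lambda>v. pderiv_dir f v x)) (at x)"
  using smooth_class_derivative[of f] unfolding pderiv_dir_def[abs_def]
  by (auto simp: frechet_derivative_works)

lemma smooth_class_continuous: "f \<in> smooth_class \<Longrightarrow> continuous_on S f"
  by (meson continuous_at_imp_continuous_on has_derivative_continuous smooth_class_has_derivative)

lemma smooth_class_pderiv_dir: "f \<in> smooth_class \<Longrightarrow> pderiv_dir f b \<in> smooth_class"
  using smooth_class_derivative by blast

lemma smooth_class_sum:
  "finite I \<Longrightarrow> (\<And>i. i \<in> I \<Longrightarrow> f i \<in> smooth_class) \<Longrightarrow> (\<lambda>x. \<Sum>i\<in>I. f i x) \<in> smooth_class"
  by (induction I rule: finite_induct) (auto intro: smooth_class.intros)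

lemma smooth_class_diff:
  "f \<in> smooth_class \<Longrightarrow> g \<in> smooth_class \<Longrightarrow> (\<lambda>x. f x - g x) \<in> smooth_class"
  using smooth_class.add[OF _ smooth_class.mult[OF smooth_class.const[of "-1"]], of f g] by simp

lemma smooth_class_cmult: "f \<in> smooth_class \<Longrightarrow> (\<lambda>x. c * f x) \<in> smooth_class"
  by (intro smooth_class.intros)

lemma smooth_class_norm_diff_square: "(\<lambda>y. (norm (y - x))\<^sup>2) \<in> smooth_class"
proof -
  have "(\<lambda>y::'a. \<Sum>b\<in>Basis. (y \<bullet> b + (-(x \<bullet> b))) * (y \<bullet> b + (-(x \<bullet> b)))) \<in> smooth_class"
    by (intro smooth_class_sum smooth_class.intros) auto
  moreover have "(\<Sum>b\<in>Basis. (y \<bullet> b + (-(x \<bullet> b))) * (y \<bullet> b + (-(x \<bullet> b)))) = (norm (y - x))\<^sup>2" for y :: 'a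
    unfolding power2_norm_eq_inner by (subst euclidean_inner) (simp add: inner_diff_left)
  ultimately show ?thesis by simp
qed

lemma pderiv_dir_eq_0_outside:
  assumes "support_of f \<subseteq> K" "x \<notin> K"
  shows "pderiv_dir f b x = 0"
proof -
  have "open (- support_of f)" "x \<in> - support_of f"
    using assms by (auto simp: support_of_def)
  moreover have "f y = 0" if "y \<in> - support_of f" for y
    using that closure_subset by (force simp: support_of_def)
  ultimately have "(f has_derivative (\<lambda>_. 0)) (at x)"
    by (intro has_derivative_transform_within_open[OF has_derivative_const[of "0::real"]]) auto
  then show ?thesis by (rule pderiv_dir_eqI)
qed

lemma support_of_subsetI: "closed K \<Longrightarrow> (\<And>x. x \<notin> K \<Longrightarrow> f x = 0) \<Longrightarrow> support_of f \<subseteq> K"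
  unfolding support_of_def by (rule closure_minimal) auto

lemma test_funI:
  assumes "f \<in> smooth_class" "compact K" "K \<subseteq> U" "\<And>x. x \<notin> K \<Longrightarrow> f x = 0"
  shows "test_fun f U"
proof -
  have *: "support_of f \<subseteq> K" using assms compact_imp_closed by (intro support_of_subsetI) auto
  moreover have "closed (support_of f)" by (simp add: support_of_def)
  ultimately have "compact (support_of f)"
    using assms(2) compact_Int_closed[of K "support_of f"] by (simp add: Int_absorb1)
  then show ?thesis unfolding test_fun_def using * assms smooth_class_smooth_fun by blast
qed

lemma test_fun_pderiv_dir:
  assumes "f \<in> smooth_class" "compact K" "K \<subseteq> U" "\<And>x. x \<notin> K \<Longrightarrow> f x = 0"
  shows "test_fun (pderiv_dir f b) U" "\<And>x. x \<notin> K \<Longrightarrow> pderiv_dir f b x = 0"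
proof -
  show *: "pderiv_dir f b x = 0" if "x \<notin> K" for x
    using assms that compact_imp_closed by (intro pderiv_dir_eq_0_outside[OF support_of_subsetI]) auto
  show "test_fun (pderiv_dir f b) U"
    by (rule test_funI[OF smooth_class_pderiv_dir]) (use assms * in auto)
qed

section \<open>The averaging kernels\<close>

text \<open>The factor 2 and \<open>flat_deriv 1\<close> come from differentiating flat 1 (1 -
  |y|^2), whose gradient is -y rho0(y).\<close>

definition rho0 :: "'a::euclidean_space \<Rightarrow> real" where
  "rho0 y = 2 * flat (flat_deriv 1) (1 - (norm y)\<^sup>2)"

definition rho :: "'a::euclidean_space \<Rightarrow> real" where
  "rho y = rho0 y / (\<integral>z. rho0 (z::'a) \<partial>lborel)"

text \<open>Divided by the mass of \<open>rho0\<close>, not by its own: only a common factor keeps y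
  rho(y) = -grad Theta(y). The mass of \<open>Theta\<close> therefore survives as the constant
  \<open>Theta_mass\<close>.\<close>

definition Theta :: "'a::euclidean_space \<Rightarrow> real" where
  "Theta y = flat 1 (1 - (norm y)\<^sup>2) / (\<integral>z. rho0 (z::'a) \<partial>lborel)"

lemma flat_deriv_1: "flat_deriv 1 = [:0, 0, 1:]"
  by (simp add: flat_deriv_def)

lemma flat_nonneg: "(\<And>s. s > 0 \<Longrightarrow> poly q s \<ge> 0) \<Longrightarrow> flat q t \<ge> 0"
  by (simp add: flat_def)

lemma flat_eq_0: "t \<le> 0 \<Longrightarrow> flat q t = 0"
  by (simp add: flat_def)

lemma continuous_on_rho0: "continuous_on S rho0"
  unfolding rho0_def[abs_def] by (intro continuous_intros)

lemma rho0_nonneg: "rho0 y \<ge> 0"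
  unfolding rho0_def flat_deriv_1 by (simp add: flat_nonneg)

lemma rho0_outside: "norm y \<ge> 1 \<Longrightarrow> rho0 y = 0"
  unfolding rho0_def by (simp add: flat_eq_0)

lemma rho0_lower: "norm y \<le> 3/4 \<Longrightarrow> rho0 y \<ge> exp (-(16/7))"
proof -
  assume "norm y \<le> 3/4"
  then have "(norm y)\<^sup>2 \<le> (3/4)\<^sup>2" by (intro power_mono) auto
  then have t: "1 - (norm y)\<^sup>2 \<ge> 7/16" by (simp add: power2_eq_square)
  have t1: "1 - (norm y)\<^sup>2 \<le> 1" by simp
  define t where "t = 1 - (norm y)\<^sup>2"
  have "1/t \<ge> 1" "1/t \<le> 16/7" using t t1 by (auto simp: t_def[symmetric] field_simps)
  moreover then have "(1/t)\<^sup>2 \<ge> 1" by (simp only: one_le_power)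
  moreover have "exp (-(1/t)) \<ge> exp (-(16/7))" using \<open>1/t \<le> 16/7\<close> by simp
  ultimately have "(1/t)\<^sup>2 * exp (-(1/t)) \<ge> 1 * exp (-(16/7))" by (intro mult_mono) auto
  moreover have "rho0 y = 2 * ((1/t)\<^sup>2 * exp (-(1/t)))" using t
    by (simp add: rho0_def flat_deriv_1 flat_def t_def power2_eq_square)
  moreover have "exp (-(16/7)::real) > 0" by simp
  ultimately show ?thesis by linarith
qed

lemma integrable_continuous_compact_support:
  fixes f :: "'a::euclidean_space \<Rightarrow> real"
  assumes "continuous_on UNIV f" "compact K" "\<And>x. x \<notin> K \<Longrightarrow> f x = 0"
  shows "integrable lborel f"
proof -
  have "integrable lborel (\<lambda>x. indicator K x *\<^sub>R f x)"
    by (rule borel_integrable_compact[OF assms(2)]) (use assms(1) continuous_on_subset in blast)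
  moreover have "(\<lambda>x. indicator K x *\<^sub>R f x) = f"
    using assms(3) by (auto simp: fun_eq_iff indicator_def)
  ultimately show ?thesis by simp
qed

lemma continuous_compact_support_bounded:
  fixes f :: "'a::euclidean_space \<Rightarrow> real"
  assumes "continuous_on UNIV f" "compact K" "\<And>x. x \<notin> K \<Longrightarrow> f x = 0"
  obtains B where "B > 0" "\<And>x. \<bar>f x\<bar> \<le> B"
proof -
  have "bounded (f ` K)"
    using assms compact_continuous_image continuous_on_subset compact_imp_bounded by blast
  then obtain B where "B > 0" "\<And>x. x \<in> K \<Longrightarrow> \<bar>f x\<bar> \<le> B"
    unfolding bounded_pos by auto
  then show ?thesis using that[of B] assms(3) by (metis abs_0 less_imp_le)
qed

lemma integrable_rho0: "integrable lborel rho0"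
  by (rule integrable_continuous_compact_support[OF continuous_on_rho0, of "cball 0 1"])
     (auto simp: rho0_outside)

lemma integral_rho0_pos: "(\<integral>y. rho0 (y::'a::euclidean_space) \<partial>lborel) > 0"
proof -
  have "0 < exp (-(16/7)) * measure lborel (ball (0::'a) (3/4))"
    by (simp add: content_ball_pos)
  also have "\<dots> = (\<integral>y. exp (-(16/7)) * indicator (ball 0 (3/4)) (y::'a) \<partial>lborel)"
    by simp
  also have "\<dots> \<le> (\<integral>y. rho0 (y::'a) \<partial>lborel)"
    by (intro integral_mono integrable_rho0 integrable_mult_right integrable_real_indicator)
       (auto simp: indicator_def rho0_lower rho0_nonneg emeasure_lborel_ball_finite[unfolded infinity_ennreal_def])
  finally show ?thesis .
qed

lemma continuous_on_rho: "continuous_on S rho"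
  unfolding rho_def[abs_def] using integral_rho0_pos[where 'a='a]
  by (intro continuous_intros continuous_on_rho0) auto

lemma continuous_on_Theta: "continuous_on S Theta"
  unfolding Theta_def[abs_def] using integral_rho0_pos[where 'a='a]
  by (intro continuous_intros) auto

lemma rho_nonneg: "rho y \<ge> 0"
  unfolding rho_def using rho0_nonneg integral_rho0_pos less_imp_le by (metis divide_nonneg_pos)

lemma Theta_nonneg: "Theta (y::'a::euclidean_space) \<ge> 0"
  unfolding Theta_def using integral_rho0_pos[where 'a='a] by (simp add: flat_nonneg)

lemma rho_outside: "norm y \<ge> 1 \<Longrightarrow> rho y = 0"
  unfolding rho_def by (simp add: rho0_outside)

lemma Theta_outside: "norm y \<ge> 1 \<Longrightarrow> Theta y = 0"
  unfolding Theta_def by (simp add: flat_eq_0)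

lemma integrable_rho: "integrable lborel rho"
  by (rule integrable_continuous_compact_support[OF continuous_on_rho, of "cball 0 1"])
     (auto simp: rho_outside)

lemma integrable_Theta: "integrable lborel Theta"
  by (rule integrable_continuous_compact_support[OF continuous_on_Theta, of "cball 0 1"])
     (auto simp: Theta_outside)

lemma measurable_rho [measurable]: "rho \<in> borel_measurable borel"
  using continuous_on_rho by (intro borel_measurable_continuous_onI)

lemma measurable_Theta [measurable]: "Theta \<in> borel_measurable borel"
  using continuous_on_Theta by (intro borel_measurable_continuous_onI)

lemma integral_rho: "(\<integral>y. rho (y::'a::euclidean_space) \<partial>lborel) = 1"
  unfolding rho_def using integral_rho0_pos[where 'a='a] by simp

text \<open>With t = 1 - |y|^2 \<le> 1 the additional factor (1/t)^2 in \<open>rho\<close> is at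
  least 1. This turns bounds against \<open>Theta\<close> into bounds against \<open>rho\<close>,
  which closes Gronwall's inequality for \<open>avg\<close>.\<close>

lemma Theta_le_rho: "2 * Theta (y::'a::euclidean_space) \<le> rho y"
proof (cases "norm y < 1")
  case True
  define t where "t = 1 - (norm y)\<^sup>2"
  have t: "0 < t" "t \<le> 1" using True by (auto simp: t_def abs_square_less_1)
  then have "1 \<le> (1/t)\<^sup>2" by (intro one_le_power) simp
  then have "exp (-(1/t)) \<le> (1/t)\<^sup>2 * exp (-(1/t))" by simp
  then have "2 * flat 1 t \<le> rho0 y"
    using t unfolding rho0_def flat_deriv_1 t_def[symmetric] by (simp add: flat_def power2_eq_square)
  then show ?thesis
    unfolding Theta_def rho_def t_def[symmetric] using integral_rho0_pos[where 'a='a]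
    by (simp add: divide_right_mono less_imp_le)
qed (simp add: Theta_outside rho_outside)

text \<open>The radius 3/4 = 1/2 + 1/4 leaves room for a ball of radius r/4 around any point at
  distance at most r/2 from the centre of an average of radius r.\<close>

lemma rho_lower_ex: "\<exists>c>0. \<forall>y::'a::euclidean_space. norm y \<le> 3/4 \<longrightarrow> c \<le> rho y"
  unfolding rho_def using integral_rho0_pos[where 'a='a] rho0_lower
  by (intro exI[of _ "exp (-(16/7)) / (\<integral>y. rho0 (y::'a) \<partial>lborel)"])
     (auto intro!: divide_right_mono simp: less_imp_le)

lemma integral_Theta_pos: "(\<integral>y. Theta (y::'a::euclidean_space) \<partial>lborel) > 0"
proof -
  define m where "m = (\<integral>z. rho0 (z::'a) \<partial>lborel)"
  have m: "m > 0" unfolding m_def by (rule integral_rho0_pos)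
  have low: "Theta y \<ge> exp (-(4/3)) / m" if "norm y \<le> 1/2" for y :: 'a
  proof -
    have "(norm y)\<^sup>2 \<le> (1/2)\<^sup>2" using that by (intro power_mono) auto
    then have t: "1 - (norm y)\<^sup>2 \<ge> 3/4" by (simp add: power2_eq_square)
    then have "1 / (1 - (norm y)\<^sup>2) \<le> 4/3" by (simp add: field_simps)
    then show ?thesis unfolding Theta_def m_def[symmetric] flat_def using t m
      by (simp add: divide_right_mono)
  qed
  have "0 < exp (-(4/3)) / m * measure lborel (ball (0::'a) (1/2))"
    using m by (simp add: content_ball_pos)
  also have "\<dots> = (\<integral>y. exp (-(4/3)) / m * indicator (ball 0 (1/2)) (y::'a) \<partial>lborel)"
    by simp
  also have "\<dots> \<le> (\<integral>y. Theta (y::'a) \<partial>lborel)"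
    by (intro integral_mono integrable_Theta integrable_mult_right integrable_real_indicator)
       (auto simp: indicator_def low Theta_nonneg emeasure_lborel_ball_finite[unfolded infinity_ennreal_def])
  finally show ?thesis .
qed

lemma rho_cong_norm: "norm (y::'a) = norm y' \<Longrightarrow> rho y = rho (y'::'a::euclidean_space)"
  by (simp add: rho_def rho0_def)

lemma Theta_cong_norm: "norm (y::'a) = norm y' \<Longrightarrow> Theta y = Theta (y'::'a::euclidean_space)"
  by (simp add: Theta_def)

section \<open>Change of variables under dilations, translations and reflections; moments of the
  kernel\<close>

lemma integral_affine_euclidean:
  fixes F :: "'a::euclidean_space \<Rightarrow> real"
  assumes [measurable]: "F \<in> borel_measurable borel" and "t > 0"
  shows "(\<integral>z. F z \<partial>lborel) = t ^ DIM('a) * (\<integral>y. F (x + t *\<^sub>R y) \<partial>lborel)"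
proof -
  have "(\<integral>z. F z \<partial>lborel)
      = (\<integral>z. F z \<partial>density (distr lborel borel (\<lambda>y. x + t *\<^sub>R y)) (\<lambda>_. ennreal (t ^ DIM('a))))"
    using lborel_affine[of t x] \<open>t > 0\<close> by (simp add: ennreal_power[symmetric])
  also have "\<dots> = t ^ DIM('a) * (\<integral>y. F (x + t *\<^sub>R y) \<partial>lborel)"
    using \<open>t > 0\<close> by (subst integral_density) (auto simp: integral_distr)
  finally show ?thesis .
qed

lemma integral_translate:
  fixes F :: "'a::euclidean_space \<Rightarrow> real"
  assumes [measurable]: "F \<in> borel_measurable borel"
  shows "(\<integral>y. F (y + x) \<partial>lborel) = (\<integral>z. F z \<partial>lborel)"
  using integral_affine_euclidean[OF assms, of 1 x] by (simp add: add.commute)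

lemma integrable_translate:
  fixes F :: "'a::euclidean_space \<Rightarrow> real"
  assumes "integrable lborel F"
  shows "integrable lborel (\<lambda>y. F (y + x))"
proof -
  have "lborel = distr lborel borel (\<lambda>y::'a. y + x)"
    using lborel_affine[of 1 x] by (simp add: density_1 add.commute)
  then show ?thesis
    using assms integrable_distr_eq[of "\<lambda>y. y + x" lborel borel F] borel_measurable_integrable[OF assms]
    by simp
qed

lemma lborel_reflect:
  "lborel = distr lborel borel (\<lambda>y::'a::euclidean_space. \<Sum>j\<in>Basis. ((if j = b then -1 else 1) * (y \<bullet> j)) *\<^sub>R j)"
  using lborel_affine_euclidean[of "\<lambda>j. if j = b then -1 else 1" "0::'a"]
  by (simp add: if_distrib[of abs] density_1 cong: if_cong)

definition reflect_origin :: "'a::euclidean_space \<Rightarrow> 'a \<Rightarrow> 'a" where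
  "reflect_origin b y = y - (2 * (y \<bullet> b)) *\<^sub>R b"

lemma integral_reflect_origin:
  fixes F :: "'a::euclidean_space \<Rightarrow> real"
  assumes [measurable]: "F \<in> borel_measurable borel" and b: "b \<in> Basis"
  shows "(\<integral>y. F (reflect_origin b y) \<partial>lborel) = (\<integral>z. F z \<partial>lborel)"
proof -
  have "(\<Sum>j\<in>Basis. ((if j = b then -1 else 1) * (y \<bullet> j)) *\<^sub>R j) = reflect_origin b y" for y
  proof (rule euclidean_eqI)
    fix i :: 'a assume i: "i \<in> Basis"
    show "(\<Sum>j\<in>Basis. ((if j = b then -1 else 1) * (y \<bullet> j)) *\<^sub>R j) \<bullet> i = reflect_origin b y \<bullet> i"
      using i b by (simp add: reflect_origin_def inner_diff_left inner_Basis)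
  qed
  then have "lborel = distr lborel borel (reflect_origin b)"
    using lborel_reflect[of b] by simp
  moreover have "reflect_origin b \<in> borel_measurable borel"
    unfolding reflect_origin_def[abs_def] by measurable
  ultimately show ?thesis using integral_distr[of "reflect_origin b" lborel borel F] assms by simp
qed

lemma norm_reflect_origin: "b \<in> Basis \<Longrightarrow> norm (reflect_origin b y) = norm y"
  unfolding norm_eq_sqrt_inner reflect_origin_def
  by (simp add: inner_diff_left inner_diff_right inner_commute algebra_simps)

lemma integrable_bounded_times:
  fixes U g :: "'a::euclidean_space \<Rightarrow> real"
  assumes "U \<in> borel_measurable borel" "\<And>x. \<bar>U x\<bar> \<le> M" "integrable lborel g"
  shows "integrable lborel (\<lambda>x. U x * g x)"
proof (rule Bochner_Integration.integrable_bound[of lborel "\<lambda>x. M * g x"])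
  show "integrable lborel (\<lambda>x. M * g x)" using assms by simp
  show "(\<lambda>x. U x * g x) \<in> borel_measurable lborel" using assms by measurable
  show "AE x in lborel. norm (U x * g x) \<le> norm (M * g x)"
    using assms(2) by (intro AE_I2) (auto simp: abs_mult intro!: mult_right_mono intro: order_trans[OF _ abs_ge_self])
qed

text \<open>The integrand is odd under reflection in the hyperplane orthogonal to \<open>b\<close>,
  and \<open>rho\<close> is radial.\<close>

lemma integral_rho_first_moment:
  assumes "b \<in> Basis"
  shows "(\<integral>y. (y \<bullet> b) * rho (y::'a::euclidean_space) \<partial>lborel) = 0"
proof -
  have "(\<integral>y. (reflect_origin b y \<bullet> b) * rho (reflect_origin b y) \<partial>lborel) = (\<integral>y. (y \<bullet> b) * rho y \<partial>lborel)"
    by (rule integral_reflect_origin) (use assms in measurable)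
  moreover have "(reflect_origin b y \<bullet> b) * rho (reflect_origin b y) = - ((y \<bullet> b) * rho y)" for y
    using assms rho_cong_norm[OF norm_reflect_origin[OF assms, of y]]
    by (simp add: reflect_origin_def inner_diff_left)
  ultimately show ?thesis by simp
qed

lemma integrable_continuous_times_rho:
  fixes g :: "'a::euclidean_space \<Rightarrow> real"
  assumes "continuous_on UNIV g"
  shows "integrable lborel (\<lambda>y. g y * rho y)"
  by (rule integrable_continuous_compact_support[of _ "cball 0 1"])
     (auto intro!: continuous_intros assms continuous_on_rho simp: rho_outside)

lemma integrable_continuous_times_Theta:
  fixes g :: "'a::euclidean_space \<Rightarrow> real"
  assumes "continuous_on UNIV g"
  shows "integrable lborel (\<lambda>y. g y * Theta y)"
  by (rule integrable_continuous_compact_support[of _ "cball 0 1"])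
     (auto intro!: continuous_intros assms continuous_on_Theta simp: Theta_outside)

definition second_moment :: "'a::euclidean_space \<Rightarrow> real" where
  "second_moment b = (\<integral>y. (y \<bullet> b)\<^sup>2 * rho y \<partial>lborel)"

lemma second_moment_pos:
  assumes "b \<in> Basis"
  shows "second_moment (b::'a::euclidean_space) > 0"
proof -
  obtain c where c: "c > 0" "\<And>y::'a. norm y \<le> 3/4 \<Longrightarrow> c \<le> rho y" using rho_lower_ex by blast
  \<comment> \<open>On this ball y \<bullet> b is at least 1/4 and |y| is at most 3/4, so both
    factors of the integrand are bounded below.\<close>
  let ?B = "ball ((1/2) *\<^sub>R b) (1/4)"
  have sub: "norm y \<le> 3/4 \<and> 1/4 \<le> y \<bullet> b" if "y \<in> ?B" for y
  proof -
    have d: "norm (y - (1/2) *\<^sub>R b) < 1/4" using that by (simp add: dist_norm norm_minus_commute)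
    have "norm y \<le> norm (y - (1/2) *\<^sub>R b) + norm ((1/2) *\<^sub>R b)" by (metis diff_add_cancel norm_triangle_ineq)
    moreover have "\<bar>(y - (1/2) *\<^sub>R b) \<bullet> b\<bar> \<le> norm (y - (1/2) *\<^sub>R b)" using assms Basis_le_norm by blast
    ultimately show ?thesis using d assms by (auto simp: inner_diff_left)
  qed
  have "0 < (1/4)\<^sup>2 * c * measure lborel ?B" using c by (simp add: content_ball_pos)
  also have "\<dots> = (\<integral>y. (1/4)\<^sup>2 * c * indicator ?B y \<partial>lborel)" by simp
  also have "\<dots> \<le> second_moment b" unfolding second_moment_def
  proof (intro integral_mono integrable_mult_right integrable_real_indicator integrable_continuous_times_rho)
    fix y show "(1/4)\<^sup>2 * c * indicator ?B y \<le> (y \<bullet> b)\<^sup>2 * rho y"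
    proof (cases "y \<in> ?B")
      case True
      then show ?thesis using sub[OF True] c by (auto intro!: mult_mono power_mono)
    qed (simp add: rho_nonneg)
  qed (auto simp: emeasure_lborel_ball_finite[unfolded infinity_ennreal_def] intro!: continuous_intros)
  finally show ?thesis .
qed

section \<open>Averages and their convolution form\<close>

definition avg :: "('a::euclidean_space \<Rightarrow> real) \<Rightarrow> real \<Rightarrow> 'a \<Rightarrow> real" where
  "avg u t x = (\<integral>y. u (x + t *\<^sub>R y) * rho y \<partial>lborel)"

definition avgT :: "('a::euclidean_space \<Rightarrow> real) \<Rightarrow> real \<Rightarrow> 'a \<Rightarrow> real" where
  "avgT u t x = (\<integral>y. u (x + t *\<^sub>R y) * Theta y \<partial>lborel)"

definition lap :: "('a::euclidean_space \<Rightarrow> real) \<Rightarrow> 'a \<Rightarrow> real" where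
  "lap f x = (\<Sum>b\<in>Basis. pderiv_dir (pderiv_dir f b) b x)"

text \<open>The test function on the ball of radius \<open>t\<close> that is inserted into the weak
  equation; t times its Laplacian is the t-derivative of the kernel of \<open>avg\<close>.\<close>

definition scaled_Theta :: "real \<Rightarrow> 'a::euclidean_space \<Rightarrow> 'a \<Rightarrow> real" where
  "scaled_Theta t x z = Theta ((1/t) *\<^sub>R (z - x)) / t ^ DIM('a)"

lemma avg_eq_convolution:
  fixes u :: "'a::euclidean_space \<Rightarrow> real"
  assumes [measurable]: "u \<in> borel_measurable borel" and "t > 0"
  shows "avg u t x = (\<integral>z. u z * (rho ((1/t) *\<^sub>R (z - x)) / t ^ DIM('a)) \<partial>lborel)"
proof -
  have "(\<integral>z. u z * (rho ((1/t) *\<^sub>R (z - x)) / t ^ DIM('a)) \<partial>lborel)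
      = t ^ DIM('a) * (\<integral>y. u (x + t *\<^sub>R y) * (rho ((1/t) *\<^sub>R (x + t *\<^sub>R y - x)) / t ^ DIM('a)) \<partial>lborel)"
    by (rule integral_affine_euclidean) (use assms in measurable)
  also have "\<dots> = avg u t x" using \<open>t > 0\<close> by (simp add: avg_def)
  finally show ?thesis ..
qed

lemma avgT_eq_convolution:
  fixes u :: "'a::euclidean_space \<Rightarrow> real"
  assumes [measurable]: "u \<in> borel_measurable borel" and "t > 0"
  shows "avgT u t x = (\<integral>z. u z * scaled_Theta t x z \<partial>lborel)"
proof -
  have "(\<integral>z. u z * scaled_Theta t x z \<partial>lborel)
      = t ^ DIM('a) * (\<integral>y. u (x + t *\<^sub>R y) * scaled_Theta t x (x + t *\<^sub>R y) \<partial>lborel)"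
    by (rule integral_affine_euclidean) (use assms in \<open>unfold scaled_Theta_def, measurable\<close>)
  also have "\<dots> = avgT u t x" using \<open>t > 0\<close> by (simp add: avgT_def scaled_Theta_def)
  finally show ?thesis ..
qed

section \<open>Averages and the Laplacian\<close>

lemma has_derivative_flat_radial:
  "((\<lambda>z::'a::euclidean_space. flat q (1 - (norm (z - x))\<^sup>2 / t\<^sup>2)) has_derivative
     (\<lambda>v. flat (flat_deriv q) (1 - (norm (z - x))\<^sup>2 / t\<^sup>2) * (- 2 * ((z - x) \<bullet> v) / t\<^sup>2))) (at z)"
proof -
  have "((\<lambda>z. 1 - inverse (t\<^sup>2) * ((z - x) \<bullet> (z - x))) has_derivative
     (\<lambda>v. - (inverse (t\<^sup>2) * (2 * ((z - x) \<bullet> v))))) (at z)"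
    by (auto intro!: derivative_eq_intros simp: inner_commute)
  then have "((\<lambda>z. 1 - ((z - x) \<bullet> (z - x)) / t\<^sup>2) has_derivative
     (\<lambda>v. - 2 * ((z - x) \<bullet> v) / t\<^sup>2)) (at z)"
    by (simp add: divide_inverse mult.commute)
  then show ?thesis
    unfolding power2_norm_eq_inner by (rule has_derivative_flat)
qed

text \<open>An explicit formula is needed because the match with the t-derivative of the
  \<open>rho\<close> kernel is verified as a pointwise algebraic identity.\<close>

lemma lap_flat_radial:
  fixes x :: "'a::euclidean_space"
  shows "lap (\<lambda>z. c * flat q (1 - (norm (z - x))\<^sup>2 / t\<^sup>2)) z =
    c * (- 2 / t\<^sup>2) * (DIM('a) * flat (flat_deriv q) (1 - (norm (z - x))\<^sup>2 / t\<^sup>2)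
       - 2 * (norm (z - x))\<^sup>2 / t\<^sup>2 * flat (flat_deriv (flat_deriv q)) (1 - (norm (z - x))\<^sup>2 / t\<^sup>2))"
proof -
  let ?f = "\<lambda>q z. flat q (1 - (norm (z - x))\<^sup>2 / t\<^sup>2)"
  have 1: "pderiv_dir (\<lambda>z. c * ?f q z) b = (\<lambda>z. (c * (-2 / t\<^sup>2)) * (((z - x) \<bullet> b) * ?f (flat_deriv q) z))" for b
  proof
    fix z
    have "((\<lambda>z. c * ?f q z) has_derivative
       (\<lambda>v. c * (?f (flat_deriv q) z * (- 2 * ((z - x) \<bullet> v) / t\<^sup>2)))) (at z)"
      by (intro has_derivative_mult_right has_derivative_flat_radial)
    from pderiv_dir_eqI[OF this]
    show "pderiv_dir (\<lambda>z. c * ?f q z) b z = (c * (-2 / t\<^sup>2)) * (((z - x) \<bullet> b) * ?f (flat_deriv q) z)"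
      by simp
  qed
  have 2: "pderiv_dir (pderiv_dir (\<lambda>z. c * ?f q z) b) b z =
      c * (-2 / t\<^sup>2) * (?f (flat_deriv q) z - 2 * ((z - x) \<bullet> b)\<^sup>2 / t\<^sup>2 * ?f (flat_deriv (flat_deriv q)) z)"
    if b: "b \<in> Basis" for b
  proof -
    have "((\<lambda>z. (c * (-2 / t\<^sup>2)) * (((z - x) \<bullet> b) * ?f (flat_deriv q) z)) has_derivative
      (\<lambda>v. (c * (-2 / t\<^sup>2)) * (((z - x) \<bullet> b) * (?f (flat_deriv (flat_deriv q)) z * (- 2 * ((z - x) \<bullet> v) / t\<^sup>2))
         + (v \<bullet> b) * ?f (flat_deriv q) z))) (at z)"
      by (intro has_derivative_mult_right has_derivative_mult has_derivative_flat_radial)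
         (auto intro!: derivative_eq_intros)
    from pderiv_dir_eqI[OF this, of b]
    have "pderiv_dir (pderiv_dir (\<lambda>z. c * ?f q z) b) b z =
      (c * (-2 / t\<^sup>2)) * (((z - x) \<bullet> b) * (?f (flat_deriv (flat_deriv q)) z * (- 2 * ((z - x) \<bullet> b) / t\<^sup>2))
         + (b \<bullet> b) * ?f (flat_deriv q) z)" unfolding 1 .
    moreover have "C * (A * (F * (- 2 * A / T)) + 1 * G) = C * (G - 2 * A\<^sup>2 / T * F)" for A C F G T :: real
      by (simp add: power2_eq_square)
    ultimately show ?thesis using b by simp
  qed
  have sq: "(\<Sum>b\<in>Basis. ((z - x) \<bullet> b)\<^sup>2) = (norm (z - x))\<^sup>2"
    using euclidean_inner[of "z - x" "z - x"] unfolding power2_norm_eq_inner by (simp only: power2_eq_square)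
  have "lap (\<lambda>z. c * ?f q z) z = (\<Sum>b\<in>Basis. c * (-2 / t\<^sup>2) * (?f (flat_deriv q) z
     - 2 * ((z - x) \<bullet> b)\<^sup>2 / t\<^sup>2 * ?f (flat_deriv (flat_deriv q)) z))"
    unfolding lap_def by (rule sum.cong[OF refl 2])
  also have "\<dots> = c * (-2 / t\<^sup>2) * (DIM('a) * ?f (flat_deriv q) z
     - 2 * (\<Sum>b\<in>Basis. ((z - x) \<bullet> b)\<^sup>2) / t\<^sup>2 * ?f (flat_deriv (flat_deriv q)) z)"
    unfolding sum_distrib_left[symmetric] sum_subtractf
    by (simp only: sum_distrib_left sum_distrib_right sum_divide_distrib sum_constant)
  finally show ?thesis unfolding sq .
qed

text \<open>All smoothness sits in the kernel, so \<open>U\<close> may be merely bounded and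
  measurable: the mean value inequality bounds the difference quotients of \<open>k\<close> by
  \<open>C\<close> on the fixed compact set, and dominated convergence applies.\<close>

lemma DERIV_integral_bounded_kernel:
  fixes k k' :: "real \<Rightarrow> 'a::euclidean_space \<Rightarrow> real"
  assumes U [measurable]: "U \<in> borel_measurable borel" and M: "\<And>z. \<bar>U z\<bar> \<le> M"
    and d: "d > 0"
    and D: "\<And>s z. \<bar>s - t\<bar> < d \<Longrightarrow> ((\<lambda>s. k s z) has_real_derivative k' s z) (at s)"
    and C: "\<And>s z. \<bar>s - t\<bar> < d \<Longrightarrow> \<bar>k' s z\<bar> \<le> C"
    and K: "compact K" "\<And>s z. \<bar>s - t\<bar> < d \<Longrightarrow> z \<notin> K \<Longrightarrow> k s z = 0"
    and kc: "\<And>s. \<bar>s - t\<bar> < d \<Longrightarrow> continuous_on UNIV (k s)"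
    and [measurable]: "k' t \<in> borel_measurable borel"
  shows "((\<lambda>s. \<integral>z. U z * k s z \<partial>lborel) has_real_derivative (\<integral>z. U z * k' t z \<partial>lborel)) (at t)"
  unfolding has_field_derivative_iff tendsto_at_iff_sequentially
proof (intro allI impI)
  fix X :: "nat \<Rightarrow> real" assume X: "\<forall>i. X i \<in> UNIV - {t}" "X \<longlonglongrightarrow> t"
  have int: "integrable lborel (\<lambda>z. U z * k s z)" if "\<bar>s - t\<bar> < d" for s
    by (intro integrable_bounded_times[OF U M] integrable_continuous_compact_support[OF kc K(1)] K(2) that)
  obtain n0 where n0: "\<And>n. n \<ge> n0 \<Longrightarrow> \<bar>X n - t\<bar> < d"
    using X(2) d unfolding LIMSEQ_iff by (metis real_norm_def)
  \<comment> \<open>Dropping finitely many terms puts the whole sequence into the interval on which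
    the hypotheses hold.\<close>
  define Y where "Y n = X (n + n0)" for n
  have Y: "\<bar>Y n - t\<bar> < d" "Y n \<noteq> t" for n using n0 X(1) by (auto simp: Y_def)
  have Yt: "Y \<longlonglongrightarrow> t" unfolding Y_def using X(2) by (rule LIMSEQ_ignore_initial_segment)
  have quot: "((\<integral>z. U z * k (Y n) z \<partial>lborel) - (\<integral>z. U z * k t z \<partial>lborel)) / (Y n - t)
      = (\<integral>z. U z * ((k (Y n) z - k t z) / (Y n - t)) \<partial>lborel)" for n
  proof -
    have "(\<integral>z. U z * k (Y n) z \<partial>lborel) - (\<integral>z. U z * k t z \<partial>lborel) = (\<integral>z. U z * k (Y n) z - U z * k t z \<partial>lborel)"
      using d by (intro Bochner_Integration.integral_diff[symmetric] int Y) auto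
    then show ?thesis
      by (simp add: algebra_simps diff_divide_distrib flip: integral_divide_zero)
  qed
  have km: "k s \<in> borel_measurable borel" if "\<bar>s - t\<bar> < d" for s
    using kc[OF that] by (rule borel_measurable_continuous_onI)
  have bnd: "\<bar>k (Y n) z - k t z\<bar> \<le> C * \<bar>Y n - t\<bar>" for n z
  proof -
    have ball: "\<bar>s - t\<bar> < d" if "s \<in> ball t d" for s
      using that by (simp add: dist_real_def abs_minus_commute)
    have "norm (k (Y n) z - k t z) \<le> C * norm (Y n - t)"
    proof (rule field_differentiable_bound[of "ball t d" "\<lambda>s. k s z" "\<lambda>s. k' s z"])
      show "((\<lambda>s. k s z) has_field_derivative k' s z) (at s within ball t d)" if "s \<in> ball t d" for s
        by (rule has_field_derivative_at_within[OF D[OF ball[OF that]]])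
      show "norm (k' s z) \<le> C" if "s \<in> ball t d" for s
        using C[OF ball[OF that]] by simp
      show "Y n \<in> ball t d" using Y(1)[of n] by (simp add: dist_real_def abs_minus_commute)
    qed (use d in auto)
    then show ?thesis by simp
  qed
  have "(\<lambda>n. \<integral>z. U z * ((k (Y n) z - k t z) / (Y n - t)) \<partial>lborel) \<longlonglongrightarrow> (\<integral>z. U z * k' t z \<partial>lborel)"
  proof (rule integral_dominated_convergence[where w="\<lambda>z. M * C * indicator K z"])
    show "(\<lambda>z. U z * k' t z) \<in> borel_measurable lborel" by measurable
    show "(\<lambda>z. U z * ((k (Y n) z - k t z) / (Y n - t))) \<in> borel_measurable lborel" for n
    proof -
      have [measurable]: "k (Y n) \<in> borel_measurable borel" "k t \<in> borel_measurable borel"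
        using km[OF Y(1)[of n]] km[of t] d by auto
      show ?thesis by measurable
    qed
    show "integrable lborel (\<lambda>z. M * C * indicator K z :: real)"
      using K(1) by (intro integrable_mult_right integrable_real_indicator)
        (auto simp: emeasure_compact_finite[unfolded infinity_ennreal_def] compact_imp_closed borel_closed)
    show "AE z in lborel. (\<lambda>n. U z * ((k (Y n) z - k t z) / (Y n - t))) \<longlonglongrightarrow> U z * k' t z"
    proof (intro AE_I2 tendsto_mult_left)
      fix z
      have "((\<lambda>s. (k s z - k t z) / (s - t)) \<longlongrightarrow> k' t z) (at t)"
        using D[of t z] d by (simp add: has_field_derivative_iff)
      then show "(\<lambda>n. (k (Y n) z - k t z) / (Y n - t)) \<longlonglongrightarrow> k' t z"
        using Y Yt unfolding tendsto_at_iff_sequentially by (auto simp: o_def)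
    qed
    show "AE z in lborel. norm (U z * ((k (Y n) z - k t z) / (Y n - t))) \<le> M * C * indicator K z" for n
    proof (intro AE_I2)
      fix z
      show "norm (U z * ((k (Y n) z - k t z) / (Y n - t))) \<le> M * C * indicator K z"
      proof (cases "z \<in> K")
        case True
        have "\<bar>(k (Y n) z - k t z) / (Y n - t)\<bar> \<le> C"
          using bnd[of n z] Y(2)[of n] by (simp add: abs_divide divide_le_eq)
        then have "\<bar>U z\<bar> * \<bar>(k (Y n) z - k t z) / (Y n - t)\<bar> \<le> M * C"
          using M[of z] C[of t z] d by (intro mult_mono) auto
        then show ?thesis using True by (simp add: abs_mult)
      next
        case False
        then show ?thesis using K(2)[OF Y(1) False] K(2)[of t, OF _ False] d by simp
      qed
    qed
  qed
  then have "(\<lambda>n. ((\<integral>z. U z * k (Y n) z \<partial>lborel) - (\<integral>z. U z * k t z \<partial>lborel)) / (Y n - t)) \<longlonglongrightarrow> (\<integral>z. U z * k' t z \<partial>lborel)"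
    unfolding quot .
  then have "(\<lambda>n. ((\<lambda>s. ((\<integral>z. U z * k s z \<partial>lborel) - (\<integral>z. U z * k t z \<partial>lborel)) / (s - t)) \<circ> X) (n + n0)) \<longlonglongrightarrow> (\<integral>z. U z * k' t z \<partial>lborel)"
    by (simp add: Y_def o_def)
  then show "((\<lambda>s. ((\<integral>z. U z * k s z \<partial>lborel) - (\<integral>z. U z * k t z \<partial>lborel)) / (s - t)) \<circ> X) \<longlonglongrightarrow> (\<integral>z. U z * k' t z \<partial>lborel)"
    by (rule LIMSEQ_offset)
qed

lemma scaled_Theta_eq:
  fixes x z :: "'a::euclidean_space"
  shows "t > 0 \<Longrightarrow> scaled_Theta t x z =
     1 / (t ^ DIM('a) * (\<integral>z. rho0 (z::'a) \<partial>lborel)) * flat 1 (1 - (norm (z - x))\<^sup>2 / t\<^sup>2)"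
  by (simp add: scaled_Theta_def Theta_def power_divide)

lemma scaled_Theta_smooth: "t > 0 \<Longrightarrow> scaled_Theta t x \<in> smooth_class"
proof -
  assume t: "t > 0"
  have "(\<lambda>z. 1 / (t ^ DIM('a) * (\<integral>z. rho0 (z::'a) \<partial>lborel)) * flat 1 (1 - 1 / t\<^sup>2 * (norm (z - x))\<^sup>2)) \<in> smooth_class"
    by (intro smooth_class.mult smooth_class.flat smooth_class.const smooth_class_diff smooth_class_norm_diff_square)
  moreover have "scaled_Theta t x = (\<lambda>z. 1 / (t ^ DIM('a) * (\<integral>z. rho0 (z::'a) \<partial>lborel)) * flat 1 (1 - 1 / t\<^sup>2 * (norm (z - x))\<^sup>2))"
    by (rule ext) (simp add: scaled_Theta_eq[OF t])
  ultimately show ?thesis by simp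
qed

lemma scaled_Theta_outside: "t > 0 \<Longrightarrow> z \<notin> cball x t \<Longrightarrow> scaled_Theta t x z = 0"
  by (simp add: scaled_Theta_def Theta_outside dist_norm norm_minus_commute divide_simps del: scaleR_right_diff_distrib)

lemma scaled_Theta_nonneg: "t > 0 \<Longrightarrow> scaled_Theta t x z \<ge> 0"
  by (simp add: scaled_Theta_def Theta_nonneg)

lemma lap_scaled_Theta:
  fixes x z :: "'a::euclidean_space"
  assumes "t > 0"
  shows "lap (scaled_Theta t x) z = 1 / (t ^ DIM('a) * (\<integral>z. rho0 (z::'a) \<partial>lborel)) * (- 2 / t\<^sup>2) *
      (DIM('a) * flat (flat_deriv 1) (1 - (norm (z - x))\<^sup>2 / t\<^sup>2)
       - 2 * (norm (z - x))\<^sup>2 / t\<^sup>2 * flat (flat_deriv (flat_deriv 1)) (1 - (norm (z - x))\<^sup>2 / t\<^sup>2))"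
proof -
  have "scaled_Theta t x = (\<lambda>z. 1 / (t ^ DIM('a) * (\<integral>z. rho0 (z::'a) \<partial>lborel)) * flat 1 (1 - (norm (z - x))\<^sup>2 / t\<^sup>2))"
    by (rule ext) (rule scaled_Theta_eq[OF assms])
  then show ?thesis by (simp only: lap_flat_radial)
qed

text \<open>The kernels are matched so that \<open>\<partial>\<^sub>t (t\<^sup>-\<^sup>N \<rho>(z/t)) = t \<Delta>(t\<^sup>-\<^sup>N \<Theta>(z/t))\<close>; this replaces
  the spherical mean value formula.\<close>

lemma DERIV_avg:
  fixes u :: "'a::euclidean_space \<Rightarrow> real"
  assumes u [measurable]: "u \<in> borel_measurable borel" and M: "\<And>z. \<bar>u z\<bar> \<le> M" and t: "t > 0"
  shows "((\<lambda>t. avg u t x) has_real_derivative (t * (\<integral>z. u z * lap (scaled_Theta t x) z \<partial>lborel))) (at t)"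
proof -
  define m where "m = (\<integral>z. rho0 (z::'a) \<partial>lborel)"
  have m: "m > 0" unfolding m_def by (rule integral_rho0_pos)
  define n where "n = DIM('a)"
  define F where "F q s z = flat q (1 - (norm (z - x))\<^sup>2 / s\<^sup>2)" for q s and z :: 'a
  define k where "k s z = 2 / m * F (flat_deriv 1) s z / s ^ n" for s and z :: 'a
  define k' where "k' s z = s * lap (scaled_Theta s x) z" for s and z :: 'a
  have k'_eq: "k' s z = s * (1 / (s ^ n * m) * (- 2 / s\<^sup>2) * (n * F (flat_deriv 1) s z
       - 2 * (norm (z - x))\<^sup>2 / s\<^sup>2 * F (flat_deriv (flat_deriv 1)) s z))" if "s > 0" for s z
    unfolding k'_def lap_scaled_Theta[OF that] m_def n_def F_def ..
  have F_out: "F q s z = 0" if "s > 0" "s \<le> r" "z \<notin> cball x r" for q s z r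
  proof -
    have "s \<le> norm (z - x)" using that by (auto simp: dist_norm norm_minus_commute)
    then have "s\<^sup>2 \<le> (norm (z - x))\<^sup>2" using that by (intro power_mono) auto
    then show ?thesis using that by (simp add: F_def flat_eq_0)
  qed
  \<comment> \<open>The t-derivative of the kernel is jointly continuous in radius and point; its
    maximum over this compact set serves as the dominating constant.\<close>
  have cont: "continuous_on ({t/2..3*t/2} \<times> cball x (3*t/2)) (\<lambda>(s,z). s * (1 / (s ^ n * m) * (- 2 / s\<^sup>2) * (n * F (flat_deriv 1) s z
       - 2 * (norm (z - x))\<^sup>2 / s\<^sup>2 * F (flat_deriv (flat_deriv 1)) s z)))"
    unfolding F_def split_beta using t m by (intro continuous_intros) auto
  have "bounded ((\<lambda>(s,z). s * (1 / (s ^ n * m) * (- 2 / s\<^sup>2) * (n * F (flat_deriv 1) s z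
       - 2 * (norm (z - x))\<^sup>2 / s\<^sup>2 * F (flat_deriv (flat_deriv 1)) s z))) ` ({t/2..3*t/2} \<times> cball x (3*t/2)))"
    by (intro compact_imp_bounded compact_continuous_image cont compact_Times) auto
  then obtain C where C0: "C > 0" and C: "\<And>s z. s \<in> {t/2..3*t/2} \<Longrightarrow> z \<in> cball x (3*t/2) \<Longrightarrow>
      \<bar>s * (1 / (s ^ n * m) * (- 2 / s\<^sup>2) * (n * F (flat_deriv 1) s z
       - 2 * (norm (z - x))\<^sup>2 / s\<^sup>2 * F (flat_deriv (flat_deriv 1)) s z))\<bar> \<le> C"
    unfolding bounded_pos by fastforce
  have near: "s > 0" "t/2 \<le> s" "s \<le> 3*t/2" if "\<bar>s - t\<bar> < t/2" for s
    using that t by linarith+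
  have "((\<lambda>s. \<integral>z. u z * k s z \<partial>lborel) has_real_derivative (\<integral>z. u z * k' t z \<partial>lborel)) (at t)"
  proof (rule DERIV_integral_bounded_kernel[OF u M, where d="t/2" and C=C and K="cball x (3*t/2)"])
    fix s z assume "\<bar>s - t\<bar> < t/2"
    note s = near[OF this]
    have D: "((\<lambda>s. F q s z) has_real_derivative F (flat_deriv q) s z * (2 * (norm (z - x))\<^sup>2 / s ^ 3)) (at s)" for q
    proof -
      have "((\<lambda>s. 1 - (norm (z - x))\<^sup>2 / s\<^sup>2) has_real_derivative (2 * (norm (z - x))\<^sup>2 / s ^ 3)) (at s)"
        using s by (auto intro!: derivative_eq_intros simp: field_simps power2_eq_square power3_eq_cube)
      from DERIV_chain2[OF DERIV_flat this] show ?thesis unfolding F_def .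
    qed
    \<comment> \<open>Removes the truncated exponent produced by differentiating s^n; the factor
      \<open>n\<close> covers n = 0.\<close>
    have n: "real n * s ^ (n - Suc 0) = real n * s ^ n / s" using s by (cases n) auto
    have "((\<lambda>s. 2 / m * F (flat_deriv 1) s z / s ^ n) has_real_derivative
       (2 / m * (F (flat_deriv (flat_deriv 1)) s z * (2 * (norm (z - x))\<^sup>2 / s ^ 3)) * s ^ n
         - 2 / m * F (flat_deriv 1) s z * (real n * s ^ (n - Suc 0))) / (s ^ n * s ^ n)) (at s)"
      using s by (intro DERIV_divide DERIV_cmult D) (auto intro!: derivative_eq_intros)
    then show "((\<lambda>s. k s z) has_real_derivative k' s z) (at s)"
      unfolding k_def k'_eq[OF s(1)] n
      by (rule DERIV_cong) (use s m in \<open>simp add: field_simps power2_eq_square power3_eq_cube\<close>)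
    show "\<bar>k' s z\<bar> \<le> C"
    proof (cases "z \<in> cball x (3*t/2)")
      case False
      then show ?thesis using F_out[OF s(1) s(3) False] C0 by (simp add: k'_eq[OF s(1)])
    qed (use C[of s z] s in \<open>auto simp: k'_eq[OF s(1)]\<close>)
    show "k s z = 0" if "z \<notin> cball x (3*t/2)" using F_out[OF s(1) s(3) that] by (simp add: k_def)
    show "continuous_on UNIV (k s)" unfolding k_def F_def using s m by (intro continuous_intros) auto
  next
    have "continuous_on UNIV (k' t)"
      unfolding k'_eq[OF t, abs_def] F_def using t m by (intro continuous_intros) auto
    then show "k' t \<in> borel_measurable borel" by (rule borel_measurable_continuous_onI)
  qed (use t in auto)
  moreover have "(\<integral>z. u z * k' t z \<partial>lborel) = t * (\<integral>z. u z * lap (scaled_Theta t x) z \<partial>lborel)"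
    unfolding k'_def by (simp add: mult.left_commute)
  moreover have "avg u s x = (\<integral>z. u z * k s z \<partial>lborel)" if "s > 0" for s
    unfolding avg_eq_convolution[OF u that] k_def F_def rho_def rho0_def m_def n_def using that
    by (intro Bochner_Integration.integral_cong) (simp_all add: power_divide)
  ultimately show ?thesis
    using has_field_derivative_transform_within_open[of "\<lambda>s. \<integral>z. u z * k s z \<partial>lborel" _ t "{0<..}" "\<lambda>s. avg u s x"] t by simp
qed

section \<open>Mean value inequalities and the maximum principle on a slab\<close>

lemma integrable_avg_cont:
  assumes "continuous_on UNIV u"
  shows "integrable lborel (\<lambda>y. u (x + t *\<^sub>R y) * rho y)"
proof (rule integrable_continuous_times_rho)
  show "continuous_on UNIV (\<lambda>y. u (x + t *\<^sub>R y))"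
    by (rule continuous_on_compose2[OF assms]) (auto intro!: continuous_intros)
qed

text \<open>The kernel vanishes off the unit ball, so a bound for \<open>F\<close> on the ball of
  radius \<open>t\<close> is enough. This admits right-hand sides that blow up at the
  boundary.\<close>

lemma integrable_kernel_local:
  fixes F K :: "'a::euclidean_space \<Rightarrow> real"
  assumes [measurable]: "F \<in> borel_measurable borel" and C: "\<And>y. y \<in> ball x t \<Longrightarrow> \<bar>F y\<bar> \<le> C" and t: "t > 0"
    and K: "integrable lborel K" "\<And>y. norm y \<ge> 1 \<Longrightarrow> K y = 0"
  shows "integrable lborel (\<lambda>y. F (x + t *\<^sub>R y) * K y)"
proof (rule Bochner_Integration.integrable_bound[of lborel "\<lambda>y. C * K y"])
  show "integrable lborel (\<lambda>y. C * K y)" using K by simp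
  have [measurable]: "K \<in> borel_measurable borel" using K by auto
  show "(\<lambda>y. F (x + t *\<^sub>R y) * K y) \<in> borel_measurable lborel" by measurable
  show "AE y in lborel. norm (F (x + t *\<^sub>R y) * K y) \<le> norm (C * K y)"
  proof (intro AE_I2)
    fix y
    show "norm (F (x + t *\<^sub>R y) * K y) \<le> norm (C * K y)"
    proof (cases "norm y < 1")
      case True
      then have "x + t *\<^sub>R y \<in> ball x t" using t by (simp add: dist_norm)
      from C[OF this] show ?thesis by (auto simp: abs_mult intro!: mult_right_mono)
    qed (simp add: K)
  qed
qed

lemma avgT_mono:
  fixes F G :: "'a::euclidean_space \<Rightarrow> real"
  assumes "F \<in> borel_measurable borel" "G \<in> borel_measurable borel" and t: "t > 0"
    and "\<And>y. y \<in> ball x t \<Longrightarrow> \<bar>F y\<bar> \<le> C" "\<And>y. y \<in> ball x t \<Longrightarrow> \<bar>G y\<bar> \<le> D"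
    and le: "\<And>y. y \<in> ball x t \<Longrightarrow> F y \<le> G y"
  shows "avgT F t x \<le> avgT G t x"
  unfolding avgT_def
proof (intro integral_mono)
  fix y
  show "F (x + t *\<^sub>R y) * Theta y \<le> G (x + t *\<^sub>R y) * Theta y"
  proof (cases "norm y < 1")
    case True
    then have "x + t *\<^sub>R y \<in> ball x t" using t by (simp add: dist_norm)
    from le[OF this] show ?thesis by (intro mult_right_mono Theta_nonneg)
  qed (simp add: Theta_outside)
qed (intro integrable_kernel_local[where C=C] integrable_kernel_local[where C=D] assms integrable_Theta Theta_outside; simp)+

definition Theta_mass :: "'a::euclidean_space itself \<Rightarrow> real" where
  "Theta_mass _ = (\<integral>y. Theta (y::'a) \<partial>lborel)"

lemma Theta_mass_pos: "Theta_mass TYPE('a::euclidean_space) > 0"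
  unfolding Theta_mass_def by (rule integral_Theta_pos)

lemma avgT_const: "avgT (\<lambda>_. c) t (x::'a::euclidean_space) = c * Theta_mass TYPE('a)"
  by (simp add: avgT_def Theta_mass_def)

lemma avgT_le:
  fixes F :: "'a::euclidean_space \<Rightarrow> real"
  assumes "F \<in> borel_measurable borel" and t: "t > 0"
    and "\<And>y. y \<in> ball x t \<Longrightarrow> \<bar>F y\<bar> \<le> C" and le: "\<And>y. y \<in> ball x t \<Longrightarrow> F y \<le> B"
  shows "avgT F t x \<le> B * Theta_mass TYPE('a)"
  using avgT_mono[of F "\<lambda>_. B" t x C "\<bar>B\<bar>"] assms by (simp add: avgT_const)

lemma avgT_ge:
  fixes F :: "'a::euclidean_space \<Rightarrow> real"
  assumes "F \<in> borel_measurable borel" and t: "t > 0"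
    and "\<And>y. y \<in> ball x t \<Longrightarrow> \<bar>F y\<bar> \<le> C" and le: "\<And>y. y \<in> ball x t \<Longrightarrow> B \<le> F y"
  shows "B * Theta_mass TYPE('a) \<le> avgT F t x"
  using avgT_mono[of "\<lambda>_. B" F t x "\<bar>B\<bar>" C] assms by (simp add: avgT_const)

lemma avg_mono:
  fixes u v :: "'a::euclidean_space \<Rightarrow> real"
  assumes "continuous_on UNIV u" "continuous_on UNIV v" "t > 0" "\<And>y. y \<in> ball x t \<Longrightarrow> u y \<le> v y"
  shows "avg u t x \<le> avg v t x"
  unfolding avg_def
proof (intro integral_mono integrable_avg_cont assms)
  fix y
  show "u (x + t *\<^sub>R y) * rho y \<le> v (x + t *\<^sub>R y) * rho y"
  proof (cases "norm y < 1")
    case True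
    then have "x + t *\<^sub>R y \<in> ball x t" using assms(3) by (simp add: dist_norm)
    from assms(4)[OF this] show ?thesis by (intro mult_right_mono rho_nonneg)
  qed (simp add: rho_outside)
qed

lemma avg_const: "avg (\<lambda>_. c) t x = c"
  by (simp add: avg_def integral_rho)

lemma avg_diff:
  assumes "continuous_on UNIV u" "continuous_on UNIV v"
  shows "avg (\<lambda>x. u x - v x) t x = avg u t x - avg v t x"
  unfolding avg_def using integrable_avg_cont[OF assms(1), of x t] integrable_avg_cont[OF assms(2), of x t]
  by (simp add: left_diff_distrib)

lemma avg_tendsto:
  fixes u :: "'a::euclidean_space \<Rightarrow> real"
  assumes "continuous_on UNIV u"
  shows "((\<lambda>t. avg u t x) \<longlongrightarrow> u x) (at_right 0)"
proof (rule tendstoI)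
  fix e :: real assume "e > 0"
  then obtain d where d: "d > 0" "\<And>y. dist y x < d \<Longrightarrow> dist (u y) (u x) < e/2"
    using assms[unfolded continuous_on_iff, rule_format, of x "e/2"] by auto
  have "dist (avg u t x) (u x) < e" if "0 < t" "t < d" for t
  proof -
    have b: "u y \<le> u x + e/2 \<and> u x - e/2 \<le> u y" if "y \<in> ball x t" for y
      using d(2)[of y] that \<open>t < d\<close> unfolding dist_real_def mem_ball by (smt (verit) dist_commute field_sum_of_halves)
    have "avg u t x \<le> avg (\<lambda>_. u x + e/2) t x"
      by (rule avg_mono[OF assms]) (use b that in auto)
    moreover have "avg (\<lambda>_. u x - e/2) t x \<le> avg u t x"
      by (rule avg_mono[OF _ assms]) (use b that in auto)
    ultimately show ?thesis using \<open>e > 0\<close> by (simp add: avg_const dist_real_def abs_le_iff)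
  qed
  then show "\<forall>\<^sub>F t in at_right 0. dist (avg u t x) (u x) < e"
    using d(1) by (auto simp: eventually_at_right_field)
qed

text \<open>Averages are differentiated only at positive radii; radius 0 enters through a right
  limit, which by \<open>avg_tendsto\<close> is the value at the centre.\<close>

lemma nonincreasing_from_right_limit:
  fixes f :: "real \<Rightarrow> real"
  assumes D: "\<And>t. 0 < t \<Longrightarrow> t < r \<Longrightarrow> \<exists>D. (f has_real_derivative D) (at t) \<and> D \<le> 0"
    and L: "(f \<longlongrightarrow> l) (at_right 0)" and t: "0 < t" "t < r"
  shows "f t \<le> l"
proof (rule tendsto_lowerbound[OF L])
  have "f t \<le> f s" if "0 < s" "s < t" for s
    by (rule DERIV_nonpos_imp_nonincreasing[of s t f]) (use that t D in auto)
  then show "\<forall>\<^sub>F s in at_right 0. f t \<le> f s"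
    using t(1) by (auto simp: eventually_at_right_field)
qed simp

text \<open>Integration of t b(t) \<le> B t from 0, where the average tends to u(x). Here b(t)
  stands for a \<open>Theta\<close> average of the Laplacian.\<close>

lemma avg_upper:
  fixes u :: "'a::euclidean_space \<Rightarrow> real"
  assumes u: "continuous_on UNIV u"
    and D: "\<And>t. 0 < t \<Longrightarrow> t < r \<Longrightarrow> ((\<lambda>t. avg u t x) has_real_derivative t * b t) (at t)"
    and b: "\<And>t. 0 < t \<Longrightarrow> t < r \<Longrightarrow> b t \<le> B" and t: "0 < t" "t < r"
  shows "avg u t x \<le> u x + B * t\<^sup>2 / 2"
proof -
  have "avg u t x - B * t\<^sup>2 / 2 \<le> u x - B * 0\<^sup>2 / 2"
  proof (rule nonincreasing_from_right_limit[OF _ _ t, where f="\<lambda>t. avg u t x - B * t\<^sup>2 / 2"])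
    fix t assume t: "0 < t" "t < r"
    have "((\<lambda>t. avg u t x - B * t\<^sup>2 / 2) has_real_derivative t * b t - B * t) (at t)"
      by (auto intro!: derivative_eq_intros D t)
    moreover have "t * b t - B * t \<le> 0" using b[OF t] t by (simp add: mult.commute)
    ultimately show "\<exists>D. ((\<lambda>t. avg u t x - B * t\<^sup>2 / 2) has_real_derivative D) (at t) \<and> D \<le> 0" by blast
  next
    show "((\<lambda>t. avg u t x - B * t\<^sup>2 / 2) \<longlongrightarrow> u x - B * 0\<^sup>2 / 2) (at_right 0)"
      by (intro tendsto_intros avg_tendsto u) auto
  qed
  then show ?thesis by simp
qed

lemma avg_uminus: "avg (\<lambda>x. - u x) t x = - avg u t x"
  by (simp add: avg_def)

lemma avg_lower:
  fixes u :: "'a::euclidean_space \<Rightarrow> real"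
  assumes u: "continuous_on UNIV u"
    and D: "\<And>t. 0 < t \<Longrightarrow> t < r \<Longrightarrow> ((\<lambda>t. avg u t x) has_real_derivative t * b t) (at t)"
    and b: "\<And>t. 0 < t \<Longrightarrow> t < r \<Longrightarrow> B \<le> b t" and t: "0 < t" "t < r"
  shows "u x + B * t\<^sup>2 / 2 \<le> avg u t x"
proof -
  have "avg (\<lambda>x. - u x) t x \<le> - u x + (- B) * t\<^sup>2 / 2"
  proof (rule avg_upper[OF _ _ _ t, where b="\<lambda>t. - b t"])
    fix t assume "0 < t" "t < r"
    from DERIV_minus[OF D[OF this]]
    show "((\<lambda>t. avg (\<lambda>x. - u x) t x) has_real_derivative t * - b t) (at t)"
      by (simp add: avg_uminus)
  qed (use u b in \<open>auto intro!: continuous_intros\<close>)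
  then show ?thesis by (simp add: avg_uminus)
qed

text \<open>The integrating factor exp(-K t^2/2) makes the average nonincreasing in t.\<close>

lemma avg_gronwall:
  fixes u :: "'a::euclidean_space \<Rightarrow> real"
  assumes u: "continuous_on UNIV u"
    and D: "\<And>t. 0 < t \<Longrightarrow> t < r \<Longrightarrow> ((\<lambda>t. avg u t x) has_real_derivative t * b t) (at t)"
    and b: "\<And>t. 0 < t \<Longrightarrow> t < r \<Longrightarrow> b t \<le> K * avg u t x" and t: "0 < t" "t < r"
  shows "avg u t x \<le> exp (K * t\<^sup>2 / 2) * u x"
proof -
  have "avg u t x * exp (- (K * t\<^sup>2 / 2)) \<le> u x * exp (- (K * 0\<^sup>2 / 2))"
  proof (rule nonincreasing_from_right_limit[OF _ _ t, where f="\<lambda>t. avg u t x * exp (- (K * t\<^sup>2 / 2))"])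
    fix t assume t: "0 < t" "t < r"
    have "((\<lambda>t. avg u t x * exp (- (K * t\<^sup>2 / 2))) has_real_derivative
        t * (b t - K * avg u t x) * exp (- (K * t\<^sup>2 / 2))) (at t)"
      by (auto intro!: derivative_eq_intros D t simp: algebra_simps)
    moreover have "t * (b t - K * avg u t x) * exp (- (K * t\<^sup>2 / 2)) \<le> 0" using b[OF t] t
      by (simp add: mult_nonneg_nonpos mult_nonpos_nonneg)
    ultimately show "\<exists>D. ((\<lambda>t. avg u t x * exp (- (K * t\<^sup>2 / 2))) has_real_derivative D) (at t) \<and> D \<le> 0" by blast
  next
    show "((\<lambda>t. avg u t x * exp (- (K * t\<^sup>2 / 2))) \<longlongrightarrow> u x * exp (- (K * 0\<^sup>2 / 2))) (at_right 0)"
      by (intro tendsto_intros avg_tendsto u) auto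
  qed
  then show ?thesis by (simp add: exp_minus field_simps)
qed

text \<open>A one-step Harnack inequality. If u(y) \<ge> T, uniform continuity keeps u above T/2 on
  a ball of radius d around y, and this ball alone contributes T/2 * c * V to the average at x,
  hence at least that divided by E to u(x). The threshold depends on the modulus of continuity but
  not on x, which is what makes the argument uniform in the unbounded directions.\<close>

lemma avg_small_imp_small:
  fixes u :: "'a::euclidean_space \<Rightarrow> real"
  assumes u: "uniformly_continuous_on UNIV u" and r: "r > 0" and E: "E > 0" and T: "T > 0"
  shows "\<exists>e>0. \<forall>x. (\<forall>y\<in>ball x r. 0 \<le> u y) \<and> avg u r x \<le> E * u x \<and> u x < e \<longrightarrow> (\<forall>y\<in>cball x (r/2). u y < T)"
proof -
  obtain d0 where d0: "d0 > 0" "\<And>y z. dist y z < d0 \<Longrightarrow> dist (u y) (u z) < T/2"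
    using u[unfolded uniformly_continuous_on_def, rule_format, of "T/2"] T by auto
  define d where "d = min d0 (r/4)"
  have d: "d > 0" "d \<le> r/4" "d \<le> d0" using d0 r by (auto simp: d_def)
  obtain c where c: "c > 0" "\<And>y::'a. norm y \<le> 3/4 \<Longrightarrow> c \<le> rho y" using rho_lower_ex by blast
  define V where "V = measure lborel (ball (0::'a) (d/r))"
  have V: "V > 0" unfolding V_def using d r by (simp add: content_ball_pos)
  have uc: "continuous_on UNIV u" using u by (rule uniformly_continuous_imp_continuous)
  show ?thesis
  proof (intro exI[of _ "T/2 * c * V / E"] conjI allI impI ballI)
    show "T/2 * c * V / E > 0" using T c V E by simp
    fix x y assume x: "(\<forall>y\<in>ball x r. 0 \<le> u y) \<and> avg u r x \<le> E * u x \<and> u x < T/2 * c * V / E" and y: "y \<in> cball x (r/2)"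
    show "u y < T"
    proof (rule ccontr)
      assume "\<not> u y < T"
      \<comment> \<open>The preimage of the ball of radius d around y under v -> x + r v; since d
        \<le> r/4 it lies in |v| \<le> 3/4, where \<open>rho\<close> is bounded below.\<close>
      let ?B = "ball ((1/r) *\<^sub>R (y - x)) (d/r)"
      have "T/2 * c * V = T/2 * c * measure lborel ?B"
        unfolding V_def using d r by (simp add: content_ball)
      also have "\<dots> = (\<integral>v. T/2 * c * indicator ?B v \<partial>lborel)" by simp
      also have "\<dots> \<le> avg u r x" unfolding avg_def
      proof (intro integral_mono integrable_mult_right integrable_real_indicator integrable_avg_cont uc)
        fix v
        show "T/2 * c * indicator ?B v \<le> u (x + r *\<^sub>R v) * rho v"
        proof (cases "v \<in> ?B")
          case True
          have "norm (r *\<^sub>R (v - (1/r) *\<^sub>R (y - x))) < r * (d/r)"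
            using True r unfolding norm_scaleR abs_of_pos[OF r] by (intro mult_strict_left_mono) (auto simp: dist_norm norm_minus_commute)
          moreover have "r *\<^sub>R (v - (1/r) *\<^sub>R (y - x)) = (x + r *\<^sub>R v) - y"
            using r by (simp add: algebra_simps)
          ultimately have dd: "norm ((x + r *\<^sub>R v) - y) < d" using r by simp
          then have "dist (u (x + r *\<^sub>R v)) (u y) < T/2" using d by (intro d0(2)) (simp add: dist_norm)
          then have 1: "u (x + r *\<^sub>R v) \<ge> T/2" using \<open>\<not> u y < T\<close> by (simp add: dist_real_def abs_if split: if_splits)
          have "norm (r *\<^sub>R v) \<le> norm ((x + r *\<^sub>R v) - y) + norm (y - x)"
            using norm_triangle_ineq[of "(x + r *\<^sub>R v) - y" "y - x"] by simp
          also have "\<dots> \<le> r/4 + r/2" using dd d y by (simp add: dist_norm norm_minus_commute)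
          finally have "norm v \<le> 3/4" using r by (simp add: field_simps)
          from mult_mono[OF 1 c(2)[OF this]] show ?thesis using 1 True T c by simp
        next
          case False
          have "0 \<le> u (x + r *\<^sub>R v) * rho v"
          proof (cases "norm v < 1")
            case True
            then have "x + r *\<^sub>R v \<in> ball x r" using r by (simp add: dist_norm)
            then show ?thesis using x rho_nonneg by (intro mult_nonneg_nonneg) auto
          qed (simp add: rho_outside)
          then show ?thesis using False by simp
        qed
      qed (auto simp: emeasure_lborel_ball_finite[unfolded infinity_ennreal_def])
      also have "\<dots> \<le> E * u x" using x by simp
      finally show False using x E by (simp add: field_simps)
    qed
  qed
qed

lemma integral_rho_inner: "(\<integral>y. (y \<bullet> a) * rho (y::'a::euclidean_space) \<partial>lborel) = 0"
proof -
  have "(\<integral>y. (y \<bullet> a) * rho y \<partial>lborel) = (\<integral>y. (\<Sum>b\<in>Basis. (a \<bullet> b) * ((y \<bullet> b) * rho y)) \<partial>lborel)"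
    by (intro Bochner_Integration.integral_cong) (simp_all add: euclidean_inner[of _ a] sum_distrib_right sum_distrib_left ac_simps)
  also have "\<dots> = (\<Sum>b\<in>Basis. (a \<bullet> b) * (\<integral>y. (y \<bullet> b) * rho y \<partial>lborel))"
    by (subst Bochner_Integration.integral_sum)
       (auto intro!: integrable_mult_right integrable_continuous_times_rho continuous_intros)
  finally show ?thesis by (simp add: integral_rho_first_moment)
qed

text \<open>Replaces the second derivative test at a minimum: \<open>w\<close> is touched from below
  by a paraboloid, whose linear part has mean zero against \<open>rho\<close> and whose quadratic
  part is measured by second moments.\<close>

lemma avg_ge_quadratic:
  fixes w :: "'a::euclidean_space \<Rightarrow> real"
  assumes w: "continuous_on UNIV w" and r: "r > 0"
    and le: "\<And>v. norm v < 1 \<Longrightarrow> w x + v \<bullet> a + r\<^sup>2 * (P * (v \<bullet> b)\<^sup>2 - Q * (norm v)\<^sup>2) \<le> w (x + r *\<^sub>R v)"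
  shows "w x + r\<^sup>2 * (P * second_moment b - Q * (\<integral>v. (norm v)\<^sup>2 * rho (v::'a) \<partial>lborel)) \<le> avg w r x"
proof -
  let ?f = "\<lambda>v. w x * rho v + ((v \<bullet> a) * rho v + (r\<^sup>2 * P * ((v \<bullet> b)\<^sup>2 * rho v) - r\<^sup>2 * Q * ((norm v)\<^sup>2 * rho v)))"
  have i: "integrable lborel (\<lambda>v. w x * rho v)" "integrable lborel (\<lambda>v. (v \<bullet> a) * rho v)"
     "integrable lborel (\<lambda>v. r\<^sup>2 * P * ((v \<bullet> b)\<^sup>2 * rho v))" "integrable lborel (\<lambda>v. r\<^sup>2 * Q * ((norm v)\<^sup>2 * rho v))"
    by (intro integrable_mult_right integrable_continuous_times_rho integrable_rho continuous_intros)+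
  have "w x + r\<^sup>2 * (P * second_moment b - Q * (\<integral>v. (norm v)\<^sup>2 * rho (v::'a) \<partial>lborel)) = (\<integral>v. ?f v \<partial>lborel)"
  proof -
    have "(\<integral>v. ?f v \<partial>lborel) = w x * 1 + (0 + (r\<^sup>2 * P * second_moment b - r\<^sup>2 * Q * (\<integral>v. (norm v)\<^sup>2 * rho (v::'a) \<partial>lborel)))"
    proof -
      note d = Bochner_Integration.integrable_diff[OF i(3,4)]
      note e = Bochner_Integration.integrable_add[OF i(2) d]
      show ?thesis
        unfolding Bochner_Integration.integral_add[OF i(1) e] Bochner_Integration.integral_add[OF i(2) d]
          Bochner_Integration.integral_diff[OF i(3,4)]
        by (simp add: integral_rho integral_rho_inner second_moment_def)
    qed
    then show ?thesis by (simp add: algebra_simps)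
  qed
  also have "\<dots> \<le> avg w r x" unfolding avg_def
  proof (intro integral_mono integrable_avg_cont w)
    show "integrable lborel ?f"
      by (intro Bochner_Integration.integrable_add Bochner_Integration.integrable_diff i)
    fix v
    show "?f v \<le> w (x + r *\<^sub>R v) * rho v"
    proof (cases "norm v < 1")
      case True
      from mult_right_mono[OF le[OF this] rho_nonneg[of v]] show ?thesis by (simp add: algebra_simps)
    qed (simp add: rho_outside)
  qed
  finally show ?thesis .
qed

text \<open>Since the slab is unbounded the infimum of \<open>w/g\<close> need not be attained; a small multiple of
  \<open>|x - x\<^sub>*|\<^sup>2\<close> restores a minimum (as in the Omori--Yau principle). The barrier \<open>g\<close> is bent
  downwards in the layer of width \<open>h\<close> at the top, where only the crude bound \<open>C\<close> on the
  potential is available.\<close>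

lemma slab_max_principle:
  fixes w :: "'a::euclidean_space \<Rightarrow> real" and b :: 'a
  assumes b: "b \<in> Basis" and w: "continuous_on UNIV w" and W: "\<And>x. - W \<le> w x"
    and L: "L > 0" and bd: "\<And>x. x \<bullet> b = 0 \<or> x \<bullet> b = L \<Longrightarrow> w x \<ge> 0"
    and lap: "\<And>x. 0 < x \<bullet> b \<Longrightarrow> x \<bullet> b < L \<Longrightarrow> w x < 0 \<Longrightarrow>
      \<exists>pot l. 0 \<le> pot \<and> pot \<le> C \<and> (x \<bullet> b \<le> L - h \<longrightarrow> pot \<le> \<kappa>) \<and>
        ((\<lambda>r. (avg w r x - w x) / r\<^sup>2) \<longlongrightarrow> l) (at_right 0) \<and> l \<le> pot * (- w x)"
    and k: "4 * \<kappa> * L\<^sup>2 \<le> second_moment b" and B: "B \<ge> 0" "2 * C * L\<^sup>2 \<le> B * second_moment b" "2 * B * h\<^sup>2 \<le> L\<^sup>2" and h: "h > 0"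
    and x0: "0 \<le> x0 \<bullet> b" "x0 \<bullet> b \<le> L"
  shows "w x0 \<ge> 0"
proof (rule ccontr)
  assume neg: "\<not> w x0 \<ge> 0"
  define S where "S = {x::'a. 0 \<le> x \<bullet> b \<and> x \<bullet> b \<le> L}"
  \<comment> \<open>Together with 2 B h^2 \<le> L^2 this keeps the barrier between L^2/2 and A on
    the slab.\<close>
  define A where "A = 2 * L\<^sup>2"
  define g where "g s = A - s\<^sup>2 - B * (max 0 (s - (L - h)))\<^sup>2" for s
  define m where "m = second_moment b"
  define m' where "m' = (\<integral>v. (norm v)\<^sup>2 * rho (v::'a) \<partial>lborel)"
  have m: "m > 0" unfolding m_def using b by (rule second_moment_pos)
  have m': "m' \<ge> m" unfolding m_def m'_def second_moment_def
    using Basis_le_norm[OF b] by (intro integral_mono integrable_continuous_times_rho continuous_intros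
      mult_right_mono rho_nonneg) (metis abs_ge_zero power2_abs power_mono)
  have Wpos: "W \<ge> 0" using W[of x0] neg by linarith
  have gb: "L\<^sup>2 / 2 \<le> g s" "g s \<le> A" if "0 \<le> s" "s \<le> L" for s
  proof -
    have "s\<^sup>2 \<le> L\<^sup>2" using that by (intro power_mono) auto
    moreover have "(max 0 (s - (L - h)))\<^sup>2 \<le> h\<^sup>2" using that h by (intro power_mono) auto
    then have "B * (max 0 (s - (L - h)))\<^sup>2 \<le> B * h\<^sup>2" using B(1) by (rule mult_left_mono)
    then have "B * (max 0 (s - (L - h)))\<^sup>2 \<le> L\<^sup>2 / 2" using B(3) by linarith
    ultimately show "L\<^sup>2 / 2 \<le> g s" unfolding g_def A_def by linarith
    have "0 \<le> B * (max 0 (s - (L - h)))\<^sup>2" using B by simp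
    then show "g s \<le> A" unfolding g_def using zero_le_power2[of s] by linarith
  qed
  have L2: "L\<^sup>2 > 0" using L by simp
  have gpos: "g (x \<bullet> b) > 0" if "x \<in> S" for x
  proof -
    have "L\<^sup>2 / 2 \<le> g (x \<bullet> b)" using that by (intro gb) (auto simp: S_def)
    then show ?thesis using L2 by linarith
  qed
  \<comment> \<open>The best constant in w \<ge> -\<tau> g on the slab; the assumed negative value
    of \<open>w\<close> makes it positive.\<close>
  define \<tau> where "\<tau> = (SUP x\<in>S. - w x / g (x \<bullet> b))"
  have bdd: "bdd_above ((\<lambda>x. - w x / g (x \<bullet> b)) ` S)"
  proof (rule bdd_aboveI2)
    fix x assume x: "x \<in> S"
    have "- w x / g (x \<bullet> b) \<le> W / g (x \<bullet> b)" using W[of x] gpos[OF x] by (intro divide_right_mono) auto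
    also have "\<dots> \<le> W / (L\<^sup>2 / 2)" using Wpos gb(1)[of "x \<bullet> b"] gpos[OF x] x L2
      by (intro divide_left_mono) (auto simp: S_def)
    finally show "- w x / g (x \<bullet> b) \<le> W / (L\<^sup>2 / 2)" .
  qed
  have x0S: "x0 \<in> S" using x0 by (simp add: S_def)
  have "- w x0 / g (x0 \<bullet> b) > 0" using neg gpos[OF x0S] by (intro divide_pos_pos) auto
  also have "- w x0 / g (x0 \<bullet> b) \<le> \<tau>" unfolding \<tau>_def by (rule cSUP_upper[OF x0S bdd])
  finally have \<tau>: "\<tau> > 0" .
  define \<phi> where "\<phi> x = w x + \<tau> * g (x \<bullet> b)" for x
  have \<phi>_nn: "\<phi> x \<ge> 0" if "x \<in> S" for x
  proof -
    have "- w x / g (x \<bullet> b) \<le> \<tau>" unfolding \<tau>_def by (rule cSUP_upper[OF that bdd])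
    then have "- w x \<le> \<tau> * g (x \<bullet> b)" using pos_divide_le_eq[OF gpos[OF that]] by blast
    then show ?thesis by (simp add: \<phi>_def)
  qed
  \<comment> \<open>Half of the lower bound \<tau> L^2/2 for \<tau> g: a point with \<phi> <
    \<epsilon> must have w < 0, so it is interior to the slab.\<close>
  define \<epsilon> where "\<epsilon> = \<tau> * L\<^sup>2 / 4"
  have \<epsilon>: "\<epsilon> > 0" using \<tau> L2 by (simp add: \<epsilon>_def)
  have A: "A > 0" using L2 by (simp add: A_def)
  have "\<tau> - \<epsilon> / A < (SUP x\<in>S. - w x / g (x \<bullet> b))" unfolding \<tau>_def[symmetric] using \<epsilon> A by simp
  then obtain xs where xs: "xs \<in> S" "\<tau> - \<epsilon> / A < - w xs / g (xs \<bullet> b)"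
    using less_cSUP_iff[OF _ bdd] x0S by blast
  have \<phi>xs: "\<phi> xs < \<epsilon>"
  proof -
    have gp: "g (xs \<bullet> b) > 0" "g (xs \<bullet> b) \<le> A" using gpos[OF xs(1)] gb(2)[of "xs \<bullet> b"] xs(1) by (auto simp: S_def)
    have "(\<tau> - \<epsilon> / A) * g (xs \<bullet> b) < - w xs" using xs(2) pos_less_divide_eq[OF gp(1)] by blast
    then have "\<phi> xs < \<epsilon> / A * g (xs \<bullet> b)" by (simp add: \<phi>_def algebra_simps)
    also have "\<dots> \<le> \<epsilon> / A * A" using gp \<epsilon> A by (intro mult_left_mono) auto
    finally show ?thesis using A by simp
  qed
  \<comment> \<open>Calibrated so that the penalty costs \<delta> m' = \<tau> m/4, a quarter of the
    concavity gained from the barrier.\<close>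
  define \<delta> where "\<delta> = \<tau> * m / (4 * m')"
  have \<delta>: "\<delta> > 0" using \<tau> m m' by (simp add: \<delta>_def)
  define \<psi> where "\<psi> x = \<phi> x + \<delta> * (norm (x - xs))\<^sup>2" for x
  \<comment> \<open>Beyond this radius the penalty alone is at least \<epsilon>, which exceeds the
    value at the minimiser; the minimum over the compact piece is therefore global on the
    slab.\<close>
  define R where "R = sqrt (\<epsilon> / \<delta>)"
  have R: "R \<ge> 0" "\<delta> * R\<^sup>2 = \<epsilon>" using \<epsilon> \<delta> by (auto simp: R_def)
  have "closed S" unfolding S_def by (intro closed_Collect_conj closed_Collect_le continuous_intros)
  then have cpt: "compact (S \<inter> cball xs R)" by (simp add: closed_Int_compact)
  have gcont: "continuous_on UNIV (\<lambda>x::'a. g (x \<bullet> b))" unfolding g_def by (intro continuous_intros)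
  have "continuous_on UNIV \<psi>" unfolding \<psi>_def \<phi>_def by (intro continuous_intros w gcont)
  then have "continuous_on (S \<inter> cball xs R) \<psi>" by (rule continuous_on_subset) simp
  then obtain x1 where x1: "x1 \<in> S \<inter> cball xs R" "\<And>y. y \<in> S \<inter> cball xs R \<Longrightarrow> \<psi> x1 \<le> \<psi> y"
    using continuous_attains_inf[OF cpt, of \<psi>] xs(1) R(1) by force
  have \<psi>x1: "\<psi> x1 < \<epsilon>" using x1(2)[of xs] xs(1) R(1) \<phi>xs by (simp add: \<psi>_def)
  have min: "\<psi> x1 \<le> \<psi> y" if "y \<in> S" for y
  proof (cases "y \<in> cball xs R")
    case False
    then have "R \<le> norm (y - xs)" by (simp add: dist_norm norm_minus_commute)
    then have "\<epsilon> \<le> \<delta> * (norm (y - xs))\<^sup>2" unfolding R(2)[symmetric] using R \<delta> by (intro mult_left_mono power_mono) auto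
    then show ?thesis using \<psi>x1 \<phi>_nn[OF that] by (simp add: \<psi>_def)
  qed (use x1(2) that in auto)
  have x1S: "x1 \<in> S" using x1 by simp
  have "\<phi> x1 \<le> \<psi> x1" using \<delta> by (simp add: \<psi>_def)
  then have "\<phi> x1 < \<epsilon>" using \<psi>x1 by simp
  moreover have "\<tau> * g (x1 \<bullet> b) \<ge> \<tau> * (L\<^sup>2 / 2)" using gb(1)[of "x1 \<bullet> b"] x1S \<tau> by (simp add: S_def)
  ultimately have wx1: "w x1 < 0" using \<epsilon> by (simp add: \<phi>_def \<epsilon>_def)
  define s1 where "s1 = x1 \<bullet> b"
  have s1: "0 < s1" "s1 < L" using bd[of x1] wx1 x1S by (auto simp: S_def s1_def less_le)
  from lap[of x1] s1 wx1 obtain pot l where pot: "0 \<le> pot" "pot \<le> C" "s1 \<le> L - h \<Longrightarrow> pot \<le> \<kappa>"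
    and lim: "((\<lambda>r. (avg w r x1 - w x1) / r\<^sup>2) \<longlongrightarrow> l) (at_right 0)" and l: "l \<le> pot * (- w x1)"
    unfolding s1_def by blast
  \<comment> \<open>The barrier is not twice differentiable at height L - h. It is replaced by one
    quadratic polynomial that agrees with it at s1 and lies above it nearby, which is the direction
    needed for touching.\<close>
  define B1 where "B1 = (if s1 \<le> L - h then 0 else B)"
  define Q where "Q s = A - s\<^sup>2 - B1 * (s - (L - h))\<^sup>2" for s
  have Q1: "Q s1 = g s1" unfolding Q_def g_def B1_def by auto
  define r0 where "r0 = min (min s1 (L - s1)) (if s1 \<le> L - h then 1 else s1 - (L - h))"
  have r0: "r0 > 0" using s1 by (auto simp: r0_def)
  have Qg: "g s \<le> Q s" if "\<bar>s - s1\<bar> < r0" for s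
  proof (cases "s1 \<le> L - h")
    case True then show ?thesis using B by (simp add: Q_def g_def B1_def)
  next
    case False
    then have "s > L - h" using that by (auto simp: r0_def)
    then show ?thesis by (simp add: Q_def g_def B1_def False)
  qed
  have key: "\<tau> * (1 + B1) * m - \<delta> * m' \<le> (avg w r x1 - w x1) / r\<^sup>2" if r: "0 < r" "r < r0" for r
  proof -
    define a where "a = (r * (\<tau> * (2 * s1 + B1 * 2 * (s1 - (L - h))))) *\<^sub>R b - (r * \<delta> * 2) *\<^sub>R (x1 - xs)"
    have "w x1 + r\<^sup>2 * (\<tau> * (1 + B1) * second_moment b - \<delta> * (\<integral>v. (norm v)\<^sup>2 * rho (v::'a) \<partial>lborel)) \<le> avg w r x1"
    proof (rule avg_ge_quadratic[OF w r(1)])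
      fix v :: 'a assume v: "norm v < 1"
      define y where "y = x1 + r *\<^sub>R v"
      have yb: "y \<bullet> b = s1 + r * (v \<bullet> b)" by (simp add: y_def s1_def inner_add_left)
      have "\<bar>v \<bullet> b\<bar> < 1" using Basis_le_norm[OF b, of v] v by linarith
      then have "r * \<bar>v \<bullet> b\<bar> < r0" using r by (smt (verit) mult_less_cancel_left2)
      then have yr: "\<bar>y \<bullet> b - s1\<bar> < r0" using r by (simp add: yb abs_mult)
      then have yS: "y \<in> S" by (auto simp: S_def r0_def abs_less_iff)
      have "\<psi> x1 \<le> w y + \<tau> * Q (y \<bullet> b) + \<delta> * (norm (y - xs))\<^sup>2"
      proof -
        have "\<tau> * g (y \<bullet> b) \<le> \<tau> * Q (y \<bullet> b)" using Qg[OF yr] \<tau> by (intro mult_left_mono) auto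
        then show ?thesis using min[OF yS] unfolding \<psi>_def \<phi>_def by linarith
      qed
      then have 1: "w x1 + \<tau> * (Q s1 - Q (y \<bullet> b)) + \<delta> * ((norm (x1 - xs))\<^sup>2 - (norm (y - xs))\<^sup>2) \<le> w y"
        using Q1 by (simp add: \<psi>_def \<phi>_def s1_def algebra_simps)
      have 2: "Q s1 - Q (y \<bullet> b) = 2 * s1 * (r * (v \<bullet> b)) + (1 + B1) * (r * (v \<bullet> b))\<^sup>2 + B1 * (2 * (s1 - (L - h)) * (r * (v \<bullet> b)))"
        unfolding Q_def yb by (simp add: power2_eq_square algebra_simps)
      have 3: "(norm (y - xs))\<^sup>2 = (norm (x1 - xs))\<^sup>2 + 2 * r * (v \<bullet> (x1 - xs)) + r\<^sup>2 * (norm v)\<^sup>2"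
        unfolding y_def power2_norm_eq_inner
        by (simp add: inner_add_left inner_add_right inner_diff_left inner_diff_right inner_commute power2_eq_square algebra_simps)
      have "v \<bullet> a = r * (\<tau> * (2 * s1 + B1 * 2 * (s1 - (L - h)))) * (v \<bullet> b) - (r * \<delta> * 2) * (v \<bullet> (x1 - xs))"
        by (simp add: a_def inner_diff_right)
      then show "w x1 + v \<bullet> a + r\<^sup>2 * (\<tau> * (1 + B1) * (v \<bullet> b)\<^sup>2 - \<delta> * (norm v)\<^sup>2) \<le> w (x1 + r *\<^sub>R v)"
        using 1 unfolding 2 3 y_def[symmetric] by (simp add: power_mult_distrib algebra_simps)
    qed
    then show ?thesis unfolding m_def m'_def using r by (simp add: le_divide_eq mult.commute)
  qed
  have "\<tau> * (1 + B1) * m - \<delta> * m' \<le> l"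
    by (rule tendsto_lowerbound[OF lim]) (use key r0 in \<open>auto simp: eventually_at_right_field\<close>)
  moreover have "\<delta> * m' = \<tau> * m / 4" using m m' by (simp add: \<delta>_def)
  moreover have "pot * (- w x1) \<le> pot * (\<tau> * A)"
  proof (rule mult_left_mono[OF _ pot(1)])
    have "- w x1 \<le> \<tau> * g s1" using \<phi>_nn[OF x1S] by (simp add: \<phi>_def s1_def)
    also have "\<dots> \<le> \<tau> * A" using gb(2)[of s1] s1 \<tau> by simp
    finally show "- w x1 \<le> \<tau> * A" .
  qed
  ultimately have main: "\<tau> * (1 + B1) * m - \<tau> * m / 4 \<le> \<tau> * (pot * A)" using l by (simp add: ac_simps)
  \<comment> \<open>Below the layer the left side is 3m/4 while pot * A \<le> m/2. Inside the layer
    it is (3/4 + B) m while pot * A \<le> B m. Both are contradictory.\<close>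
  have fin: "(1 + B1) * m - m / 4 \<le> pot * A"
  proof -
    have "\<tau> * ((1 + B1) * m - m / 4) \<le> \<tau> * (pot * A)" using main by (simp add: algebra_simps)
    then show ?thesis using \<tau> by (simp only: mult_le_cancel_left_pos)
  qed
  show False
  proof (cases "s1 \<le> L - h")
    case True
    have "pot * A \<le> \<kappa> * A" using pot(3)[OF True] A by (intro mult_right_mono) auto
    then show ?thesis using fin True k m by (simp add: B1_def A_def m_def algebra_simps)
  next
    case False
    have "pot * A \<le> C * A" using pot(2) A by (intro mult_right_mono) auto
    then show ?thesis using fin False B(2) m by (simp add: B1_def A_def m_def algebra_simps)
  qed
qed

section \<open>Reflections and a Harnack chain\<close>

text \<open>The tangent line of the convex function t^a at x, usable for either order of x and y.
  Zero arguments are split off because the mean value theorem is applied on positive reals.\<close>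

lemma powr_diff_le:
  fixes x y a :: real
  assumes "0 \<le> x" "0 \<le> y" "1 \<le> a"
  shows "x powr a - y powr a \<le> a * x powr (a - 1) * (x - y)"
proof (cases "x = 0 \<or> y = 0 \<or> x = y")
  case True
  then show ?thesis
  proof (elim disjE)
    assume "y = 0"
    moreover have "x powr a = x powr (a - 1) * x" if "x > 0"
      using powr_add[of x "a - 1" 1] that by simp
    ultimately show ?thesis using assms by (cases "x = 0") (auto simp: mult_right_mono)
  qed (use assms in auto)
next
  case False
  then have xy: "x > 0" "y > 0" "x \<noteq> y" using assms by auto
  have D: "((\<lambda>t. t powr a) has_real_derivative a * t powr (a - 1)) (at t)" if "t > 0" for t
    using that by (rule has_real_derivative_powr)
  show ?thesis
  proof (cases "y < x")
    case True
    obtain z where z: "y < z" "z < x" "x powr a - y powr a = (x - y) * (a * z powr (a - 1))"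
      using MVT2[OF True, of "\<lambda>t. t powr a" "\<lambda>t. a * t powr (a - 1)"] D xy by auto
    have "z powr (a - 1) \<le> x powr (a - 1)" using z xy assms by (intro powr_mono2) auto
    then have "(x - y) * (a * z powr (a - 1)) \<le> (x - y) * (a * x powr (a - 1))"
      using True assms by (intro mult_left_mono) auto
    then show ?thesis using z by (simp add: mult.commute)
  next
    case False
    then have lt: "x < y" using xy by simp
    obtain z where z: "x < z" "z < y" "y powr a - x powr a = (y - x) * (a * z powr (a - 1))"
      using MVT2[OF lt, of "\<lambda>t. t powr a" "\<lambda>t. a * t powr (a - 1)"] D xy by auto
    have "x powr (a - 1) \<le> z powr (a - 1)" using z xy assms by (intro powr_mono2) auto
    then have "(y - x) * (a * x powr (a - 1)) \<le> (y - x) * (a * z powr (a - 1))"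
      using lt assms by (intro mult_left_mono) auto
    then show ?thesis using z by (simp add: algebra_simps)
  qed
qed

text \<open>The equation reads -\<Delta>u = \<open>rhs\<close>. At y = P i the quotient is 0 by the
  convention for division; the P i lie on the boundary, and two-sided bounds are used only at
  positive height.\<close>

definition rhs :: "real \<Rightarrow> nat \<Rightarrow> (nat \<Rightarrow> real) \<Rightarrow> (nat \<Rightarrow> real) \<Rightarrow> (nat \<Rightarrow> 'a::euclidean_space) \<Rightarrow>
    ('a \<Rightarrow> real) \<Rightarrow> 'a \<Rightarrow> real" where
  "rhs p l q s P u y = u y powr p - (\<Sum>i<l. u y powr q i / norm (y - P i) powr s i)"

lemma rhs_measurable [measurable]:
  assumes [measurable]: "u \<in> borel_measurable borel"
  shows "rhs p l q s P u \<in> borel_measurable borel"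
  unfolding rhs_def[abs_def] by measurable

definition reflect :: "'a::euclidean_space \<Rightarrow> real \<Rightarrow> 'a \<Rightarrow> 'a" where
  "reflect b L x = x + (2 * (L - x \<bullet> b)) *\<^sub>R b"

lemma reflect_inner: "b \<in> Basis \<Longrightarrow> reflect b L x \<bullet> b = 2 * L - x \<bullet> b"
  by (simp add: reflect_def inner_add_left)

lemma reflect_affine: "b \<in> Basis \<Longrightarrow> reflect b L (x + t *\<^sub>R y) = reflect b L x + t *\<^sub>R reflect_origin b y"
  by (simp add: reflect_def reflect_origin_def inner_add_left algebra_simps)

lemma continuous_on_reflect [continuous_intros]:
  "continuous_on S f \<Longrightarrow> continuous_on S (\<lambda>x. reflect b L (f x))"
  unfolding reflect_def by (intro continuous_intros)

lemma measurable_reflect [measurable]: "reflect b L \<in> borel_measurable borel"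
  by (intro borel_measurable_continuous_onI continuous_intros)

lemma measurable_reflect_origin [measurable]: "reflect_origin b \<in> borel_measurable borel"
  unfolding reflect_origin_def[abs_def] by measurable

lemma avg_reflect:
  fixes b :: "'a::euclidean_space"
  assumes b: "b \<in> Basis" and [measurable]: "u \<in> borel_measurable borel"
  shows "avg (\<lambda>x. u (reflect b L x)) t x = avg u t (reflect b L x)"
proof -
  have "avg (\<lambda>x. u (reflect b L x)) t x = (\<integral>y. u (reflect b L x + t *\<^sub>R reflect_origin b y) * rho (reflect_origin b y) \<partial>lborel)"
    unfolding avg_def reflect_affine[OF b] by (simp add: rho_cong_norm[OF norm_reflect_origin[OF b]])
  also have "\<dots> = avg u t (reflect b L x)"
    unfolding avg_def by (rule integral_reflect_origin[OF _ b, where F="\<lambda>y. u (reflect b L x + t *\<^sub>R y) * rho y"]) measurable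
  finally show ?thesis .
qed

lemma avgT_reflect:
  fixes b :: "'a::euclidean_space"
  assumes b: "b \<in> Basis" and [measurable]: "u \<in> borel_measurable borel"
  shows "avgT (\<lambda>x. u (reflect b L x)) t x = avgT u t (reflect b L x)"
proof -
  have "avgT (\<lambda>x. u (reflect b L x)) t x = (\<integral>y. u (reflect b L x + t *\<^sub>R reflect_origin b y) * Theta (reflect_origin b y) \<partial>lborel)"
    unfolding avgT_def reflect_affine[OF b] by (simp add: Theta_cong_norm[OF norm_reflect_origin[OF b]])
  also have "\<dots> = avgT u t (reflect b L x)"
    unfolding avgT_def by (rule integral_reflect_origin[OF _ b, where F="\<lambda>y. u (reflect b L x + t *\<^sub>R y) * Theta y"]) measurable
  finally show ?thesis .
qed

text \<open>Near a continuity point the \<open>Theta\<close> averages of \<open>g\<close> are close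
  to g(x) times \<open>Theta_mass\<close>; integrating t times them gives t^2/2. Thus a
  distributional Laplacian yields the pointwise second order information required by the maximum
  principle.\<close>

lemma laplacian_limit:
  fixes u :: "'a::euclidean_space \<Rightarrow> real"
  assumes u: "continuous_on UNIV u" and r: "r > 0" and g: "g \<in> borel_measurable borel" "isCont g x"
    and D: "\<And>t. 0 < t \<Longrightarrow> t < r \<Longrightarrow> ((\<lambda>t. avg u t x) has_real_derivative t * avgT g t x) (at t)"
  shows "((\<lambda>t. (avg u t x - u x) / t\<^sup>2) \<longlongrightarrow> g x * Theta_mass TYPE('a) / 2) (at_right 0)"
proof (rule tendstoI)
  fix e :: real assume e: "e > 0"
  define c where "c = Theta_mass TYPE('a)"
  have c: "c > 0" unfolding c_def by (rule Theta_mass_pos)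
  obtain d where d: "d > 0" "\<And>y. dist y x < d \<Longrightarrow> dist (g y) (g x) < e / c"
    using g(2) e c unfolding continuous_at_eps_delta by (metis divide_pos_pos dist_real_def dist_norm)
  have main: "dist ((avg u t x - u x) / t\<^sup>2) (g x * c / 2) < e" if t: "0 < t" "t < min d r" for t
  proof -
    have gb: "g x - e / c \<le> g y \<and> g y \<le> g x + e / c \<and> \<bar>g y\<bar> \<le> \<bar>g x\<bar> + e / c" if "y \<in> ball x s" "s < min d r" for y s
    proof -
      have "dist (g y) (g x) < e / c" using that by (intro d(2)) (simp add: dist_commute)
      then show ?thesis unfolding dist_real_def by linarith
    qed
    have up: "avgT g s x \<le> (g x + e / c) * c" if "0 < s" "s < min d r" for s
      unfolding c_def[symmetric] using that gb[of _ s] by (intro avgT_le[OF g(1), folded c_def, where C="\<bar>g x\<bar> + e / c"]) auto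
    have lo: "(g x - e / c) * c \<le> avgT g s x" if "0 < s" "s < min d r" for s
      unfolding c_def[symmetric] using that gb[of _ s] by (intro avgT_ge[OF g(1), folded c_def, where C="\<bar>g x\<bar> + e / c"]) auto
    have "avg u t x \<le> u x + (g x + e / c) * c * t\<^sup>2 / 2"
      by (rule avg_upper[OF u D up t]) auto
    moreover have "u x + (g x - e / c) * c * t\<^sup>2 / 2 \<le> avg u t x"
      by (rule avg_lower[OF u D lo t]) auto
    ultimately have "(avg u t x - u x) / t\<^sup>2 \<le> (g x + e / c) * c / 2" "(g x - e / c) * c / 2 \<le> (avg u t x - u x) / t\<^sup>2"
      using t by (auto simp: field_simps)
    moreover have "(g x + e / c) * c / 2 = g x * c / 2 + e / 2" "(g x - e / c) * c / 2 = g x * c / 2 - e / 2"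
      using c by (auto simp: field_simps)
    ultimately show ?thesis unfolding dist_real_def using e by linarith
  qed
  show "\<forall>\<^sub>F t in at_right 0. dist ((avg u t x - u x) / t\<^sup>2) (g x * Theta_mass TYPE('a) / 2) < e"
    unfolding c_def[symmetric] eventually_at_right_field using main d(1) r by (intro exI[of _ "min d r"]) auto
qed

text \<open>From \<Delta>v = g \<le> K v Gronwall bounds the average of v over radius d by a
  multiple of v(x), so smallness spreads from x to distance d/2. A vertical displacement inside the
  slab is cut into such steps. Their number depends only on \<beta> - \<alpha> and d, hence the
  threshold is the same for all tangential positions.\<close>

lemma harnack_chain:
  fixes v g :: "'a::euclidean_space \<Rightarrow> real" and b :: 'a
  assumes b: "b \<in> Basis" and v: "uniformly_continuous_on UNIV v" and g: "g \<in> borel_measurable borel"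
    and d: "d > 0" and K: "K \<ge> 0"
    and loc: "\<And>x y. \<alpha> \<le> x \<bullet> b \<Longrightarrow> x \<bullet> b \<le> \<beta> \<Longrightarrow> y \<in> ball x (2 * d) \<Longrightarrow> 0 \<le> v y \<and> g y \<le> K * v y \<and> \<bar>g y\<bar> \<le> C \<and> v y \<le> C"
    and D: "\<And>x t. \<alpha> \<le> x \<bullet> b \<Longrightarrow> x \<bullet> b \<le> \<beta> \<Longrightarrow> 0 < t \<Longrightarrow> t < 2 * d \<Longrightarrow>
       ((\<lambda>t. avg v t x) has_real_derivative t * avgT g t x) (at t)"
    and T: "T > 0"
  shows "\<exists>e>0. \<forall>x c. \<alpha> \<le> x \<bullet> b \<and> x \<bullet> b \<le> \<beta> \<and> \<alpha> \<le> x \<bullet> b + c \<and> x \<bullet> b + c \<le> \<beta> \<and> v x < e \<longrightarrow> v (x + c *\<^sub>R b) < T"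
proof -
  have vc: "continuous_on UNIV v" using v by (rule uniformly_continuous_imp_continuous)
  have vm: "v \<in> borel_measurable borel" using vc by (rule borel_measurable_continuous_onI)
  \<comment> \<open>The constant is K/2 since 2 Theta \<le> rho turns the \<open>Theta\<close>
    average of v into half of its \<open>rho\<close> average.\<close>
  have har: "avg v d x \<le> exp (K / 2 * d\<^sup>2 / 2) * v x" if x: "\<alpha> \<le> x \<bullet> b" "x \<bullet> b \<le> \<beta>" for x
  proof (rule avg_gronwall[OF vc D[OF x], where r="2 * d"])
    fix t assume t: "0 < t" "t < 2 * d"
    have bl: "y \<in> ball x (2 * d)" if "y \<in> ball x t" for y using that t by simp
    have [measurable]: "v \<in> borel_measurable borel" by (rule vm)
    have "avgT g t x \<le> avgT (\<lambda>y. K * v y) t x"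
      by (rule avgT_mono[OF g _ t(1), where C=C and D="K * C"]) (use loc[OF x bl] K in \<open>auto simp: abs_mult mult_left_mono\<close>)
    also have "\<dots> = K * avgT v t x" by (simp add: avgT_def mult.assoc)
    also have "avgT v t x \<le> avg v t x / 2"
    proof -
      have "avgT v t x \<le> (\<integral>y. v (x + t *\<^sub>R y) * rho y / 2 \<partial>lborel)" unfolding avgT_def
      proof (intro integral_mono)
        show "integrable lborel (\<lambda>y. v (x + t *\<^sub>R y) * Theta y)"
          by (rule integrable_continuous_times_Theta, rule continuous_on_compose2[OF vc]) (auto intro!: continuous_intros)
        show "integrable lborel (\<lambda>y. v (x + t *\<^sub>R y) * rho y / 2)"
          using integrable_avg_cont[OF vc, of x t] by simp
        fix y
        show "v (x + t *\<^sub>R y) * Theta y \<le> v (x + t *\<^sub>R y) * rho y / 2"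
        proof (cases "norm y < 1")
          case True
          then have "x + t *\<^sub>R y \<in> ball x t" using t by (simp add: dist_norm)
          then have "0 \<le> v (x + t *\<^sub>R y)" using loc[OF x bl] by blast
          from mult_left_mono[OF Theta_le_rho[of y] this] show ?thesis by simp
        qed (simp add: Theta_outside rho_outside)
      qed
      then show ?thesis by (simp add: avg_def)
    qed
    finally show "avgT g t x \<le> K / 2 * avg v t x" using K by (simp add: mult_left_mono)
  qed (use d in auto)
  have step: "\<exists>e>0. \<forall>x y. \<alpha> \<le> x \<bullet> b \<and> x \<bullet> b \<le> \<beta> \<and> dist x y \<le> d / 2 \<and> v x < e \<longrightarrow> v y < T" if Tpos: "T > 0" for T
  proof -
    obtain e where e: "e > 0" "\<And>x. (\<forall>y\<in>ball x d. 0 \<le> v y) \<Longrightarrow> avg v d x \<le> exp (K / 2 * d\<^sup>2 / 2) * v x \<Longrightarrow> v x < e \<Longrightarrow> (\<forall>y\<in>cball x (d/2). v y < T)"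
      using avg_small_imp_small[OF v d, of "exp (K / 2 * d\<^sup>2 / 2)" T] Tpos exp_gt_zero by blast
    have "v y < T" if "\<alpha> \<le> x \<bullet> b" "x \<bullet> b \<le> \<beta>" "dist x y \<le> d / 2" "v x < e" for x y
    proof -
      have "0 \<le> v y" if "y \<in> ball x d" for y
        using loc[OF \<open>\<alpha> \<le> x \<bullet> b\<close> \<open>x \<bullet> b \<le> \<beta>\<close>, of y] that d by simp
      then show ?thesis using e(2)[OF _ har[OF that(1,2)] that(4)] that(3) by simp
    qed
    then show ?thesis using e(1) by blast
  qed
  have chain: "\<exists>e>0. \<forall>x c. \<alpha> \<le> x \<bullet> b \<and> x \<bullet> b \<le> \<beta> \<and> \<alpha> \<le> x \<bullet> b + c \<and> x \<bullet> b + c \<le> \<beta> \<and> \<bar>c\<bar> \<le> real n * (d / 2) \<and> v x < e \<longrightarrow> v (x + c *\<^sub>R b) < T"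
    if "T > 0" for T n
    using that
  proof (induction n arbitrary: T)
    case 0
    then show ?case by (intro exI[of _ T]) auto
  next
    case (Suc n)
    obtain e1 where e1: "e1 > 0" "\<And>x y. \<alpha> \<le> x \<bullet> b \<Longrightarrow> x \<bullet> b \<le> \<beta> \<Longrightarrow> dist x y \<le> d / 2 \<Longrightarrow> v x < e1 \<Longrightarrow> v y < T"
      using step[OF Suc.prems] by blast
    obtain e2 where e2: "e2 > 0" "\<And>x c. \<alpha> \<le> x \<bullet> b \<Longrightarrow> x \<bullet> b \<le> \<beta> \<Longrightarrow> \<alpha> \<le> x \<bullet> b + c \<Longrightarrow> x \<bullet> b + c \<le> \<beta> \<Longrightarrow> \<bar>c\<bar> \<le> real n * (d / 2) \<Longrightarrow> v x < e2 \<Longrightarrow> v (x + c *\<^sub>R b) < e1"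
      using Suc.IH[OF e1(1)] by blast
    have "v (x + c *\<^sub>R b) < T" if x: "\<alpha> \<le> x \<bullet> b" "x \<bullet> b \<le> \<beta>" "\<alpha> \<le> x \<bullet> b + c" "x \<bullet> b + c \<le> \<beta>" and c: "\<bar>c\<bar> \<le> real (Suc n) * (d / 2)" and vx: "v x < e2" for x c
    proof -
      \<comment> \<open>The displacement shortened by one step of length d/2 towards 0. It lies
        between 0 and c, so the intermediate point stays in the slab and the induction hypothesis
        applies.\<close>
      define c' where "c' = (if \<bar>c\<bar> \<le> d / 2 then 0 else if c > 0 then c - d / 2 else c + d / 2)"
      have c': "\<bar>c'\<bar> \<le> real n * (d / 2)" "\<bar>c - c'\<bar> \<le> d / 2" "min 0 c \<le> c'" "c' \<le> max 0 c"
        using c d by (auto simp: c'_def algebra_simps abs_if split: if_splits)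
      have "v (x + c' *\<^sub>R b) < e1" using c' x vx by (intro e2(2)) (auto simp: min_def max_def split: if_splits)
      moreover have "dist (x + c' *\<^sub>R b) (x + c *\<^sub>R b) \<le> d / 2"
      proof -
        have "(x + c' *\<^sub>R b) - (x + c *\<^sub>R b) = (c' - c) *\<^sub>R b" by (simp add: algebra_simps)
        then show ?thesis using c'(2) b by (simp add: dist_norm abs_minus_commute)
      qed
      moreover have "(x + c' *\<^sub>R b) \<bullet> b = x \<bullet> b + c'" using b by (simp add: inner_add_left)
      ultimately show ?thesis using c' x by (intro e1(2)[of "x + c' *\<^sub>R b"]) (auto simp: min_def max_def split: if_splits)
    qed
    then show ?case using e2(1) by (intro exI[of _ e2]) auto
  qed
  obtain n :: nat where n: "\<beta> - \<alpha> \<le> real n * (d / 2)"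
    using real_arch_simple[of "(\<beta> - \<alpha>) / (d / 2)"] d by (auto simp: field_simps)
  obtain e where e: "e > 0" "\<And>x c. \<alpha> \<le> x \<bullet> b \<Longrightarrow> x \<bullet> b \<le> \<beta> \<Longrightarrow> \<alpha> \<le> x \<bullet> b + c \<Longrightarrow> x \<bullet> b + c \<le> \<beta> \<Longrightarrow> \<bar>c\<bar> \<le> real n * (d / 2) \<Longrightarrow> v x < e \<Longrightarrow> v (x + c *\<^sub>R b) < T"
    using chain[OF T, of n] by blast
  have "\<bar>c\<bar> \<le> real n * (d / 2)" if "\<alpha> \<le> x \<bullet> b" "x \<bullet> b \<le> \<beta>" "\<alpha> \<le> x \<bullet> b + c" "x \<bullet> b + c \<le> \<beta>" for x c
    using that n by linarith
  then show ?thesis using e by blast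
qed

section \<open>Moving planes\<close>

text \<open>Data shared by the weak solution, which is only measurable, and by its continuous
  representative, so that the bounds on the right-hand side are available for both.\<close>

locale bounded_profile =
  fixes b :: "'a::euclidean_space" and p :: real and l :: nat and q s :: "nat \<Rightarrow> real"
    and P :: "nat \<Rightarrow> 'a" and M :: real and u :: "'a \<Rightarrow> real"
  assumes b: "b \<in> Basis" and p: "p > 1" and q: "\<And>i. i < l \<Longrightarrow> 1 \<le> q i"
    and s: "\<And>i. i < l \<Longrightarrow> 0 < s i" and P: "\<And>i. i < l \<Longrightarrow> P i \<bullet> b = 0"
    and M: "M > 0" and u_nonneg: "\<And>x. 0 \<le> u x" and u_le: "\<And>x. u x \<le> M"
begin

abbreviation "F \<equiv> rhs p l q s P u"

lemma dist_P: "i < l \<Longrightarrow> x \<bullet> b \<le> norm (x - P i)"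
  using Basis_le_norm[OF b, of "x - P i"] P[of i] by (simp add: inner_diff_left)

lemma weight_le:
  assumes "i < l" "0 < h" "h \<le> x \<bullet> b" "0 \<le> A"
  shows "A / norm (x - P i) powr s i \<le> A / h powr s i"
proof -
  have "h powr s i \<le> norm (x - P i) powr s i"
    using dist_P[OF assms(1), of x] assms s[of i] by (intro powr_mono2) auto
  then show ?thesis using assms by (intro divide_left_mono mult_pos_pos) auto
qed

definition rhs_bound :: "real \<Rightarrow> real" where
  "rhs_bound h = M powr p + (\<Sum>i<l. M powr q i / h powr s i)"

lemma weighted_sum_bounds:
  assumes h: "0 < h" "h \<le> x \<bullet> b"
  shows "0 \<le> (\<Sum>i<l. u x powr q i / norm (x - P i) powr s i)"
    "(\<Sum>i<l. u x powr q i / norm (x - P i) powr s i) \<le> (\<Sum>i<l. M powr q i / h powr s i)"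
proof -
  show "0 \<le> (\<Sum>i<l. u x powr q i / norm (x - P i) powr s i)" by (intro sum_nonneg) auto
  show "(\<Sum>i<l. u x powr q i / norm (x - P i) powr s i) \<le> (\<Sum>i<l. M powr q i / h powr s i)"
  proof (intro sum_mono)
    fix i assume "i \<in> {..<l}"
    then have i: "i < l" by simp
    have "u x powr q i / norm (x - P i) powr s i \<le> u x powr q i / h powr s i"
      using weight_le[OF i h] by simp
    also have "\<dots> \<le> M powr q i / h powr s i"
      using u_nonneg u_le q[OF i] by (intro divide_right_mono powr_mono2) auto
    finally show "u x powr q i / norm (x - P i) powr s i \<le> M powr q i / h powr s i" .
  qed
qed

lemma F_bound: "0 < h \<Longrightarrow> h \<le> x \<bullet> b \<Longrightarrow> \<bar>F x\<bar> \<le> rhs_bound h"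
proof -
  assume h: "0 < h" "h \<le> x \<bullet> b"
  have "u x powr p \<le> M powr p" using u_nonneg u_le p by (intro powr_mono2) auto
  then show ?thesis using weighted_sum_bounds[OF h] powr_ge_zero[of "u x" p] unfolding rhs_def rhs_bound_def by linarith
qed

lemma inner_ball: "y \<in> ball x t \<Longrightarrow> x \<bullet> b - t < y \<bullet> b \<and> y \<bullet> b < x \<bullet> b + t"
  using Basis_le_norm[OF b, of "y - x"] by (auto simp: inner_diff_left dist_norm norm_minus_commute abs_le_iff)

end

text \<open>\<open>u_deriv\<close> is the equation tested on balls that stay inside the half-space,
  with no gradient involved. The Dirichlet condition is expressed by vanishing below the boundary
  together with uniform continuity on the whole space.\<close>

locale half_space_profile = bounded_profile +
  assumes u_outside: "\<And>x. x \<bullet> b \<le> 0 \<Longrightarrow> u x = 0"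
    and u_uc: "uniformly_continuous_on UNIV u"
    and u_deriv: "\<And>x t. 0 < t \<Longrightarrow> t < x \<bullet> b \<Longrightarrow>
      ((\<lambda>t. avg u t x) has_real_derivative - (t * avgT (rhs p l q s P u) t x)) (at t)"
begin

abbreviation "R \<equiv> reflect b"

lemma u_cont: "continuous_on UNIV u"
  using u_uc by (rule uniformly_continuous_imp_continuous)

lemma u_meas [measurable]: "u \<in> borel_measurable borel"
  using u_cont by (rule borel_measurable_continuous_onI)

definition harnack_const :: "real \<Rightarrow> real" where
  "harnack_const h = (\<Sum>i<l. q i * M powr (q i - 1) / h powr s i)"

lemma harnack_const_nonneg: "harnack_const h \<ge> 0"
  unfolding harnack_const_def using q by (intro sum_nonneg divide_nonneg_nonneg mult_nonneg_nonneg) (auto intro: order_trans[of 0 1])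

text \<open>The power term only lowers -F. In the weighted terms q \<ge> 1 allows u^q \<le> q
  M^(q-1) u, so they are linear in u once the weights are bounded at height h.\<close>

lemma u_harnack_const: "0 < h \<Longrightarrow> h \<le> x \<bullet> b \<Longrightarrow> - F x \<le> harnack_const h * u x"
proof -
  assume h: "0 < h" "h \<le> x \<bullet> b"
  have "(\<Sum>i<l. u x powr q i / norm (x - P i) powr s i) \<le> (\<Sum>i<l. q i * M powr (q i - 1) / h powr s i * u x)"
  proof (intro sum_mono)
    fix i assume "i \<in> {..<l}"
    then have i: "i < l" by simp
    have qi: "1 \<le> q i" using q i by simp
    have "u x powr q i \<le> q i * u x powr (q i - 1) * u x"
      using powr_diff_le[of "u x" 0 "q i"] u_nonneg qi by simp
    also have "\<dots> \<le> q i * M powr (q i - 1) * u x"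
      using qi u_nonneg[of x] u_le by (intro mult_right_mono mult_left_mono powr_mono2) auto
    finally have "u x powr q i / h powr s i \<le> q i * M powr (q i - 1) * u x / h powr s i"
      by (rule divide_right_mono) simp
    then show "u x powr q i / norm (x - P i) powr s i \<le> q i * M powr (q i - 1) / h powr s i * u x"
      using weight_le[OF i h, of "u x powr q i"] by simp
  qed
  then show ?thesis unfolding rhs_def harnack_const_def sum_distrib_right using powr_ge_zero[of "u x" p] by linarith
qed

definition w :: "real \<Rightarrow> 'a \<Rightarrow> real" where
  "w L x = u (R L x) - u x"

definition g :: "real \<Rightarrow> 'a \<Rightarrow> real" where
  "g L x = F x - F (R L x)"

lemma dist_reflect: "dist (R L x) (R L y) = dist x y"
proof -
  have "R L x - R L y = reflect_origin b (x - y)"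
    by (simp add: reflect_def reflect_origin_def inner_diff_left algebra_simps)
  then show ?thesis by (simp add: dist_norm norm_reflect_origin[OF b])
qed

lemma w_uc: "uniformly_continuous_on UNIV (w L)"
proof -
  have "uniformly_continuous_on UNIV (R L)"
    unfolding uniformly_continuous_on_def using dist_reflect by metis
  moreover have "uniformly_continuous_on (range (R L)) u"
    using u_uc unfolding uniformly_continuous_on_def by fastforce
  ultimately have "uniformly_continuous_on UNIV (\<lambda>x. u (R L x))"
    using uniformly_continuous_on_compose[of UNIV "R L" u] by (simp add: o_def)
  then show ?thesis unfolding w_def[abs_def] using u_uc by (rule uniformly_continuous_on_diff)
qed

lemma w_cont: "continuous_on UNIV (w L)"
  using w_uc by (rule uniformly_continuous_imp_continuous)

lemma w_bounds: "- M \<le> w L x" "w L x \<le> M"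
  unfolding w_def using u_nonneg[of x] u_le[of x] u_nonneg[of "R L x"] u_le[of "R L x"] by linarith+

lemma g_meas [measurable]: "g L \<in> borel_measurable borel"
  unfolding g_def[abs_def] by measurable

text \<open>The two upper limits on \<open>t\<close> keep the ball around x and the ball around its
  mirror image inside the half-space.\<close>

lemma w_deriv:
  assumes t: "0 < t" "t < x \<bullet> b" "t < 2 * L - x \<bullet> b"
  shows "((\<lambda>t. avg (w L) t x) has_real_derivative t * avgT (g L) t x) (at t)"
proof -
  have uR: "continuous_on UNIV (\<lambda>x. u (R L x))"
    by (rule continuous_on_compose2[OF u_cont]) (auto intro!: continuous_intros)
  have avg: "avg (w L) t x = avg u t (R L x) - avg u t x" for t
    unfolding w_def avg_diff[OF uR u_cont] avg_reflect[OF b u_meas] ..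
  have inb: "x \<bullet> b - t \<le> y \<bullet> b" if "y \<in> ball x t" for x y
  proof -
    have "\<bar>(y - x) \<bullet> b\<bar> \<le> norm (y - x)" by (rule Basis_le_norm[OF b])
    then show ?thesis using that by (simp add: inner_diff_left dist_norm norm_minus_commute)
  qed
  have int: "integrable lborel (\<lambda>y. F (x + t *\<^sub>R y) * Theta y)" if "t < x \<bullet> b" for x
    using that inb[of _ x] t by (intro integrable_kernel_local[where C="rhs_bound (x \<bullet> b - t)"] F_bound integrable_Theta Theta_outside) auto
  have int2: "integrable lborel (\<lambda>y. F (R L (x + t *\<^sub>R y)) * Theta y)"
  proof (rule integrable_kernel_local[where F="\<lambda>x. F (R L x)" and C="rhs_bound (2 * L - x \<bullet> b - t)"])
    fix y assume "y \<in> ball x t"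
    then have "R L y \<in> ball (R L x) t" by (simp add: dist_reflect)
    from inb[OF this] show "\<bar>F (R L y)\<bar> \<le> rhs_bound (2 * L - x \<bullet> b - t)"
      using t by (intro F_bound) (auto simp: reflect_inner[OF b])
  qed (use t in \<open>auto intro: integrable_Theta Theta_outside\<close>)
  have "avgT (g L) t x = avgT F t x - avgT (\<lambda>x. F (R L x)) t x"
    unfolding avgT_def g_def left_diff_distrib
    by (rule Bochner_Integration.integral_diff[OF int[OF t(2)] int2])
  then have e: "avgT (g L) t x = avgT F t x - avgT F t (R L x)"
    by (simp add: avgT_reflect[OF b])
  have "((\<lambda>t. avg u t (R L x) - avg u t x) has_real_derivative - (t * avgT F t (R L x)) - - (t * avgT F t x)) (at t)"
    using t by (intro DERIV_diff u_deriv) (auto simp: reflect_inner[OF b])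
  then show ?thesis unfolding avg e by (simp add: algebra_simps)
qed

lemma F_isCont:
  assumes "x \<bullet> b > 0"
  shows "isCont F x"
proof -
  have "isCont u x" using u_cont by (simp add: continuous_on_eq_continuous_at)
  then have 1: "isCont (\<lambda>y. u y powr a) x" if "a > 0" for a
    using that u_nonneg unfolding isCont_def by (intro tendsto_powr') auto
  have 2: "norm (x - P i) > 0" if "i < l" for i using dist_P[OF that, of x] assms by linarith
  show ?thesis unfolding rhs_def[abs_def]
    by (intro continuous_intros isCont_diff isCont_sum isCont_divide ballI 1)
       (use p q 2 in \<open>force+\<close>)
qed

text \<open>Reflecting upwards increases the distance to a boundary point: with c = 2 (L - x
  \<bullet> b) the squared distance grows by 2 c (x \<bullet> b) + c^2. Here it is essential that
  the P i lie on the boundary.\<close>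

lemma weight_reflect:
  assumes "i < l" "0 < x \<bullet> b" "x \<bullet> b \<le> L" "0 \<le> A"
  shows "A / norm (R L x - P i) powr s i \<le> A / norm (x - P i) powr s i"
proof -
  define c where "c = 2 * (L - x \<bullet> b)"
  have c: "c \<ge> 0" using assms by (simp add: c_def)
  have "(norm (x - P i))\<^sup>2 \<le> (norm (R L x - P i))\<^sup>2"
  proof -
    have "R L x - P i = (x - P i) + c *\<^sub>R b" by (simp add: reflect_def c_def)
    then have "(norm (R L x - P i))\<^sup>2 = (norm (x - P i))\<^sup>2 + 2 * c * ((x - P i) \<bullet> b) + c\<^sup>2"
      unfolding power2_norm_eq_inner using b
      by (simp add: inner_add_left inner_add_right inner_commute power2_eq_square algebra_simps)
    then show ?thesis using c assms P[of i] by (simp add: inner_diff_left)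
  qed
  then have "norm (x - P i) \<le> norm (R L x - P i)" by (simp add: abs_le_square_iff[symmetric])
  moreover have "norm (x - P i) > 0" using dist_P[OF assms(1), of x] assms by linarith
  ultimately show ?thesis using assms s[of i]
    by (intro divide_left_mono powr_mono2 mult_pos_pos) auto
qed

text \<open>Where w < 0 the weighted terms are smaller at the mirror image, both through the weight
  and through u, so they help. Only the power term opposes, and convexity makes it at most p u^(p-1)
  times -w.\<close>

lemma g_neg:
  assumes x: "0 < x \<bullet> b" "x \<bullet> b \<le> L" and "w L x < 0"
  shows "g L x \<le> p * u x powr (p - 1) * (- w L x)"
proof -
  have lt: "u (R L x) < u x" using assms by (simp add: w_def)
  have "(\<Sum>i<l. u (R L x) powr q i / norm (R L x - P i) powr s i) \<le> (\<Sum>i<l. u x powr q i / norm (x - P i) powr s i)"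
  proof (intro sum_mono)
    fix i assume "i \<in> {..<l}"
    then have i: "i < l" by simp
    have "u (R L x) powr q i / norm (R L x - P i) powr s i \<le> u (R L x) powr q i / norm (x - P i) powr s i"
      by (rule weight_reflect[OF i x]) simp
    also have "\<dots> \<le> u x powr q i / norm (x - P i) powr s i"
      using lt u_nonneg q[OF i] by (intro divide_right_mono powr_mono2) auto
    finally show "u (R L x) powr q i / norm (R L x - P i) powr s i \<le> u x powr q i / norm (x - P i) powr s i" .
  qed
  moreover have "u x powr p - u (R L x) powr p \<le> p * u x powr (p - 1) * (u x - u (R L x))"
    using u_nonneg p by (intro powr_diff_le) auto
  ultimately show ?thesis unfolding g_def rhs_def w_def by simp
qed

text \<open>Where w \<ge> 0 the roles are exchanged: the power term helps, and the weighted terms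
  are Lipschitz in u above height h. This is the inequality \<Delta>w \<le> K w required for
  Harnack's inequality.\<close>

lemma g_pos:
  assumes h: "0 < h" "h \<le> x \<bullet> b" "x \<bullet> b \<le> L" and "0 \<le> w L x"
  shows "g L x \<le> harnack_const h * w L x"
proof -
  have le: "u x \<le> u (R L x)" using assms by (simp add: w_def)
  have "(\<Sum>i<l. u (R L x) powr q i / norm (R L x - P i) powr s i) - (\<Sum>i<l. u x powr q i / norm (x - P i) powr s i)
    \<le> (\<Sum>i<l. q i * M powr (q i - 1) / h powr s i * w L x)"
    unfolding sum_subtractf[symmetric]
  proof (intro sum_mono)
    fix i assume "i \<in> {..<l}"
    then have i: "i < l" by simp
    have qi: "1 \<le> q i" using q i by simp
    have "u (R L x) powr q i / norm (R L x - P i) powr s i \<le> u (R L x) powr q i / norm (x - P i) powr s i"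
      using h by (intro weight_reflect[OF i]) auto
    then have "u (R L x) powr q i / norm (R L x - P i) powr s i - u x powr q i / norm (x - P i) powr s i
       \<le> (u (R L x) powr q i - u x powr q i) / norm (x - P i) powr s i" by (simp add: diff_divide_distrib)
    also have "\<dots> \<le> (u (R L x) powr q i - u x powr q i) / h powr s i"
      using le u_nonneg qi by (intro weight_le[OF i h(1,2)]) (simp add: powr_mono2)
    also have "\<dots> \<le> q i * M powr (q i - 1) * w L x / h powr s i"
    proof (rule divide_right_mono)
      have "u (R L x) powr q i - u x powr q i \<le> q i * u (R L x) powr (q i - 1) * (u (R L x) - u x)"
        using u_nonneg qi by (intro powr_diff_le) auto
      also have "\<dots> \<le> q i * M powr (q i - 1) * (u (R L x) - u x)"
        using qi u_nonneg u_le le by (intro mult_right_mono mult_left_mono powr_mono2) auto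
      finally show "u (R L x) powr q i - u x powr q i \<le> q i * M powr (q i - 1) * w L x" by (simp add: w_def)
    qed simp
    finally show "u (R L x) powr q i / norm (R L x - P i) powr s i - u x powr q i / norm (x - P i) powr s i
      \<le> q i * M powr (q i - 1) / h powr s i * w L x" by simp
  qed
  moreover have "u x powr p \<le> u (R L x) powr p" using le u_nonneg p by (intro powr_mono2) auto
  ultimately show ?thesis unfolding g_def rhs_def harnack_const_def sum_distrib_right by simp
qed

text \<open>Normalisation of the averaged Laplacian: (avg u t x - u x) / t^2 tends to
  \<open>c0\<close> times \<Delta>u(x).\<close>

definition c0 :: real where "c0 = Theta_mass TYPE('a) / 2"

lemma c0_pos: "c0 > 0" unfolding c0_def using Theta_mass_pos by simp

lemma w_lap:
  assumes "0 < x \<bullet> b" "x \<bullet> b < 2 * L"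
  shows "((\<lambda>t. (avg (w L) t x - w L x) / t\<^sup>2) \<longlongrightarrow> c0 * g L x) (at_right 0)"
proof -
  have "isCont (g L) x" unfolding g_def[abs_def]
  proof (intro isCont_diff F_isCont assms)
    have "isCont (R L) x" by (rule continuous_on_interior[of UNIV]) (auto intro!: continuous_intros)
    moreover have "isCont F (R L x)" using assms by (intro F_isCont) (simp add: reflect_inner[OF b])
    ultimately show "isCont (\<lambda>x. F (R L x)) x" by (rule isCont_o2)
  qed
  then have "((\<lambda>t. (avg (w L) t x - w L x) / t\<^sup>2) \<longlongrightarrow> g L x * Theta_mass TYPE('a) / 2) (at_right 0)"
    using assms by (intro laplacian_limit[OF w_cont, where r="min (x \<bullet> b) (2 * L - x \<bullet> b)"] w_deriv) auto
  then show ?thesis by (simp add: c0_def mult.commute)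
qed

section \<open>Starting and continuing the moving planes\<close>

definition good :: "real \<Rightarrow> bool" where
  "good L \<longleftrightarrow> (\<forall>x. 0 \<le> x \<bullet> b \<longrightarrow> x \<bullet> b \<le> L \<longrightarrow> 0 \<le> w L x)"

text \<open>At a point with w < 0 the potential is at most c0 p M^(p-1) always, and at most c0 p
  a^(p-1) if u < a. Points below the top layer with u \<ge> a are the only ones that the slab
  principle cannot handle, and they are excluded by \<open>big\<close>.\<close>

lemma good_criterion:
  assumes L: "L > 0" and h: "h > 0" and B: "B \<ge> 0" "2 * (c0 * p * M powr (p - 1)) * L\<^sup>2 \<le> B * second_moment b" "2 * B * h\<^sup>2 \<le> L\<^sup>2"
    and k: "4 * (c0 * p * a powr (p - 1)) * L\<^sup>2 \<le> second_moment b"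
    and big: "\<And>x. 0 < x \<bullet> b \<Longrightarrow> x \<bullet> b < L \<Longrightarrow> x \<bullet> b \<le> L - h \<Longrightarrow> u x \<ge> a \<Longrightarrow> 0 \<le> w L x"
  shows "good L"
  unfolding good_def
proof (intro allI impI)
  fix x0 assume x0: "0 \<le> x0 \<bullet> b" "x0 \<bullet> b \<le> L"
  show "0 \<le> w L x0"
  proof (rule slab_max_principle[OF b w_cont w_bounds(1) L _ _ k B h x0])
    fix x assume "x \<bullet> b = 0 \<or> x \<bullet> b = L"
    then show "0 \<le> w L x"
    proof
      assume "x \<bullet> b = 0" then show ?thesis using u_outside[of x] u_nonneg by (simp add: w_def)
    next
      assume "x \<bullet> b = L" then show ?thesis by (simp add: w_def reflect_def)
    qed
  next
    fix x assume x: "0 < x \<bullet> b" "x \<bullet> b < L" and neg: "w L x < 0"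
    define pot where "pot = c0 * p * u x powr (p - 1)"
    have pn: "0 \<le> pot" using c0_pos p by (simp add: pot_def)
    moreover have "pot \<le> c0 * p * M powr (p - 1)" unfolding pot_def
      using c0_pos p u_nonneg u_le by (intro mult_left_mono powr_mono2) auto
    moreover have "pot \<le> c0 * p * a powr (p - 1)" if "x \<bullet> b \<le> L - h"
    proof -
      have "u x < a" using big[OF x that] neg by linarith
      then show ?thesis unfolding pot_def using c0_pos p u_nonneg[of x] by (intro mult_left_mono powr_mono2) auto
    qed
    moreover have "((\<lambda>r. (avg (w L) r x - w L x) / r\<^sup>2) \<longlongrightarrow> c0 * g L x) (at_right 0)"
      using x by (intro w_lap) auto
    moreover have "c0 * g L x \<le> pot * (- w L x)"
      using mult_left_mono[OF g_neg[of x L], of c0] x neg c0_pos by (simp add: pot_def mult.assoc)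
    ultimately show "\<exists>pot lim. 0 \<le> pot \<and> pot \<le> c0 * p * M powr (p - 1) \<and>
        (x \<bullet> b \<le> L - h \<longrightarrow> pot \<le> c0 * p * a powr (p - 1)) \<and>
        ((\<lambda>r. (avg (w L) r x - w L x) / r\<^sup>2) \<longlongrightarrow> lim) (at_right 0) \<and> lim \<le> pot * (- w L x)"
      by blast
  qed
qed

text \<open>With a = M + 1 no point satisfies u \<ge> a, and in a narrow slab even the crude
  potential is small enough. This starts the procedure.\<close>

lemma good_small:
  assumes L: "L > 0" and k: "4 * (c0 * p * (M + 1) powr (p - 1)) * L\<^sup>2 \<le> second_moment b"
  shows "good L"
proof (rule good_criterion[OF L, where h="L / 2" and B="1 / 2" and a="M + 1"])
  have "2 * (c0 * p * M powr (p - 1)) * L\<^sup>2 \<le> 2 * (c0 * p * (M + 1) powr (p - 1)) * L\<^sup>2"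
    using c0_pos p M by (intro mult_right_mono mult_left_mono powr_mono2) auto
  then show "2 * (c0 * p * M powr (p - 1)) * L\<^sup>2 \<le> 1 / 2 * second_moment b" using k by linarith
  show "2 * (1 / 2) * (L / 2)\<^sup>2 \<le> L\<^sup>2" by (simp add: power_divide)
  fix x assume "M + 1 \<le> u x"
  then show "0 \<le> w L x" using u_le[of x] by linarith
qed (use L k in auto)

lemma u_small_near_boundary:
  assumes "e > 0"
  shows "\<exists>h>0. \<forall>x. x \<bullet> b < h \<longrightarrow> u x < e"
proof -
  obtain d where d: "d > 0" "\<And>x y. dist x y < d \<Longrightarrow> dist (u x) (u y) < e"
    using u_uc[unfolded uniformly_continuous_on_def, rule_format, of e] assms by auto
  have "u x < e" if "x \<bullet> b < d" for x
  proof (cases "x \<bullet> b \<le> 0")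
    case True then show ?thesis using u_outside assms by simp
  next
    case False
    define y where "y = x - (x \<bullet> b) *\<^sub>R b"
    have "y \<bullet> b = 0" using b by (simp add: y_def inner_diff_left)
    moreover have "dist x y < d" using b False that by (simp add: y_def dist_norm)
    ultimately have "dist (u x) 0 < e" using d(2)[of x y] u_outside[of y] by simp
    then show ?thesis using u_nonneg[of x] by (simp add: dist_real_def)
  qed
  then show ?thesis using d(1) by blast
qed

text \<open>Balls of radius h0/2 about points of height at least h0 stay above height h0/2, where
  the weights are bounded.\<close>

lemma chain_u:
  assumes "0 < h0" "T > 0"
  shows "\<exists>e>0. \<forall>x c. h0 \<le> x \<bullet> b \<and> x \<bullet> b \<le> \<beta> \<and> h0 \<le> x \<bullet> b + c \<and> x \<bullet> b + c \<le> \<beta> \<and> u x < e \<longrightarrow> u (x + c *\<^sub>R b) < T"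
proof (rule harnack_chain[OF b u_uc, where g="\<lambda>x. - F x" and d="h0 / 4" and K="harnack_const (h0 / 2)" and C="max (rhs_bound (h0 / 2)) M"])
  fix x y assume x: "h0 \<le> x \<bullet> b" and y: "y \<in> ball x (2 * (h0 / 4))"
  have yb: "h0 / 2 \<le> y \<bullet> b" using inner_ball[OF y] x by simp
  then show "0 \<le> u y \<and> - F y \<le> harnack_const (h0 / 2) * u y \<and> \<bar>- F y\<bar> \<le> max (rhs_bound (h0 / 2)) M \<and> u y \<le> max (rhs_bound (h0 / 2)) M"
    using u_nonneg u_harnack_const[OF _ yb] F_bound[OF _ yb] u_le[of y] assms by (auto simp: le_max_iff_disj)
next
  fix x t assume "h0 \<le> x \<bullet> b" "0 < t" "t < 2 * (h0 / 4)"
  then show "((\<lambda>t. avg u t x) has_real_derivative t * avgT (\<lambda>x. - F x) t x) (at t)"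
    using u_deriv[of t x] assms by (simp add: avgT_def)
qed (use assms harnack_const_nonneg in auto)

text \<open>The margins keep the balls of radius 2 d above height hh/2 and below the plane, where
  \<open>good\<close> supplies w \<ge> 0.\<close>

lemma chain_w:
  assumes good: "good L" and h: "0 < hh" "0 < d" "4 * d \<le> hh" "\<beta> \<le> L - 4 * d" and "T > 0"
  shows "\<exists>e>0. \<forall>x c. hh \<le> x \<bullet> b \<and> x \<bullet> b \<le> \<beta> \<and> hh \<le> x \<bullet> b + c \<and> x \<bullet> b + c \<le> \<beta> \<and> w L x < e \<longrightarrow> w L (x + c *\<^sub>R b) < T"
proof (rule harnack_chain[OF b w_uc, where g="g L" and d=d and K="harnack_const (hh / 2)" and C="max (2 * rhs_bound (hh / 2)) M"])
  fix x y assume x: "hh \<le> x \<bullet> b" "x \<bullet> b \<le> \<beta>" and y: "y \<in> ball x (2 * d)"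
  have yb: "hh / 2 \<le> y \<bullet> b" "y \<bullet> b \<le> L" using inner_ball[OF y] x h by auto
  have wy: "0 \<le> w L y" using good yb h by (auto simp: good_def)
  have "hh / 2 \<le> R L y \<bullet> b" using yb by (simp add: reflect_inner[OF b])
  then have "\<bar>g L y\<bar> \<le> 2 * rhs_bound (hh / 2)" unfolding g_def
    using F_bound[OF _ yb(1)] F_bound[of "hh / 2" "R L y"] h by linarith
  then show "0 \<le> w L y \<and> g L y \<le> harnack_const (hh / 2) * w L y \<and> \<bar>g L y\<bar> \<le> max (2 * rhs_bound (hh / 2)) M \<and> w L y \<le> max (2 * rhs_bound (hh / 2)) M"
    using wy g_pos[OF _ yb wy] w_bounds(2)[of L y] h by (auto simp: le_max_iff_disj)
next
  fix x t assume "hh \<le> x \<bullet> b" "x \<bullet> b \<le> \<beta>" "0 < t" "t < 2 * d"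
  then show "((\<lambda>t. avg (w L) t x) has_real_derivative t * avgT (g L) t x) (at t)"
    using h by (intro w_deriv) auto
qed (use assms harnack_const_nonneg in auto)

lemma good_limit:
  assumes L: "L > 0" and below: "\<And>L'. 0 < L' \<Longrightarrow> L' < L \<Longrightarrow> good L'"
  shows "good L"
  unfolding good_def
proof (intro allI impI)
  fix x assume x: "0 \<le> x \<bullet> b" "x \<bullet> b \<le> L"
  show "0 \<le> w L x"
  proof (cases "x \<bullet> b = L")
    case True then show ?thesis by (simp add: w_def reflect_def)
  next
    case False
    have "continuous_on UNIV (\<lambda>L. w L x)" unfolding w_def reflect_def
      by (intro continuous_intros continuous_on_compose2[OF u_cont]) auto
    then have "isCont (\<lambda>L. w L x) L" by (simp add: continuous_on_eq_continuous_at)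
    then have "((\<lambda>L. w L x) \<longlongrightarrow> w L x) (at_left L)"
      unfolding isCont_def by (rule filterlim_mono[OF _ order_refl at_le]) auto
    moreover have "\<forall>\<^sub>F L' in at_left L. 0 \<le> w L' x"
    proof -
      have "0 \<le> w L' x" if "x \<bullet> b < L'" "L' < L" for L'
        using below[of L'] that x by (simp add: good_def)
      then show ?thesis unfolding eventually_at_left_field using x False by (intro exI[of _ "x \<bullet> b"]) auto
    qed
    ultimately show ?thesis by (rule tendsto_lowerbound) simp
  qed
qed

text \<open>Just above the critical height Ls some plane fails at a point x with u(x) \<ge> a below
  the top layer. There w for Ls is almost 0. The chain for w carries this smallness straight down to
  height hh, where u is small as well, so u is small at the mirror image near height 2 Ls. The chain
  for u carries that back down to x, against u(x) \<ge> a. Every threshold is uniform in the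
  tangential position, so no subsequence of translates is extracted.\<close>

lemma all_good:
  assumes "L > 0"
  shows "good L"
proof (rule ccontr)
  assume notgood: "\<not> good L"
  have mub: "second_moment b > 0" using b by (rule second_moment_pos)
  define bad where "bad = {L. L > 0 \<and> \<not> good L}"
  define D where "D = 4 * (c0 * p * (M + 1) powr (p - 1))"
  have D: "D > 0" using c0_pos p M by (simp add: D_def)
  define l0 where "l0 = sqrt (second_moment b / D)"
  have l0: "l0 > 0" using mub D by (simp add: l0_def)
  have small: "good L'" if "0 < L'" "L' \<le> l0" for L'
  proof (rule good_small[OF that(1)])
    have "L'\<^sup>2 \<le> l0\<^sup>2" using that by (intro power_mono) auto
    also have "l0\<^sup>2 = second_moment b / D" using mub D by (simp add: l0_def)
    finally show "4 * (c0 * p * (M + 1) powr (p - 1)) * L'\<^sup>2 \<le> second_moment b"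
      unfolding D_def[symmetric] using D by (simp add: field_simps)
  qed
  define Ls where "Ls = Inf bad"
  have bad_ne: "bad \<noteq> {}" using assms notgood by (auto simp: bad_def)
  have bad_lb: "l0 \<le> L'" if "L' \<in> bad" for L' using small[of L'] that by (force simp: bad_def)
  have "l0 \<le> Ls" unfolding Ls_def using bad_ne bad_lb by (rule cInf_greatest)
  then have Ls: "Ls > 0" using l0 by simp
  have bdd: "bdd_below bad" using bad_lb by (rule bdd_belowI)
  have below: "good L'" if "0 < L'" "L' < Ls" for L'
    using cInf_lower[OF _ bdd, of L'] that unfolding Ls_def[symmetric] by (force simp: bad_def)
  have gLs: "good Ls" using Ls below by (rule good_limit)
  have near: "\<exists>L'. Ls < L' \<and> L' < Ls + e \<and> \<not> good L'" if "e > 0" for e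
  proof -
    have "Inf bad < Ls + e" using that by (simp add: Ls_def)
    then obtain L' where L': "L' \<in> bad" "L' < Ls + e" using cInf_less_iff[OF bad_ne bdd] by blast
    have "Ls \<le> L'" unfolding Ls_def using L'(1) bdd by (rule cInf_lower)
    moreover have "L' \<noteq> Ls" using L'(1) gLs by (auto simp: bad_def)
    ultimately show ?thesis using L' by (force simp: bad_def)
  qed
  \<comment> \<open>The constants must be fixed before the failing plane L' is chosen; \<Lambda>
    bounds all candidates.\<close>
  define \<Lambda> where "\<Lambda> = Ls + 1"
  \<comment> \<open>Solves 4 c0 p a^(p-1) \<Lambda>^2 = second_moment b, the largest potential that
    the criterion tolerates on a slab of height \<Lambda>.\<close>
  define a where "a = (second_moment b / (4 * (c0 * p) * \<Lambda>\<^sup>2)) powr (1 / (p - 1))"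
  have \<Lambda>: "\<Lambda> > 0" using Ls by (simp add: \<Lambda>_def)
  have a: "a > 0" using mub c0_pos p \<Lambda> by (simp add: a_def)
  have ka: "4 * (c0 * p * a powr (p - 1)) * \<Lambda>\<^sup>2 = second_moment b"
    using mub c0_pos p \<Lambda> by (simp add: a_def powr_powr field_simps)
  define C where "C = c0 * p * M powr (p - 1)"
  have C: "C \<ge> 0" using c0_pos p by (simp add: C_def)
  define B where "B = 2 * C * \<Lambda>\<^sup>2 / second_moment b"
  have B: "B \<ge> 0" using C mub by (simp add: B_def)
  \<comment> \<open>Small enough that 2 B h^2 \<le> Ls^2, and at most Ls/2 so that the layer does
    not reach the boundary.\<close>
  define h where "h = Ls / (2 * (B + 1))"
  have h: "h > 0" "h \<le> Ls / 2" using Ls B by (auto simp: h_def field_simps)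
  have Bh: "2 * B * h\<^sup>2 \<le> Ls\<^sup>2"
  proof -
    have "2 * B * h\<^sup>2 = Ls\<^sup>2 * (2 * B / (4 * (B + 1)\<^sup>2))" unfolding h_def power_divide power_mult_distrib by simp
    also have "\<dots> \<le> Ls\<^sup>2 * 1"
    proof (rule mult_left_mono)
      have "2 * B \<le> 4 * (B + 1)\<^sup>2" using B by (simp add: power2_eq_square algebra_simps)
      then show "2 * B / (4 * (B + 1)\<^sup>2) \<le> 1" using B by (simp add: divide_le_eq_1)
    qed simp
    finally show ?thesis by simp
  qed
  obtain h0 where h0: "h0 > 0" "\<And>x. x \<bullet> b < h0 \<Longrightarrow> u x < a" using u_small_near_boundary[OF a] by blast
  obtain e2 where e2: "e2 > 0" "\<And>x c. h0 \<le> x \<bullet> b \<Longrightarrow> x \<bullet> b \<le> 2 * Ls \<Longrightarrow> h0 \<le> x \<bullet> b + c \<Longrightarrow> x \<bullet> b + c \<le> 2 * Ls \<Longrightarrow> u x < e2 \<Longrightarrow> u (x + c *\<^sub>R b) < a"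
    using chain_u[OF h0(1) a, of "2 * Ls"] by blast
  obtain h1 where h1: "h1 > 0" "\<And>x. x \<bullet> b < h1 \<Longrightarrow> u x < e2 / 2" using u_small_near_boundary[of "e2 / 2"] e2(1) by auto
  \<comment> \<open>The height at which the descent stops: below h1, so that u < e2/2 there, and
    below h0, so that the points with u \<ge> a lie above it.\<close>
  define hh where "hh = min (h1 / 2) (min h0 (Ls / 2))"
  have hh: "hh > 0" "hh < h1" "hh \<le> h0" "hh \<le> Ls / 2" using h1(1) h0(1) Ls by (auto simp: hh_def min_def)
  define d where "d = min (hh / 4) (h / 8)"
  have d: "d > 0" "4 * d \<le> hh" "4 * d \<le> h / 2" using hh(1) h(1) by (auto simp: d_def min_def)
  obtain e1 where e1: "e1 > 0" "\<And>x c. hh \<le> x \<bullet> b \<Longrightarrow> x \<bullet> b \<le> Ls - h / 2 \<Longrightarrow> hh \<le> x \<bullet> b + c \<Longrightarrow> x \<bullet> b + c \<le> Ls - h / 2 \<Longrightarrow> w Ls x < e1 \<Longrightarrow> w Ls (x + c *\<^sub>R b) < e2 / 2"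
    using chain_w[OF gLs hh(1) d(1,2), of "Ls - h / 2" "e2 / 2"] d(3) e2(1) by auto
  obtain \<delta> where \<delta>: "\<delta> > 0" "\<And>x y. dist x y < \<delta> \<Longrightarrow> dist (u x) (u y) < e1"
    using u_uc[unfolded uniformly_continuous_on_def, rule_format, of e1] e1(1) by auto
  obtain L' where L': "Ls < L'" "L' < Ls + min (\<delta> / 2) (min (h / 2) 1)" "\<not> good L'"
    using near[of "min (\<delta> / 2) (min (h / 2) 1)"] \<delta>(1) h(1) by auto
  have L'0: "L' > 0" using L'(1) Ls by simp
  have L'\<Lambda>: "L'\<^sup>2 \<le> \<Lambda>\<^sup>2" using L' L'0 by (intro power_mono) (auto simp: \<Lambda>_def)
  have "\<exists>x. 0 < x \<bullet> b \<and> x \<bullet> b < L' \<and> x \<bullet> b \<le> L' - h \<and> a \<le> u x \<and> w L' x < 0"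
  proof (rule ccontr)
    assume no: "\<not> ?thesis"
    have "good L'"
    proof (rule good_criterion[OF L'0 h(1) B])
      have "2 * C * L'\<^sup>2 \<le> 2 * C * \<Lambda>\<^sup>2" using L'\<Lambda> C by (intro mult_left_mono) auto
      then show "2 * (c0 * p * M powr (p - 1)) * L'\<^sup>2 \<le> B * second_moment b" using mub by (simp add: B_def C_def)
      have "Ls\<^sup>2 \<le> L'\<^sup>2" using L' Ls by (intro power_mono) auto
      then show "2 * B * h\<^sup>2 \<le> L'\<^sup>2" using Bh by linarith
      have "4 * (c0 * p * a powr (p - 1)) * L'\<^sup>2 \<le> 4 * (c0 * p * a powr (p - 1)) * \<Lambda>\<^sup>2"
        using L'\<Lambda> c0_pos p by (intro mult_left_mono) auto
      then show "4 * (c0 * p * a powr (p - 1)) * L'\<^sup>2 \<le> second_moment b" using ka by simp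
    qed (use no in force)
    then show False using L'(3) by simp
  qed
  then obtain x where x: "0 < x \<bullet> b" "x \<bullet> b \<le> L' - h" "a \<le> u x" "w L' x < 0" by blast
  have xh0: "h0 \<le> x \<bullet> b" using h0(2)[of x] x(3) by force
  have xtop: "x \<bullet> b \<le> Ls - h / 2" using x(2) L'(2) by auto
  have wx: "w Ls x < e1"
  proof -
    have "R Ls x - R L' x = (2 * (Ls - L')) *\<^sub>R b" by (simp add: reflect_def algebra_simps)
    then have "dist (R Ls x) (R L' x) < \<delta>" using b L' by (simp add: dist_norm)
    from \<delta>(2)[OF this] have "u (R Ls x) < u (R L' x) + e1" by (simp add: dist_real_def abs_less_iff)
    then show ?thesis using x(4) by (simp add: w_def)
  qed
  \<comment> \<open>The point of height hh on the vertical line through x. Both w and u are below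
    e2/2 at y, hence u < e2 at its mirror image.\<close>
  define y where "y = x + (hh - x \<bullet> b) *\<^sub>R b"
  have yb: "y \<bullet> b = hh" using b by (simp add: y_def inner_add_left)
  have "w Ls y < e2 / 2" unfolding y_def
    using xh0 xtop hh h wx by (intro e1(2)) auto
  moreover have "u y < e2 / 2" using h1(2)[of y] yb hh by simp
  ultimately have uz: "u (R Ls y) < e2" by (simp add: w_def)
  define z where "z = R Ls y"
  have zb: "z \<bullet> b = 2 * Ls - hh" by (simp add: z_def reflect_inner[OF b] yb)
  have xz: "x = z + (x \<bullet> b - z \<bullet> b) *\<^sub>R b"
    unfolding zb by (simp add: z_def reflect_def yb y_def inner_add_left b algebra_simps flip: scaleR_add_left scaleR_left_diff_distrib)
  have "u (z + (x \<bullet> b - z \<bullet> b) *\<^sub>R b) < a"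
    using uz xh0 xtop hh h Ls zb by (intro e2(2)) (auto simp: z_def[symmetric])
  then show False using xz x(3) by simp
qed

lemma u_mono:
  assumes "0 \<le> x \<bullet> b" "0 \<le> t"
  shows "u x \<le> u (x + t *\<^sub>R b)"
proof (cases "t = 0")
  case False
  have "good (x \<bullet> b + t / 2)" using assms False by (intro all_good) auto
  then have "0 \<le> w (x \<bullet> b + t / 2) x" using assms unfolding good_def by auto
  then show ?thesis by (simp add: w_def reflect_def)
qed simp

end

section \<open>The limit at infinite height\<close>

lemma integral_uminus_euclidean:
  fixes F :: "'a::euclidean_space \<Rightarrow> real"
  assumes [measurable]: "F \<in> borel_measurable borel"
  shows "(\<integral>y. F (- y) \<partial>lborel) = (\<integral>z. F z \<partial>lborel)"
proof -
  have "lborel = distr lborel borel (\<lambda>y::'a. - y)"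
    using lborel_affine[of "-1" "0::'a"] by (simp add: density_1)
  then show ?thesis using integral_distr[of "\<lambda>y. - y" lborel borel F] by simp
qed

text \<open>Green's formula without derivatives: a - avg a acts like -\<Delta>a, and the double
  difference is the symmetric bilinear form. It follows by Fubini, translation invariance and the
  evenness of \<open>rho\<close>.\<close>

lemma avg_symmetric_form:
  fixes a f :: "'a::euclidean_space \<Rightarrow> real"
  assumes a: "continuous_on UNIV a" and f: "continuous_on UNIV f" and K: "compact K" "\<And>x. x \<notin> K \<Longrightarrow> f x = 0"
  shows "integrable lborel (\<lambda>v. rho v * (\<integral>x. (a x - a (x + r *\<^sub>R v)) * (f x - f (x + r *\<^sub>R v)) \<partial>lborel))" (is ?int)
    and "(\<integral>v. rho v * (\<integral>x. (a x - a (x + r *\<^sub>R v)) * (f x - f (x + r *\<^sub>R v)) \<partial>lborel) \<partial>lborel)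
       = 2 * (\<integral>x. (a x - avg a r x) * f x \<partial>lborel)" (is ?eq)
    and "integrable lborel (\<lambda>x. (a x - avg a r x) * f x)"
proof -
  define G where "G y = (\<integral>x. a (x + y) * f x \<partial>lborel)" for y
  define I where "I = (\<integral>x. a x * f x \<partial>lborel)"
  have a_sh: "continuous_on UNIV (\<lambda>x. a (x + y))" for y
    by (rule continuous_on_compose2[OF a]) (auto intro!: continuous_intros)
  have f_sh: "continuous_on UNIV (\<lambda>x. f (x + y))" for y
    by (rule continuous_on_compose2[OF f]) (auto intro!: continuous_intros)
  have int1: "integrable lborel (\<lambda>x. a (x + y) * f x)" for y
    by (rule integrable_continuous_compact_support[OF _ K(1)])
       (auto intro!: continuous_intros a_sh f K(2))
  have int0: "integrable lborel (\<lambda>x. a x * f x)" using int1[of 0] by simp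
  have [measurable]: "a \<in> borel_measurable borel" "f \<in> borel_measurable borel"
    using a f by (auto intro: borel_measurable_continuous_onI)
  have int2: "integrable lborel (\<lambda>x. a x * f (x + y))" for y
    using integrable_translate[OF int1[of "- y"], of y] by simp
  have int3: "integrable lborel (\<lambda>x. a (x + y) * f (x + y))" for y
    using integrable_translate[OF int0, of y] by simp
  have Dy: "(\<integral>x. (a x - a (x + y)) * (f x - f (x + y)) \<partial>lborel) = 2 * I - G y - G (- y)" for y
  proof -
    have "(\<integral>x. (a x - a (x + y)) * (f x - f (x + y)) \<partial>lborel)
       = (\<integral>x. (a x * f x - a (x + y) * f x) - (a x * f (x + y) - a (x + y) * f (x + y)) \<partial>lborel)"
      by (intro Bochner_Integration.integral_cong) (simp_all add: algebra_simps)
    also have "\<dots> = (I - G y) - ((\<integral>x. a x * f (x + y) \<partial>lborel) - (\<integral>x. a (x + y) * f (x + y) \<partial>lborel))"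
      unfolding I_def G_def
      by (simp only: Bochner_Integration.integral_diff Bochner_Integration.integrable_diff int0 int1 int2 int3)
    also have "(\<integral>x. a (x + y) * f (x + y) \<partial>lborel) = I"
      unfolding I_def by (rule integral_translate[of "\<lambda>x. a x * f x"]) measurable
    also have "(\<integral>x. a x * f (x + y) \<partial>lborel) = G (- y)"
      unfolding G_def using integral_translate[of "\<lambda>x. a (x - y) * f x" y] by simp
    finally show ?thesis by simp
  qed
  have cont2: "continuous_on UNIV (\<lambda>(x, v). rho v * (a (x + r *\<^sub>R v) * f x))"
    unfolding split_beta
    by (intro continuous_intros continuous_on_compose2[OF a] continuous_on_compose2[OF f]
        continuous_on_compose2[OF continuous_on_rho[of UNIV]]) auto
  have prod_int: "integrable (lborel \<Otimes>\<^sub>M lborel) (\<lambda>(x, v). rho v * (a (x + r *\<^sub>R v) * f x))"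
    unfolding lborel_prod
  proof (rule integrable_continuous_compact_support[OF cont2])
    show "compact (K \<times> cball (0::'a) 1)" using K by (intro compact_Times) auto
    fix xv :: "'a \<times> 'a" assume "xv \<notin> K \<times> cball 0 1"
    then have "fst xv \<notin> K \<or> norm (snd xv) \<ge> 1" by (cases xv) auto
    then show "(\<lambda>(x, v). rho v * (a (x + r *\<^sub>R v) * f x)) xv = 0"
      using K(2)[of "fst xv"] rho_outside[of "snd xv"] by (auto simp: split_beta)
  qed
  have fub: "(\<integral>v. (\<integral>x. rho v * (a (x + r *\<^sub>R v) * f x) \<partial>lborel) \<partial>lborel)
     = (\<integral>x. (\<integral>v. rho v * (a (x + r *\<^sub>R v) * f x) \<partial>lborel) \<partial>lborel)"
    using lborel_pair.Fubini_integral[of "\<lambda>x v. rho v * (a (x + r *\<^sub>R v) * f x)"] prod_int by simp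
  have intG: "integrable lborel (\<lambda>v. rho v * G (r *\<^sub>R v))"
    using lborel_pair.integrable_snd[OF prod_int] by (simp add: G_def)
  have intGm: "integrable lborel (\<lambda>v. rho v * G (- (r *\<^sub>R v)))"
    and eqGm: "(\<integral>v. rho v * G (- (r *\<^sub>R v)) \<partial>lborel) = (\<integral>v. rho v * G (r *\<^sub>R v) \<partial>lborel)"
  proof -
    have m: "(\<lambda>v. rho v * G (r *\<^sub>R v)) \<in> borel_measurable borel" using intG by auto
    have rm: "rho (- v) = rho v" for v :: 'a by (rule rho_cong_norm) simp
    have "lborel = distr lborel borel (\<lambda>y::'a. - y)"
      using lborel_affine[of "-1" "0::'a"] by (simp add: density_1)
    then have "integrable lborel (\<lambda>v. rho (- v) * G (r *\<^sub>R (- v)))"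
      using intG integrable_distr_eq[of "\<lambda>y. - y" lborel borel "\<lambda>v. rho v * G (r *\<^sub>R v)"] m by simp
    then show "integrable lborel (\<lambda>v. rho v * G (- (r *\<^sub>R v)))" by (simp add: rm)
    show "(\<integral>v. rho v * G (- (r *\<^sub>R v)) \<partial>lborel) = (\<integral>v. rho v * G (r *\<^sub>R v) \<partial>lborel)"
      using integral_uminus_euclidean[OF m] by (simp add: rm)
  qed
  have e: "rho v * (\<integral>x. (a x - a (x + r *\<^sub>R v)) * (f x - f (x + r *\<^sub>R v)) \<partial>lborel)
      = (2 * I * rho v - rho v * G (r *\<^sub>R v)) - rho v * G (- (r *\<^sub>R v))" for v
    unfolding Dy by (simp add: algebra_simps)
  show ?int unfolding e by (intro Bochner_Integration.integrable_diff integrable_mult_right integrable_rho intG intGm)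
  have avg_f: "(\<integral>v. rho v * (a (x + r *\<^sub>R v) * f x) \<partial>lborel) = avg a r x * f x" for x
    unfolding avg_def by (subst integral_mult_left_zero[symmetric]) (simp add: ac_simps)
  have avg_int: "integrable lborel (\<lambda>x. avg a r x * f x)"
    using lborel_pair.integrable_fst[OF prod_int] by (simp add: avg_f)
  have avg_eq: "(\<integral>x. avg a r x * f x \<partial>lborel) = (\<integral>v. rho v * G (r *\<^sub>R v) \<partial>lborel)"
    using fub unfolding avg_f by (simp add: G_def)
  have "(\<integral>v. (2 * I * rho v - rho v * G (r *\<^sub>R v)) - rho v * G (- (r *\<^sub>R v)) \<partial>lborel)
     = 2 * I * 1 - (\<integral>v. rho v * G (r *\<^sub>R v) \<partial>lborel) - (\<integral>v. rho v * G (r *\<^sub>R v) \<partial>lborel)"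
  proof -
    have i: "integrable lborel (\<lambda>v. 2 * I * rho v)" by (intro integrable_mult_right integrable_rho)
    show ?thesis
      unfolding Bochner_Integration.integral_diff[OF Bochner_Integration.integrable_diff[OF i intG] intGm]
        Bochner_Integration.integral_diff[OF i intG]
      by (simp add: integral_rho eqGm)
  qed
  moreover have "(\<integral>x. (a x - avg a r x) * f x \<partial>lborel) = I - (\<integral>v. rho v * G (r *\<^sub>R v) \<partial>lborel)"
    unfolding left_diff_distrib I_def avg_eq[symmetric] by (rule Bochner_Integration.integral_diff[OF int0 avg_int])
  ultimately show ?eq unfolding e by simp
  show "integrable lborel (\<lambda>x. (a x - avg a r x) * f x)"
    unfolding left_diff_distrib by (rule Bochner_Integration.integrable_diff[OF int0 avg_int])
qed

text \<open>With A = v e the left side equals (A - A')^2 - (A' z - A z')^2/(z z'); the second square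
  is dropped, and (A - A')^2 is expanded so that the difference of v meets the test function v
  e^2.\<close>

lemma picone_discrete:
  fixes z z' v v' e e' :: real
  assumes "z > 0" "z' > 0"
  shows "(z - z') * ((v * e)\<^sup>2 / z - (v' * e')\<^sup>2 / z') \<le> (v - v') * (v * e\<^sup>2 - v' * e'\<^sup>2) + v * v' * (e - e')\<^sup>2"
proof -
  define A where "A = v * e"
  define A' where "A' = v' * e'"
  have "(z - z') * (A\<^sup>2 / z - A'\<^sup>2 / z') = (A - A')\<^sup>2 - (A' * z - A * z')\<^sup>2 / (z * z')"
    using assms by (simp add: field_simps power2_eq_square)
  also have "\<dots> \<le> (A - A')\<^sup>2" using assms by simp
  also have "\<dots> = (v - v') * (v * e\<^sup>2 - v' * e'\<^sup>2) + v * v' * (e - e')\<^sup>2"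
    by (simp add: A_def A'_def power2_eq_square algebra_simps)
  finally show ?thesis by (simp add: A_def A'_def)
qed

text \<open>Piecewise linear: only differences of the cutoff enter the discrete form, so a Lipschitz
  bound 1/R takes the place of smoothness.\<close>

definition cutoff :: "real \<Rightarrow> 'a::euclidean_space \<Rightarrow> real" where
  "cutoff R x = max 0 (min 1 (2 - norm x / R))"

lemma cutoff_cont: "R > 0 \<Longrightarrow> continuous_on S (cutoff R)"
  unfolding cutoff_def[abs_def] by (intro continuous_intros) auto

lemma cutoff_outside: "R > 0 \<Longrightarrow> norm x \<ge> 2 * R \<Longrightarrow> cutoff R x = 0"
  by (auto simp: cutoff_def max_def min_def field_simps)

lemma cutoff_inside: "R > 0 \<Longrightarrow> norm x \<le> R \<Longrightarrow> cutoff R x = 1"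
  by (auto simp: cutoff_def max_def min_def field_simps)

lemma cutoff_lipschitz: "R > 0 \<Longrightarrow> \<bar>cutoff R x - cutoff R y\<bar> \<le> norm (x - y) / R"
proof -
  assume R: "R > 0"
  have "\<bar>cutoff R x - cutoff R y\<bar> \<le> \<bar>norm x / R - norm y / R\<bar>"
    unfolding cutoff_def by (auto simp: max_def min_def)
  also have "\<dots> = \<bar>norm x - norm y\<bar> / R" using R by (simp add: diff_divide_distrib[symmetric])
  also have "\<dots> \<le> norm (x - y) / R" using R norm_triangle_ineq3[of x y] by (intro divide_right_mono) auto
  finally show ?thesis .
qed

context half_space_profile
begin

section \<open>The vertical limit and its equation\<close>

lemma u_mono': "0 \<le> t \<Longrightarrow> u x \<le> u (x + t *\<^sub>R b)"
  using u_mono[of x t] u_outside[of x] u_nonneg[of "x + t *\<^sub>R b"] by (cases "0 \<le> x \<bullet> b") auto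

definition v :: "'a \<Rightarrow> real" where
  "v x = (SUP n::nat. u (x + real n *\<^sub>R b))"

lemma v_lim: "(\<lambda>n. u (x + real n *\<^sub>R b)) \<longlonglongrightarrow> v x"
  unfolding v_def
proof (rule LIMSEQ_incseq_SUP)
  show "bdd_above (range (\<lambda>n. u (x + real n *\<^sub>R b)))" using u_le by (intro bdd_aboveI2)
  show "incseq (\<lambda>n. u (x + real n *\<^sub>R b))"
  proof (rule incseq_SucI)
    fix n
    show "u (x + real n *\<^sub>R b) \<le> u (x + real (Suc n) *\<^sub>R b)"
      using u_mono'[of 1 "x + real n *\<^sub>R b"] by (simp add: algebra_simps)
  qed
qed

lemma u_le_v: "u (x + t *\<^sub>R b) \<le> v x"
proof -
  obtain n :: nat where n: "t \<le> real n" using real_arch_simple by blast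
  have "u (x + t *\<^sub>R b) \<le> u (x + t *\<^sub>R b + (real n - t) *\<^sub>R b)" using n by (intro u_mono') simp
  also have "\<dots> = u (x + real n *\<^sub>R b)" by (simp add: algebra_simps)
  also have "\<dots> \<le> v x" unfolding v_def using u_le by (intro cSUP_upper bdd_aboveI2) auto
  finally show ?thesis .
qed

lemma v_bounds: "0 \<le> v x" "v x \<le> M"
proof -
  show "0 \<le> v x" using u_le_v[of x 0] u_nonneg[of x] by simp
  show "v x \<le> M" using v_lim by (rule LIMSEQ_le_const2) (use u_le in auto)
qed

lemma v_shift: "v (x + t *\<^sub>R b) = v x"
proof -
  have le: "v (x + t *\<^sub>R b) \<le> v x" for x t
  proof (rule LIMSEQ_le_const2[OF v_lim])
    have "u (x + t *\<^sub>R b + real n *\<^sub>R b) \<le> v x" for n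
      using u_le_v[of x "t + real n"] by (simp add: algebra_simps)
    then show "\<exists>N. \<forall>n\<ge>N. u (x + t *\<^sub>R b + real n *\<^sub>R b) \<le> v x" by blast
  qed
  show ?thesis using le[of x t] le[of "x + t *\<^sub>R b" "- t"] by simp
qed

text \<open>All vertical translates of u share its modulus of continuity, so the limit inherits it;
  strictness is lost in the limit.\<close>

lemma v_modulus:
  assumes "e > 0"
  shows "\<exists>d>0. \<forall>x y. dist x y < d \<longrightarrow> \<bar>u x - u y\<bar> \<le> e \<and> \<bar>v x - v y\<bar> \<le> e"
proof -
  obtain d where d: "d > 0" "\<And>x y. dist x y < d \<Longrightarrow> dist (u x) (u y) < e"
    using u_uc[unfolded uniformly_continuous_on_def, rule_format, of e] assms by auto
  have "\<bar>v x - v y\<bar> \<le> e" if "dist x y < d" for x y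
  proof (rule LIMSEQ_le_const2)
    show "(\<lambda>n. \<bar>u (x + real n *\<^sub>R b) - u (y + real n *\<^sub>R b)\<bar>) \<longlonglongrightarrow> \<bar>v x - v y\<bar>"
      by (intro tendsto_intros v_lim)
    have "\<bar>u (x + real n *\<^sub>R b) - u (y + real n *\<^sub>R b)\<bar> \<le> e" for n
      using d(2)[of "x + real n *\<^sub>R b" "y + real n *\<^sub>R b"] that by (simp add: dist_real_def)
    then show "\<exists>N. \<forall>n\<ge>N. \<bar>u (x + real n *\<^sub>R b) - u (y + real n *\<^sub>R b)\<bar> \<le> e" by blast
  qed
  then show ?thesis using d by (intro exI[of _ d]) (auto simp: dist_real_def less_imp_le)
qed

lemma v_uc: "uniformly_continuous_on UNIV v"
  unfolding uniformly_continuous_on_def dist_real_def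
proof (intro allI impI)
  fix e :: real assume "e > 0"
  then obtain d where "d > 0" "\<And>x y. dist x y < d \<Longrightarrow> \<bar>v x - v y\<bar> \<le> e / 2" using v_modulus[of "e / 2"] by auto
  then show "\<exists>d>0. \<forall>x\<in>UNIV. \<forall>x'\<in>UNIV. dist x' x < d \<longrightarrow> \<bar>v x' - v x\<bar> < e"
    using \<open>e > 0\<close> by (intro exI[of _ d]) force
qed

lemma v_cont: "continuous_on UNIV v"
  using v_uc by (rule uniformly_continuous_imp_continuous)

lemma avg_u_lim: "(\<lambda>n. avg u r (x + real n *\<^sub>R b)) \<longlonglongrightarrow> avg v r x"
  unfolding avg_def
proof (rule integral_dominated_convergence[where w="\<lambda>y. M * rho y"])
  have [measurable]: "v \<in> borel_measurable borel" using v_cont by (rule borel_measurable_continuous_onI)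
  show "(\<lambda>y. v (x + r *\<^sub>R y) * rho y) \<in> borel_measurable lborel" by measurable
  show "(\<lambda>y. u (x + real n *\<^sub>R b + r *\<^sub>R y) * rho y) \<in> borel_measurable lborel" for n by measurable
  show "integrable lborel (\<lambda>y. M * rho (y::'a))" by (intro integrable_mult_right integrable_rho)
  show "AE y in lborel. (\<lambda>n. u (x + real n *\<^sub>R b + r *\<^sub>R y) * rho y) \<longlonglongrightarrow> v (x + r *\<^sub>R y) * rho y"
    using v_lim[of "x + r *\<^sub>R y" for y] by (intro AE_I2 tendsto_mult_right) (simp add: algebra_simps)
  show "AE y in lborel. norm (u (x + real n *\<^sub>R b + r *\<^sub>R y) * rho y) \<le> M * rho y" for n
    using u_nonneg u_le by (intro AE_I2) (simp add: abs_mult mult_right_mono rho_nonneg)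
qed

definition weight_bound :: "real \<Rightarrow> real" where
  "weight_bound h = (\<Sum>i<l. M powr q i / h powr s i)"

text \<open>Each s i is positive, so the weights decay with the height; this is how the singular
  terms disappear from the limit equation.\<close>

lemma weight_bound_lim: "(\<lambda>n. weight_bound (h + real n)) \<longlonglongrightarrow> 0"
proof -
  have 1: "filterlim (\<lambda>n. h + real n) at_top sequentially"
    by (intro filterlim_tendsto_add_at_top[OF tendsto_const] filterlim_real_sequentially)
  have "(\<lambda>n. M powr q i / (h + real n) powr s i) \<longlonglongrightarrow> 0" if "i < l" for i
  proof -
    have "(\<lambda>n. (h + real n) powr (- s i)) \<longlonglongrightarrow> 0"
      using s[OF that] by (intro tendsto_neg_powr 1) auto
    then have "(\<lambda>n. M powr q i * (h + real n) powr (- s i)) \<longlonglongrightarrow> M powr q i * 0" by (intro tendsto_intros)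
    then show ?thesis by (simp add: powr_minus divide_inverse)
  qed
  then have "(\<lambda>n. weight_bound (h + real n)) \<longlonglongrightarrow> (\<Sum>i<l. 0)" unfolding weight_bound_def by (intro tendsto_sum) auto
  then show ?thesis by simp
qed

lemma F_lower: "0 < h \<Longrightarrow> h \<le> x \<bullet> b \<Longrightarrow> u x powr p - weight_bound h \<le> F x"
  using weighted_sum_bounds(2)[of h x] by (simp add: rhs_def weight_bound_def)

lemma F_upper: "F x \<le> u x powr p"
  unfolding rhs_def by (simp add: sum_nonneg)

text \<open>The averaged form of -\<Delta>u \<le> u^p, where the weighted terms are discarded by
  their sign. The converse bound below pays for them with \<open>weight_bound\<close>.\<close>

lemma u_avg_ge:
  assumes r: "0 < r" "r < r1" "r1 \<le> x \<bullet> b" and bd: "\<And>y. y \<in> ball x r1 \<Longrightarrow> u y powr p \<le> B"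
  shows "u x - avg u r x \<le> c0 * r\<^sup>2 * B"
proof -
  have "u x + (- B * Theta_mass TYPE('a)) * r\<^sup>2 / 2 \<le> avg u r x"
  proof (rule avg_lower[OF u_cont _ _ r(1,2)])
    fix t assume t: "0 < t" "t < r1"
    show "((\<lambda>t. avg u t x) has_real_derivative t * (- avgT F t x)) (at t)"
      using u_deriv[of t x] t r by simp
    have "avgT F t x \<le> B * Theta_mass TYPE('a)"
    proof (rule avgT_le[where C="rhs_bound (x \<bullet> b - t)"])
      fix y assume y: "y \<in> ball x t"
      show "\<bar>F y\<bar> \<le> rhs_bound (x \<bullet> b - t)" using inner_ball[OF y] t r by (intro F_bound) auto
      show "F y \<le> B" using F_upper[of y] bd[of y] y t by simp
    qed (use t in auto)
    then show "- B * Theta_mass TYPE('a) \<le> - avgT F t x" by simp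
  qed
  then show ?thesis by (simp add: c0_def algebra_simps)
qed

lemma u_avg_le:
  assumes r: "0 < r" "r < r1" "r1 < x \<bullet> b" and bd: "\<And>y. y \<in> ball x r1 \<Longrightarrow> B \<le> u y powr p"
  shows "c0 * r\<^sup>2 * (B - weight_bound (x \<bullet> b - r1)) \<le> u x - avg u r x"
proof -
  define B' where "B' = B - weight_bound (x \<bullet> b - r1)"
  have "avg u r x \<le> u x + (- B' * Theta_mass TYPE('a)) * r\<^sup>2 / 2"
  proof (rule avg_upper[OF u_cont _ _ r(1,2)])
    fix t assume t: "0 < t" "t < r1"
    show "((\<lambda>t. avg u t x) has_real_derivative t * (- avgT F t x)) (at t)"
      using u_deriv[of t x] t r by simp
    have "B' * Theta_mass TYPE('a) \<le> avgT F t x"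
    proof (rule avgT_ge[where C="rhs_bound (x \<bullet> b - r1)"])
      fix y assume y: "y \<in> ball x t"
      have yb: "0 < x \<bullet> b - r1" "x \<bullet> b - r1 \<le> y \<bullet> b" using inner_ball[OF y] t r by auto
      show "\<bar>F y\<bar> \<le> rhs_bound (x \<bullet> b - r1)" by (rule F_bound[OF yb])
      show "B' \<le> F y" using F_lower[OF yb] bd[of y] y t by (simp add: B'_def)
    qed (use t in auto)
    then show "- avgT F t x \<le> - B' * Theta_mass TYPE('a)" by simp
  qed
  then show ?thesis unfolding B'_def[symmetric] by (simp add: c0_def algebra_simps)
qed

lemma powr_modulus:
  assumes "e > 0"
  shows "\<exists>d>0. \<forall>x y. dist x y < d \<longrightarrow> u y powr p \<le> u x powr p + e"
proof -
  define K where "K = p * M powr (p - 1)"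
  have K: "K > 0" using p M by (simp add: K_def)
  obtain d where d: "d > 0" "\<And>x y. dist x y < d \<Longrightarrow> \<bar>u x - u y\<bar> \<le> e / K"
    using v_modulus[of "e / K"] assms K by auto
  have "u y powr p \<le> u x powr p + e" if "dist x y < d" for x y
  proof (cases "u y \<le> u x")
    case True
    then have "u y powr p \<le> u x powr p" using u_nonneg p by (intro powr_mono2) auto
    then show ?thesis using assms by simp
  next
    case False
    have "u y powr p - u x powr p \<le> p * u y powr (p - 1) * (u y - u x)"
      using u_nonneg p by (intro powr_diff_le) auto
    also have "\<dots> \<le> K * (u y - u x)" unfolding K_def
      using u_nonneg u_le p False by (intro mult_right_mono mult_left_mono powr_mono2) auto
    also have "\<dots> \<le> K * (e / K)" using d(2)[OF that] K by (intro mult_left_mono) auto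
    finally show ?thesis using K by simp
  qed
  then show ?thesis using d(1) by blast
qed

lemma v_powr_lim: "(\<lambda>n. u (x + real n *\<^sub>R b) powr p) \<longlonglongrightarrow> v x powr p"
  using p u_nonneg by (intro tendsto_powr'[OF v_lim tendsto_const]) auto

lemma shift_inner: "(x + t *\<^sub>R b) \<bullet> b = x \<bullet> b + t"
  using b by (simp add: inner_add_left)

text \<open>The averaged form of -\<Delta>v = v^p. Bounds for u at x + n b are passed to the limit:
  oscillation of u^p inside the ball costs e, and the weights tend to 0.\<close>

lemma v_avg_bounds:
  assumes e: "e > 0" and d: "\<And>x y. dist x y < d \<Longrightarrow> u y powr p \<le> u x powr p + e" and r: "0 < r" "r < d"
  shows "c0 * r\<^sup>2 * (v x powr p - e) \<le> v x - avg v r x" "v x - avg v r x \<le> c0 * r\<^sup>2 * (v x powr p + e)"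
proof -
  \<comment> \<open>The estimates for u need a radius strictly larger than r on which the
    oscillation is still at most e.\<close>
  obtain r1 where r1: "r < r1" "r1 < d" using dense r by blast
  obtain n0 :: nat where n0: "r1 - x \<bullet> b < real n0" using reals_Archimedean2 by blast
  have lim: "(\<lambda>n. u (x + real n *\<^sub>R b) - avg u r (x + real n *\<^sub>R b)) \<longlonglongrightarrow> v x - avg v r x"
    by (intro tendsto_intros v_lim avg_u_lim)
  show "v x - avg v r x \<le> c0 * r\<^sup>2 * (v x powr p + e)"
  proof (rule LIMSEQ_le[OF lim])
    show "(\<lambda>n. c0 * r\<^sup>2 * (u (x + real n *\<^sub>R b) powr p + e)) \<longlonglongrightarrow> c0 * r\<^sup>2 * (v x powr p + e)"
      by (intro tendsto_intros v_powr_lim)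
    have "u (x + real n *\<^sub>R b) - avg u r (x + real n *\<^sub>R b) \<le> c0 * r\<^sup>2 * (u (x + real n *\<^sub>R b) powr p + e)" if "n \<ge> n0" for n
      using r r1 n0 that by (intro u_avg_ge[of r r1] d) (auto simp: shift_inner)
    then show "\<exists>N. \<forall>n\<ge>N. u (x + real n *\<^sub>R b) - avg u r (x + real n *\<^sub>R b) \<le> c0 * r\<^sup>2 * (u (x + real n *\<^sub>R b) powr p + e)"
      by blast
  qed
  show "c0 * r\<^sup>2 * (v x powr p - e) \<le> v x - avg v r x"
  proof (rule LIMSEQ_le[OF _ lim])
    have "(\<lambda>n. c0 * r\<^sup>2 * (u (x + real n *\<^sub>R b) powr p - e - weight_bound (x \<bullet> b - r1 + real n))) \<longlonglongrightarrow> c0 * r\<^sup>2 * (v x powr p - e - 0)"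
      by (intro tendsto_intros v_powr_lim weight_bound_lim)
    then show "(\<lambda>n. c0 * r\<^sup>2 * (u (x + real n *\<^sub>R b) powr p - e - weight_bound (x \<bullet> b - r1 + real n))) \<longlonglongrightarrow> c0 * r\<^sup>2 * (v x powr p - e)"
      by simp
    have "c0 * r\<^sup>2 * (u (x + real n *\<^sub>R b) powr p - e - weight_bound (x \<bullet> b - r1 + real n)) \<le> u (x + real n *\<^sub>R b) - avg u r (x + real n *\<^sub>R b)" if "n \<ge> n0" for n
    proof -
      let ?x = "x + real n *\<^sub>R b"
      have "c0 * r\<^sup>2 * (u ?x powr p - e - weight_bound (?x \<bullet> b - r1)) \<le> u ?x - avg u r ?x"
      proof (rule u_avg_le)
        fix y assume "y \<in> ball ?x r1"
        then have "u ?x powr p \<le> u y powr p + e" using r1 by (intro d) (simp add: dist_commute)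
        then show "u ?x powr p - e \<le> u y powr p" by simp
      qed (use r r1 n0 that in \<open>auto simp: shift_inner\<close>)
      moreover have "?x \<bullet> b - r1 = x \<bullet> b - r1 + real n" by (simp add: shift_inner)
      ultimately show ?thesis by simp
    qed
    then show "\<exists>N. \<forall>n\<ge>N. c0 * r\<^sup>2 * (u (x + real n *\<^sub>R b) powr p - e - weight_bound (x \<bullet> b - r1 + real n)) \<le> u (x + real n *\<^sub>R b) - avg u r (x + real n *\<^sub>R b)"
      by blast
  qed
qed

text \<open>Here the radius is arbitrary: high enough up every ball fits into the half-space, and
  u^p \<ge> 0 needs no control of oscillation.\<close>

lemma v_superharmonic:
  assumes r: "0 < r"
  shows "avg v r x \<le> v x"
proof -
  define r1 where "r1 = r + 1"
  obtain n0 :: nat where n0: "r1 - x \<bullet> b < real n0" using reals_Archimedean2 by blast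
  have "0 \<le> v x - avg v r x"
  proof (rule LIMSEQ_le)
    have "(\<lambda>n. c0 * r\<^sup>2 * (0 - weight_bound (x \<bullet> b - r1 + real n))) \<longlonglongrightarrow> c0 * r\<^sup>2 * (0 - 0)"
      by (intro tendsto_intros weight_bound_lim)
    then show "(\<lambda>n. c0 * r\<^sup>2 * (0 - weight_bound (x \<bullet> b - r1 + real n))) \<longlonglongrightarrow> 0" by simp
    show "(\<lambda>n. u (x + real n *\<^sub>R b) - avg u r (x + real n *\<^sub>R b)) \<longlonglongrightarrow> v x - avg v r x"
      by (intro tendsto_intros v_lim avg_u_lim)
    have "c0 * r\<^sup>2 * (0 - weight_bound (x \<bullet> b - r1 + real n)) \<le> u (x + real n *\<^sub>R b) - avg u r (x + real n *\<^sub>R b)" if "n \<ge> n0" for n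
    proof -
      let ?x = "x + real n *\<^sub>R b"
      have "c0 * r\<^sup>2 * (0 - weight_bound (?x \<bullet> b - r1)) \<le> u ?x - avg u r ?x"
        by (rule u_avg_le) (use r n0 that in \<open>auto simp: shift_inner r1_def\<close>)
      moreover have "?x \<bullet> b - r1 = x \<bullet> b - r1 + real n" by (simp add: shift_inner)
      ultimately show ?thesis by simp
    qed
    then show "\<exists>N. \<forall>n\<ge>N. c0 * r\<^sup>2 * (0 - weight_bound (x \<bullet> b - r1 + real n)) \<le> u (x + real n *\<^sub>R b) - avg u r (x + real n *\<^sub>R b)"
      by blast
  qed
  then show ?thesis by simp
qed

text \<open>The strong minimum principle on one ball. The Harnack step with E = 1 applies, since the
  value 0 lies below every threshold.\<close>

lemma zero_propagates:
  assumes f: "uniformly_continuous_on UNIV f" "\<And>y::'a. 0 \<le> f y" and "r > 0" "avg f r x \<le> f x" "f x = 0" "dist x y \<le> r / 2"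
  shows "f y = 0"
proof (rule ccontr)
  assume "f y \<noteq> 0"
  then have "f y > 0" using f(2)[of y] by simp
  then obtain e where "e > 0" "\<And>x. (\<forall>y\<in>ball x r. 0 \<le> f y) \<Longrightarrow> avg f r x \<le> 1 * f x \<Longrightarrow> f x < e \<Longrightarrow> (\<forall>z\<in>cball x (r/2). f z < f y)"
    using avg_small_imp_small[OF f(1) \<open>r > 0\<close>, of 1 "f y"] by auto
  from this(2)[of x] this(1) have "f y < f y" using assms by auto
  then show False by simp
qed

text \<open>\<open>v\<close> is superharmonic at all radii, so a single ball of radius 2 dist + 1
  reaches any other point.\<close>

lemma v_pos_or_zero:
  assumes "v x0 = 0"
  shows "v x = 0"
proof -
  define r where "r = 2 * dist x0 x + 1"
  show ?thesis
    by (rule zero_propagates[OF v_uc v_bounds(1), of r x0])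
       (use v_superharmonic[of r x0] assms in \<open>auto simp: r_def add_nonneg_pos\<close>)
qed

section \<open>Strict positivity of the gap between the limit and the solution\<close>

definition z :: "'a \<Rightarrow> real" where "z x = v x - u x"

lemma z_nonneg: "0 \<le> z x" using u_le_v[of x 0] by (simp add: z_def)

lemma z_uc: "uniformly_continuous_on UNIV z"
  unfolding z_def[abs_def] using v_uc u_uc by (rule uniformly_continuous_on_diff)

lemma z_cont: "continuous_on UNIV z"
  using z_uc by (rule uniformly_continuous_imp_continuous)

text \<open>Compare u with its translate by n b. Monotonicity orders the power terms, the weights at
  the lower point have the right sign, and those at the upper point are at most S n, which tends to
  0.\<close>

lemma z_superharmonic:
  assumes r: "0 < r" "r < x \<bullet> b"
  shows "avg z r x \<le> z x"
proof -
  obtain r1 where r1: "r < r1" "r1 < x \<bullet> b" using dense r by blast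
  let ?x = "\<lambda>n. x + real n *\<^sub>R b"
  define S where "S n = weight_bound (x \<bullet> b - r1 + real n)" for n
  have un: "u y \<le> u (y + real n *\<^sub>R b)" for y n by (intro u_mono') simp
  have main: "avg u r (?x n) - avg u r x \<le> u (?x n) - u x + c0 * r\<^sup>2 * S n" for n
  proof -
    let ?f = "\<lambda>y. u (y + real n *\<^sub>R b) - u y"
    have sh: "continuous_on UNIV (\<lambda>y. u (y + real n *\<^sub>R b))"
      by (rule continuous_on_compose2[OF u_cont]) (auto intro!: continuous_intros)
    have avgsh: "avg (\<lambda>y. u (y + real n *\<^sub>R b)) t x = avg u t (?x n)" for t
      by (simp add: avg_def algebra_simps)
    have af: "avg ?f t x = avg u t (?x n) - avg u t x" for t
      unfolding avg_diff[OF sh u_cont] avgsh ..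
    have "avg ?f r x \<le> ?f x + (S n * Theta_mass TYPE('a)) * r\<^sup>2 / 2"
    proof (rule avg_upper[OF _ _ _ r(1) r1(1)])
      show "continuous_on UNIV ?f" by (intro continuous_intros sh u_cont)
      fix t assume t: "0 < t" "t < r1"
      have "((\<lambda>t. avg u t (?x n) - avg u t x) has_real_derivative - (t * avgT F t (?x n)) - - (t * avgT F t x)) (at t)"
        using t r1 by (intro DERIV_diff u_deriv) (auto simp: shift_inner)
      then show "((\<lambda>t. avg ?f t x) has_real_derivative t * (avgT F t x - avgT F t (?x n))) (at t)"
        unfolding af by (simp add: algebra_simps)
      have "avgT F t x \<le> avgT (\<lambda>y. F (y + real n *\<^sub>R b) + S n) t x"
      proof (rule avgT_mono[where C="rhs_bound (x \<bullet> b - r1)" and D="rhs_bound (x \<bullet> b - r1) + \<bar>S n\<bar>"])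
        fix y assume y: "y \<in> ball x t"
        have yb: "0 < x \<bullet> b - r1" "x \<bullet> b - r1 \<le> y \<bullet> b" using inner_ball[OF y] t r1 by auto
        have yb': "0 < x \<bullet> b - r1 + real n" "x \<bullet> b - r1 + real n \<le> (y + real n *\<^sub>R b) \<bullet> b"
          using yb by (auto simp: shift_inner)
        show "\<bar>F y\<bar> \<le> rhs_bound (x \<bullet> b - r1)" by (rule F_bound[OF yb])
        have "\<bar>F (y + real n *\<^sub>R b)\<bar> \<le> rhs_bound (x \<bullet> b - r1)" using yb by (intro F_bound) (auto simp: shift_inner)
        then show "\<bar>F (y + real n *\<^sub>R b) + S n\<bar> \<le> rhs_bound (x \<bullet> b - r1) + \<bar>S n\<bar>" by linarith
        have "u y powr p \<le> u (y + real n *\<^sub>R b) powr p" using un u_nonneg p by (intro powr_mono2) auto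
        then show "F y \<le> F (y + real n *\<^sub>R b) + S n" using F_lower[OF yb'] F_upper[of y] by (simp add: S_def)
      qed (use t in auto)
      also have "\<dots> = avgT F t (?x n) + S n * Theta_mass TYPE('a)"
      proof -
        have i: "integrable lborel (\<lambda>y. F (?x n + t *\<^sub>R y) * Theta y)"
        proof (rule integrable_kernel_local[where C="rhs_bound (x \<bullet> b - r1)"])
          fix y assume y: "y \<in> ball (?x n) t"
          show "\<bar>F y\<bar> \<le> rhs_bound (x \<bullet> b - r1)" using inner_ball[OF y] t r1 by (intro F_bound) (auto simp: shift_inner)
        qed (use t in \<open>auto intro: integrable_Theta Theta_outside\<close>)
        have "avgT (\<lambda>y. F (y + real n *\<^sub>R b) + S n) t x = (\<integral>y. F (?x n + t *\<^sub>R y) * Theta y + S n * Theta y \<partial>lborel)"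
          unfolding avgT_def by (simp add: algebra_simps)
        also have "\<dots> = avgT F t (?x n) + S n * Theta_mass TYPE('a)"
          using Bochner_Integration.integral_add[OF i integrable_mult_right[OF integrable_Theta]]
          by (simp add: avgT_def Theta_mass_def)
        finally show ?thesis .
      qed
      finally show "avgT F t x - avgT F t (?x n) \<le> S n * Theta_mass TYPE('a)" by simp
    qed
    then show ?thesis unfolding af by (simp add: c0_def algebra_simps)
  qed
  have "avg v r x - avg u r x \<le> v x - u x + c0 * r\<^sup>2 * 0"
  proof (rule LIMSEQ_le)
    show "(\<lambda>n. avg u r (?x n) - avg u r x) \<longlonglongrightarrow> avg v r x - avg u r x" by (intro tendsto_intros avg_u_lim)
    show "(\<lambda>n. u (?x n) - u x + c0 * r\<^sup>2 * S n) \<longlonglongrightarrow> v x - u x + c0 * r\<^sup>2 * 0"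
      unfolding S_def by (intro tendsto_intros v_lim weight_bound_lim)
    show "\<exists>N. \<forall>n\<ge>N. avg u r (?x n) - avg u r x \<le> u (?x n) - u x + c0 * r\<^sup>2 * S n" using main by blast
  qed
  then show ?thesis unfolding z_def[abs_def] avg_diff[OF v_cont u_cont] by simp
qed

text \<open>A zero of z would spread downwards along a vertical line to the boundary, where u = 0
  and hence z = v > 0.\<close>

lemma z_pos:
  assumes "v 0 \<noteq> 0"
  shows "z x > 0"
proof (rule ccontr)
  assume "\<not> z x > 0"
  then have zx: "z x = 0" using z_nonneg[of x] by simp
  have vpos: "v y > 0" for y using v_pos_or_zero[of y 0] v_bounds(1)[of y] assms by (simp add: less_le) metis
  have xb: "x \<bullet> b > 0" using u_outside[of x] vpos[of x] zx by (force simp: z_def)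
  define y where "y = x - (x \<bullet> b) *\<^sub>R b"
  have yb: "y \<bullet> b = 0" using b by (simp add: y_def inner_diff_left)
  \<comment> \<open>At height h superharmonicity is used with radius h/2, which spreads the zero
    over distance h/4; the height shrinks by the factor 3/4 each time.\<close>
  have step: "z (y + ((3/4)^n * (x \<bullet> b)) *\<^sub>R b) = 0" for n :: nat
  proof (induction n)
    case 0 then show ?case using zx by (simp add: y_def)
  next
    case (Suc n)
    define h where "h = (3/4)^n * (x \<bullet> b)"
    have h: "h > 0" using xb by (simp add: h_def)
    show ?case
    proof (rule zero_propagates[OF z_uc z_nonneg, of "h / 2" "y + h *\<^sub>R b"])
      show "avg z (h / 2) (y + h *\<^sub>R b) \<le> z (y + h *\<^sub>R b)" using h by (intro z_superharmonic) (auto simp: shift_inner yb)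
      show "z (y + h *\<^sub>R b) = 0" using Suc by (simp add: h_def)
      have "(y + h *\<^sub>R b) - (y + ((3/4)^Suc n * (x \<bullet> b)) *\<^sub>R b) = (h / 4) *\<^sub>R b"
        by (simp add: h_def algebra_simps flip: scaleR_left_diff_distrib)
      then show "dist (y + h *\<^sub>R b) (y + ((3/4)^Suc n * (x \<bullet> b)) *\<^sub>R b) \<le> h / 2 / 2"
        using b h by (simp add: dist_norm)
    qed (use h in auto)
  qed
  have "isCont z y" using z_cont by (simp add: continuous_on_eq_continuous_at)
  moreover have "(\<lambda>n. y + ((3/4)^n * (x \<bullet> b)) *\<^sub>R b) \<longlonglongrightarrow> y + (0 * (x \<bullet> b)) *\<^sub>R b"
    by (intro tendsto_intros LIMSEQ_power_zero) simp
  ultimately have "(\<lambda>n. z (y + ((3/4)^n * (x \<bullet> b)) *\<^sub>R b)) \<longlonglongrightarrow> z y" using isCont_tendsto_compose by force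
  then have "z y = 0" unfolding step by (simp add: LIMSEQ_const_iff)
  then show False using vpos[of y] u_outside[of y] yb by (simp add: z_def)
qed

end

section \<open>Stability and the Liouville argument\<close>

lemma le_of_le_add_eps:
  fixes X Y Z :: real
  assumes "\<And>e. e > 0 \<Longrightarrow> X \<le> Y + e * Z"
  shows "X \<le> Y"
proof (rule ccontr)
  assume "\<not> X \<le> Y"
  define e where "e = (X - Y) / (2 * (\<bar>Z\<bar> + 1))"
  have e: "e > 0" using \<open>\<not> X \<le> Y\<close> by (simp add: e_def)
  have "e * Z \<le> e * (\<bar>Z\<bar> + 1)" using e by (intro mult_left_mono) auto
  also have "\<dots> = (X - Y) / 2" by (simp add: e_def field_simps)
  finally show False using assms[OF e] \<open>\<not> X \<le> Y\<close> by (simp add: field_simps)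
qed

context half_space_profile
begin

lemma indicator_cball_integrable: "integrable lborel (\<lambda>x::'a. indicator (cball 0 S) x :: real)"
  by (intro integrable_real_indicator) (auto simp: emeasure_lborel_cball_finite[unfolded infinity_ennreal_def])

text \<open>With z_n = v - u_n and u_n the translate of u by n b, convexity gives -\<Delta>z_n \<ge>
  p u_n^(p-1) z_n. Testing with (v \<eta>)^2/z_n and applying Picone bounds p \<integral> u_n^(p-1)
  (v \<eta>)^2 by the form of v against v \<eta>^2, which the equation for v evaluates, plus the
  energy of the cutoff. The condition on n lifts the support of \<eta> to height at least 1.\<close>

lemma stability:
  assumes nz: "v 0 \<noteq> 0" and S: "S \<ge> 1" and n: "real n \<ge> 2 * S + 1"
  shows "2 * c0 * (p * (\<integral>x. u (x + real n *\<^sub>R b) powr (p - 1) * (v x * cutoff S x)\<^sup>2 \<partial>lborel))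
    \<le> 2 * c0 * (\<integral>x. v x powr p * (v x * (cutoff S x)\<^sup>2) \<partial>lborel) + 1 / S\<^sup>2 * (\<integral>x. indicator (cball 0 (3 * S)) x * (v x)\<^sup>2 \<partial>lborel)"
proof -
  define zn where "zn x = z (x + real n *\<^sub>R b)" for x
  define un where "un x = u (x + real n *\<^sub>R b)" for x
  define \<eta> where "\<eta> = (cutoff S :: 'a \<Rightarrow> real)"
  define f where "f x = (v x * \<eta> x)\<^sup>2 / zn x" for x
  define f1 where "f1 x = v x * (\<eta> x)\<^sup>2" for x
  define K where "K = cball (0::'a) (2 * S)"
  have zn: "zn x = v x - un x" for x unfolding zn_def un_def z_def v_shift ..
  have znp: "zn x > 0" for x unfolding zn_def by (rule z_pos[OF nz])
  have unc: "continuous_on UNIV un" unfolding un_def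
    by (rule continuous_on_compose2[OF u_cont]) (auto intro!: continuous_intros)
  have znc: "continuous_on UNIV zn" unfolding zn[abs_def] by (intro continuous_intros v_cont unc)
  have \<eta>c: "continuous_on UNIV \<eta>" unfolding \<eta>_def using S by (intro cutoff_cont) simp
  have \<eta>0: "\<eta> x = 0" if "norm x \<ge> 2 * S" for x unfolding \<eta>_def using S that by (intro cutoff_outside) auto
  have \<eta>K: "\<eta> x = 0" if "x \<notin> K" for x using that by (intro \<eta>0) (simp add: K_def)
  have fc: "continuous_on UNIV f" unfolding f_def
    by (intro continuous_intros v_cont \<eta>c znc) (use znp in \<open>auto simp: less_imp_neq[symmetric]\<close>)
  have f1c: "continuous_on UNIV f1" unfolding f1_def by (intro continuous_intros v_cont \<eta>c)
  have cK: "compact K" by (simp add: K_def)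
  have fK: "f x = 0" "f1 x = 0" if "x \<notin> K" for x using \<eta>K[OF that] by (auto simp: f_def f1_def)
  have f_nn: "f x \<ge> 0" "f1 x \<ge> 0" for x using znp[of x] v_bounds(1)[of x] by (auto simp: f_def f1_def)
  have fint: "integrable lborel f" "integrable lborel f1"
    using integrable_continuous_compact_support[OF fc cK fK(1)] integrable_continuous_compact_support[OF f1c cK fK(2)] by auto
  have powc: "continuous_on UNIV (\<lambda>x. h x powr a)" if "continuous_on UNIV h" "\<And>x. h x \<ge> 0" "a > 0" for h :: "'a \<Rightarrow> real" and a
    using that by (intro continuous_on_powr') auto
  have i1: "integrable lborel (\<lambda>x. un x powr (p - 1) * (v x * \<eta> x)\<^sup>2)"
    using p u_nonneg \<eta>K by (intro integrable_continuous_compact_support[OF _ cK] continuous_intros powc unc v_cont \<eta>c) (auto simp: un_def)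
  have i2: "integrable lborel (\<lambda>x. v x powr p * f1 x)"
    using p v_bounds fK by (intro integrable_continuous_compact_support[OF _ cK] continuous_intros powc f1c v_cont) auto
  define A where "A = (\<integral>x. un x powr (p - 1) * (v x * \<eta> x)\<^sup>2 \<partial>lborel)"
  define Bv where "Bv = (\<integral>x. v x powr p * f1 x \<partial>lborel)"
  define V2 where "V2 = (\<integral>x. indicator (cball 0 (3 * S)) x * (v x)\<^sup>2 \<partial>lborel)"
  define V where "V = measure lborel (cball (0::'a) (3 * S))"
  define If where "If = (\<integral>x. f x \<partial>lborel)"
  define If1 where "If1 = (\<integral>x. f1 x \<partial>lborel)"
  have "2 * c0 * (p * A) \<le> 2 * c0 * Bv + 1 / S\<^sup>2 * V2"
  proof (rule le_of_le_add_eps)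
    fix \<epsilon> :: real assume \<epsilon>: "\<epsilon> > 0"
    obtain d where d: "d > 0" "\<And>x y. dist x y < d \<Longrightarrow> u y powr p \<le> u x powr p + \<epsilon>" using powr_modulus[OF \<epsilon>] by blast
    obtain d' where d': "d' > 0" "\<And>x y. dist x y < d' \<Longrightarrow> \<bar>v x - v y\<bar> \<le> \<epsilon>" using v_modulus[OF \<epsilon>] by blast
    \<comment> \<open>The bound 1 keeps the balls in the half-space after the shift; d and d' make
      the oscillations of u^p and of v at most \<epsilon>.\<close>
    define r1 where "r1 = min 1 (min d d')"
    define r where "r = r1 / 2"
    have r: "0 < r" "r < r1" "r1 \<le> 1" "r1 \<le> d" "r1 \<le> d'" "r < d" using d(1) d'(1) by (auto simp: r_def r1_def min_def)
    \<comment> \<open>The supersolution inequality for zn with error 2 \<epsilon>, multiplied by f;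
      the product zn * f is (v \<eta>)^2.\<close>
    have low: "c0 * r\<^sup>2 * (p * (un x powr (p - 1) * (v x * \<eta> x)\<^sup>2) - 2 * \<epsilon> * f x) \<le> (zn x - avg zn r x) * f x" for x
    proof (cases "x \<in> K")
      case False then show ?thesis using fK \<eta>K by simp
    next
      case True
      have xb: "r1 \<le> (x + real n *\<^sub>R b) \<bullet> b"
      proof -
        have "\<bar>x \<bullet> b\<bar> \<le> norm x" by (rule Basis_le_norm[OF b])
        then have "x \<bullet> b \<ge> - (2 * S)" using True by (simp add: K_def)
        then show ?thesis using n r S unfolding shift_inner by linarith
      qed
      have "avg zn r x = avg v r x - avg un r x" unfolding zn[abs_def] by (rule avg_diff[OF v_cont unc])
      moreover have "avg un r x = avg u r (x + real n *\<^sub>R b)" by (simp add: avg_def un_def algebra_simps)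
      moreover have "u (x + real n *\<^sub>R b) - avg u r (x + real n *\<^sub>R b) \<le> c0 * r\<^sup>2 * (un x powr p + \<epsilon>)"
        unfolding un_def using r xb by (intro u_avg_ge[of r r1] d) auto
      moreover have "c0 * r\<^sup>2 * (v x powr p - \<epsilon>) \<le> v x - avg v r x"
        by (rule v_avg_bounds(1)[OF \<epsilon> d(2) r(1) r(6)])
      ultimately have "c0 * r\<^sup>2 * (v x powr p - \<epsilon>) - c0 * r\<^sup>2 * (un x powr p + \<epsilon>) \<le> zn x - avg zn r x"
        unfolding zn by (simp add: un_def)
      then have 1: "c0 * r\<^sup>2 * (v x powr p - un x powr p - 2 * \<epsilon>) \<le> zn x - avg zn r x"
        by (simp add: algebra_simps)
      have "un x powr p - v x powr p \<le> p * un x powr (p - 1) * (un x - v x)"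
        using u_nonneg v_bounds p by (intro powr_diff_le) (auto simp: un_def)
      then have "p * un x powr (p - 1) * zn x - 2 * \<epsilon> \<le> v x powr p - un x powr p - 2 * \<epsilon>"
        unfolding zn by (simp add: algebra_simps)
      then have "c0 * r\<^sup>2 * (p * un x powr (p - 1) * zn x - 2 * \<epsilon>) \<le> c0 * r\<^sup>2 * (v x powr p - un x powr p - 2 * \<epsilon>)"
        using c0_pos by (intro mult_left_mono) auto
      with 1 have "c0 * r\<^sup>2 * (p * un x powr (p - 1) * zn x - 2 * \<epsilon>) \<le> zn x - avg zn r x" by linarith
      then have "c0 * r\<^sup>2 * (p * un x powr (p - 1) * zn x - 2 * \<epsilon>) * f x \<le> (zn x - avg zn r x) * f x"
        by (rule mult_right_mono) (rule f_nn)
      moreover have "zn x * f x = (v x * \<eta> x)\<^sup>2" using znp[of x] by (simp add: f_def)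
      then have "c0 * r\<^sup>2 * (p * un x powr (p - 1) * zn x - 2 * \<epsilon>) * f x
          = c0 * r\<^sup>2 * (p * (un x powr (p - 1) * (v x * \<eta> x)\<^sup>2) - 2 * \<epsilon> * f x)"
        by (simp only: mult.assoc left_diff_distrib)
      ultimately show ?thesis by simp
    qed
    have up: "(v x - avg v r x) * f1 x \<le> c0 * r\<^sup>2 * (v x powr p * f1 x + \<epsilon> * f1 x)" for x
    proof -
      have "(v x - avg v r x) * f1 x \<le> c0 * r\<^sup>2 * (v x powr p + \<epsilon>) * f1 x"
        by (rule mult_right_mono[OF v_avg_bounds(2)[OF \<epsilon> d(2) r(1) r(6)] f_nn(2)])
      then show ?thesis by (simp add: algebra_simps)
    qed
    note sz = avg_symmetric_form[OF znc fc cK fK(1), of r]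
    note sv = avg_symmetric_form[OF v_cont f1c cK fK(2), of r]
    have L: "c0 * r\<^sup>2 * (p * A - 2 * \<epsilon> * If) \<le> (\<integral>x. (zn x - avg zn r x) * f x \<partial>lborel)"
    proof -
      have i: "integrable lborel (\<lambda>x. p * (un x powr (p - 1) * (v x * \<eta> x)\<^sup>2))" "integrable lborel (\<lambda>x. 2 * \<epsilon> * f x)"
        using i1 fint by (auto intro: integrable_mult_right)
      have "c0 * r\<^sup>2 * (p * A - 2 * \<epsilon> * If) = (\<integral>x. c0 * r\<^sup>2 * (p * (un x powr (p - 1) * (v x * \<eta> x)\<^sup>2) - 2 * \<epsilon> * f x) \<partial>lborel)"
        unfolding integral_mult_right_zero Bochner_Integration.integral_diff[OF i] A_def If_def ..
      also have "\<dots> \<le> (\<integral>x. (zn x - avg zn r x) * f x \<partial>lborel)"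
        by (intro integral_mono integrable_mult_right Bochner_Integration.integrable_diff[OF i] sz(3) low)
      finally show ?thesis .
    qed
    have U: "(\<integral>x. (v x - avg v r x) * f1 x \<partial>lborel) \<le> c0 * r\<^sup>2 * (Bv + \<epsilon> * If1)"
    proof -
      have i: "integrable lborel (\<lambda>x. v x powr p * f1 x)" "integrable lborel (\<lambda>x. \<epsilon> * f1 x)"
        using i2 fint by (auto intro: integrable_mult_right)
      have "(\<integral>x. (v x - avg v r x) * f1 x \<partial>lborel) \<le> (\<integral>x. c0 * r\<^sup>2 * (v x powr p * f1 x + \<epsilon> * f1 x) \<partial>lborel)"
        by (intro integral_mono integrable_mult_right Bochner_Integration.integrable_add[OF i] sv(3) up)
      also have "\<dots> = c0 * r\<^sup>2 * (Bv + \<epsilon> * If1)"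
        unfolding integral_mult_right_zero Bochner_Integration.integral_add[OF i] Bv_def If1_def ..
      finally show ?thesis .
    qed
    define Dz where "Dz y = (\<integral>x. (zn x - zn (x + r *\<^sub>R y)) * (f x - f (x + r *\<^sub>R y)) \<partial>lborel)" for y
    define Dv where "Dv y = (\<integral>x. (v x - v (x + r *\<^sub>R y)) * (f1 x - f1 (x + r *\<^sub>R y)) \<partial>lborel)" for y
    \<comment> \<open>Picone pointwise. The cutoff term lives in |x| \<le> 3 S because the shift is
      at most 1 \<le> S, and v(x) v(x + r y) exceeds v(x)^2 by at most M \<epsilon>.\<close>
    have DD: "Dz y \<le> Dv y + r\<^sup>2 / S\<^sup>2 * (V2 + M * \<epsilon> * V)" if y: "norm y < 1" for y
    proof -
      let ?s = "\<lambda>x. x + r *\<^sub>R y"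
      have ry: "norm (r *\<^sub>R y) \<le> r" using y r by (simp add: mult_le_one)
      have out: "norm (?s x) \<ge> 2 * S \<and> norm x \<ge> 2 * S" if "x \<notin> cball 0 (3 * S)" for x
      proof -
        have "norm x \<le> norm (?s x) + norm (r *\<^sub>R y)" using norm_triangle_ineq4[of "?s x" "r *\<^sub>R y"] by simp
        moreover have "norm x > 3 * S" using that by simp
        ultimately show ?thesis using ry r S by linarith
      qed
      have sh: "continuous_on UNIV (\<lambda>x. h (?s x))" if "continuous_on UNIV h" for h :: "'a \<Rightarrow> real"
        by (rule continuous_on_compose2[OF that]) (auto intro!: continuous_intros)
      have fout: "f x = 0 \<and> f (?s x) = 0 \<and> f1 x = 0 \<and> f1 (?s x) = 0" if "x \<notin> cball 0 (3 * S)" for x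
        using out[OF that] \<eta>0 by (auto simp: f_def f1_def)
      have iz: "integrable lborel (\<lambda>x. (zn x - zn (?s x)) * (f x - f (?s x)))"
        by (rule integrable_continuous_compact_support[of _ "cball 0 (3 * S)"])
           (auto intro!: continuous_intros znc fc sh simp: fout)
      have iv: "integrable lborel (\<lambda>x. (v x - v (?s x)) * (f1 x - f1 (?s x)))"
        by (rule integrable_continuous_compact_support[of _ "cball 0 (3 * S)"])
           (auto intro!: continuous_intros v_cont f1c sh simp: fout)
      have iB1: "integrable lborel (\<lambda>x. indicator (cball 0 (3 * S)) x * (v x)\<^sup>2)"
        using borel_integrable_compact[of "cball 0 (3 * S)" "\<lambda>x. (v x)\<^sup>2"] v_cont
        by (auto intro!: continuous_intros intro: continuous_on_subset)
      have iB2: "integrable lborel (\<lambda>x::'a. M * \<epsilon> * indicator (cball 0 (3 * S)) x :: real)"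
        by (intro integrable_mult_right indicator_cball_integrable)
      let ?B = "\<lambda>x. r\<^sup>2 / S\<^sup>2 * (indicator (cball 0 (3 * S)) x * (v x)\<^sup>2 + M * \<epsilon> * indicator (cball 0 (3 * S)) x)"
      have "Dz y \<le> (\<integral>x. (v x - v (?s x)) * (f1 x - f1 (?s x)) + ?B x \<partial>lborel)"
        unfolding Dz_def
      proof (intro integral_mono iz Bochner_Integration.integrable_add iv integrable_mult_right iB1 indicator_cball_integrable)
        fix x
        show "(zn x - zn (?s x)) * (f x - f (?s x)) \<le> (v x - v (?s x)) * (f1 x - f1 (?s x)) + ?B x"
        proof (cases "x \<in> cball 0 (3 * S)")
          case False then show ?thesis by (simp add: fout)
        next
          case True
          have "(zn x - zn (?s x)) * (f x - f (?s x)) \<le> (v x - v (?s x)) * (f1 x - f1 (?s x)) + v x * v (?s x) * (\<eta> x - \<eta> (?s x))\<^sup>2"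
            unfolding f_def f1_def by (rule picone_discrete[OF znp znp])
          moreover have "v x * v (?s x) * (\<eta> x - \<eta> (?s x))\<^sup>2 \<le> ((v x)\<^sup>2 + M * \<epsilon>) * (r\<^sup>2 / S\<^sup>2)"
          proof (rule mult_mono)
            have "r * norm y < r" using y r by simp
            then have "r * norm y < d'" using r by linarith
            then have "dist x (?s x) < d'" using r by (simp add: dist_norm)
            then have "v (?s x) \<le> v x + \<epsilon>" using d'(2)[of x "?s x"] by (simp add: abs_le_iff)
            then have "v x * v (?s x) \<le> v x * (v x + \<epsilon>)" using v_bounds by (intro mult_left_mono) auto
            also have "\<dots> \<le> (v x)\<^sup>2 + M * \<epsilon>" using v_bounds[of x] \<epsilon> by (simp add: power2_eq_square algebra_simps)
            finally show "v x * v (?s x) \<le> (v x)\<^sup>2 + M * \<epsilon>" .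
            have "\<bar>\<eta> x - \<eta> (?s x)\<bar> \<le> norm (x - ?s x) / S" unfolding \<eta>_def using S by (intro cutoff_lipschitz) simp
            also have "\<dots> \<le> r / S" using ry S by (intro divide_right_mono) auto
            finally have "\<bar>\<eta> x - \<eta> (?s x)\<bar>\<^sup>2 \<le> (r / S)\<^sup>2" by (intro power_mono) auto
            then show "(\<eta> x - \<eta> (?s x))\<^sup>2 \<le> r\<^sup>2 / S\<^sup>2" by (simp add: power_divide)
          qed (use M \<epsilon> in auto)
          ultimately show ?thesis using True by (simp add: algebra_simps)
        qed
      qed
      also have "\<dots> = Dv y + r\<^sup>2 / S\<^sup>2 * (V2 + M * \<epsilon> * V)"
      proof -
        note iB = Bochner_Integration.integrable_add[OF iB1 iB2]
        show ?thesis
          unfolding Bochner_Integration.integral_add[OF iv integrable_mult_right[OF iB]] integral_mult_right_zero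
            Bochner_Integration.integral_add[OF iB1 iB2] Dv_def V2_def V_def by simp
      qed
      finally show ?thesis .
    qed
    have "2 * (\<integral>x. (zn x - avg zn r x) * f x \<partial>lborel) = (\<integral>y. rho y * Dz y \<partial>lborel)"
      unfolding Dz_def by (rule sz(2)[symmetric])
    also have "\<dots> \<le> (\<integral>y. rho y * Dv y + (r\<^sup>2 / S\<^sup>2 * (V2 + M * \<epsilon> * V)) * rho y \<partial>lborel)"
    proof (intro integral_mono Bochner_Integration.integrable_add integrable_mult_right integrable_rho)
      show "integrable lborel (\<lambda>y. rho y * Dz y)" unfolding Dz_def by (rule sz(1))
      show "integrable lborel (\<lambda>y. rho y * Dv y)" unfolding Dv_def by (rule sv(1))
      fix y :: 'a
      show "rho y * Dz y \<le> rho y * Dv y + (r\<^sup>2 / S\<^sup>2 * (V2 + M * \<epsilon> * V)) * rho y"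
      proof (cases "norm y < 1")
        case True
        from mult_left_mono[OF DD[OF this] rho_nonneg[of y]] show ?thesis by (simp add: algebra_simps)
      qed (simp add: rho_outside)
    qed
    also have "\<dots> = (\<integral>y. rho y * Dv y \<partial>lborel) + r\<^sup>2 / S\<^sup>2 * (V2 + M * \<epsilon> * V)"
    proof -
      have i: "integrable lborel (\<lambda>y. rho y * Dv y)" unfolding Dv_def by (rule sv(1))
      show ?thesis
        unfolding Bochner_Integration.integral_add[OF i integrable_mult_right[OF integrable_rho]]
          integral_mult_right_zero integral_rho by simp
    qed
    also have "(\<integral>y. rho y * Dv y \<partial>lborel) = 2 * (\<integral>x. (v x - avg v r x) * f1 x \<partial>lborel)"
      unfolding Dv_def by (rule sv(2))
    finally have "2 * (c0 * r\<^sup>2 * (p * A - 2 * \<epsilon> * If)) \<le> 2 * (c0 * r\<^sup>2 * (Bv + \<epsilon> * If1)) + r\<^sup>2 / S\<^sup>2 * (V2 + M * \<epsilon> * V)"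
      using L U by linarith
    then have "r\<^sup>2 * (2 * c0 * (p * A - 2 * \<epsilon> * If)) \<le> r\<^sup>2 * (2 * c0 * (Bv + \<epsilon> * If1) + 1 / S\<^sup>2 * (V2 + M * \<epsilon> * V))"
      by (simp add: algebra_simps)
    \<comment> \<open>Both sides are of second order in r, so r cancels; the integrals multiplying
      \<epsilon> were fixed beforehand, and \<epsilon> can be sent to 0.\<close>
    then have "2 * c0 * (p * A - 2 * \<epsilon> * If) \<le> 2 * c0 * (Bv + \<epsilon> * If1) + 1 / S\<^sup>2 * (V2 + M * \<epsilon> * V)"
      using r by (simp only: mult_le_cancel_left_pos zero_less_power)
    then show "2 * c0 * (p * A) \<le> 2 * c0 * Bv + 1 / S\<^sup>2 * V2 + \<epsilon> * (2 * c0 * If1 + 4 * c0 * If + 1 / S\<^sup>2 * (M * V))"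
      by (simp add: algebra_simps add_divide_distrib)
  qed
  then show ?thesis unfolding A_def Bv_def V2_def un_def f1_def \<eta>_def .
qed

text \<open>As n grows, u_n^(p-1) becomes v^(p-1) under the integral, and both sides of the
  stability inequality contain the same integral of v^(p+1); p > 1 leaves the factor p - 1.\<close>

lemma energy_estimate:
  assumes nz: "v 0 \<noteq> 0" and S: "S \<ge> 1"
  shows "2 * c0 * (p - 1) * (\<integral>x. v x powr (p + 1) * (cutoff S x)\<^sup>2 \<partial>lborel)
    \<le> 1 / S\<^sup>2 * (\<integral>x. indicator (cball 0 (3 * S)) x * (v x)\<^sup>2 \<partial>lborel)"
proof -
  have vp: "v x > 0" for x using v_pos_or_zero[of x 0] v_bounds(1)[of x] nz by (simp add: less_le) metis
  have e1: "v x powr p * (v x * (cutoff S x)\<^sup>2) = v x powr (p + 1) * (cutoff S x)\<^sup>2" for x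
    using vp[of x] by (simp add: powr_add)
  have e2: "v x powr (p - 1) * (v x * cutoff S x)\<^sup>2 = v x powr (p + 1) * (cutoff S x)\<^sup>2" for x
  proof -
    have "v x powr (p + 1) = v x powr (p - 1) * v x powr 2" by (simp add: add.commute flip: powr_add)
    also have "v x powr 2 = (v x)\<^sup>2" using vp[of x] by (simp add: powr_numeral)
    finally show ?thesis by (simp add: power_mult_distrib)
  qed
  define Q where "Q = (\<integral>x. v x powr (p + 1) * (cutoff S x)\<^sup>2 \<partial>lborel)"
  define W where "W = 1 / S\<^sup>2 * (\<integral>x. indicator (cball 0 (3 * S)) x * (v x)\<^sup>2 \<partial>lborel)"
  have [measurable]: "v \<in> borel_measurable borel" using v_cont by (rule borel_measurable_continuous_onI)
  have [measurable]: "(cutoff S :: 'a \<Rightarrow> real) \<in> borel_measurable borel"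
    using S by (intro borel_measurable_continuous_onI cutoff_cont) simp
  have lim: "(\<lambda>n. \<integral>x. u (x + real n *\<^sub>R b) powr (p - 1) * (v x * cutoff S x)\<^sup>2 \<partial>lborel)
     \<longlonglongrightarrow> (\<integral>x. v x powr (p - 1) * (v x * cutoff S x)\<^sup>2 \<partial>lborel)"
  proof (rule integral_dominated_convergence[where w="\<lambda>x. M powr (p - 1) * (v x * cutoff S x)\<^sup>2"])
    show "integrable lborel (\<lambda>x. M powr (p - 1) * (v x * cutoff S x)\<^sup>2)"
      by (intro integrable_mult_right integrable_continuous_compact_support[of _ "cball 0 (2 * S)"])
         (use S in \<open>auto intro!: continuous_intros v_cont cutoff_cont cutoff_outside\<close>)
    show "AE x in lborel. (\<lambda>n. u (x + real n *\<^sub>R b) powr (p - 1) * (v x * cutoff S x)\<^sup>2) \<longlonglongrightarrow> v x powr (p - 1) * (v x * cutoff S x)\<^sup>2"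
      using p u_nonneg by (intro AE_I2 tendsto_mult_right tendsto_powr' v_lim tendsto_const) auto
    show "AE x in lborel. norm (u (x + real n *\<^sub>R b) powr (p - 1) * (v x * cutoff S x)\<^sup>2) \<le> M powr (p - 1) * (v x * cutoff S x)\<^sup>2" for n
      using u_nonneg u_le p by (intro AE_I2) (auto intro!: mult_right_mono powr_mono2)
  qed measurable
  have "2 * c0 * (p * Q) \<le> 2 * c0 * Q + W"
  proof (rule LIMSEQ_le_const2)
    show "(\<lambda>n. 2 * c0 * (p * (\<integral>x. u (x + real n *\<^sub>R b) powr (p - 1) * (v x * cutoff S x)\<^sup>2 \<partial>lborel))) \<longlonglongrightarrow> 2 * c0 * (p * Q)"
      unfolding Q_def e2[symmetric] by (intro tendsto_intros lim)
    obtain n0 :: nat where "2 * S + 1 \<le> real n0" using real_arch_simple by blast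
    then have "real n \<ge> 2 * S + 1" if "n \<ge> n0" for n using that by (meson le_trans of_nat_le_iff order_trans)
    then show "\<exists>N. \<forall>n\<ge>N. 2 * c0 * (p * (\<integral>x. u (x + real n *\<^sub>R b) powr (p - 1) * (v x * cutoff S x)\<^sup>2 \<partial>lborel)) \<le> 2 * c0 * Q + W"
      using stability[OF nz S] unfolding Q_def W_def e1 by blast
  qed
  then show ?thesis unfolding Q_def[symmetric] W_def[symmetric] by (simp add: algebra_simps)
qed

section \<open>Energy growth and the contradiction\<close>

definition energy :: "real \<Rightarrow> real" where
  "energy S = (\<integral>x. indicator (cball 0 S) x * v x powr (p + 1) \<partial>lborel)"

lemma energy_integrable: "integrable lborel (\<lambda>x. indicator (cball 0 S) x * v x powr (p + 1))"
proof -
  have "continuous_on (cball 0 S) (\<lambda>x. v x powr (p + 1))"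
    using p v_bounds(1) by (intro continuous_on_powr' continuous_on_subset[OF v_cont] continuous_intros) auto
  then show ?thesis using borel_integrable_compact[of "cball 0 S" "\<lambda>x. v x powr (p + 1)"] by auto
qed

text \<open>A Young inequality done by hand: v^2/S^2 is either a small multiple of v^(p+1) or at
  most K^2 S^(-N). The critical exponent makes the second part, integrated over radius 3 S,
  independent of S.\<close>

lemma energy_le_energy:
  assumes nz: "v 0 \<noteq> 0" and N: "DIM('a) \<ge> 3" and pN: "p = (real DIM('a) + 2) / (real DIM('a) - 2)" and e: "e > 0"
  shows "\<exists>C\<ge>0. \<forall>S\<ge>1. energy S \<le> e * energy (3 * S) + C"
proof -
  define n where "n = real DIM('a)"
  have n: "n \<ge> 3" using N by (simp add: n_def)
  have pn: "p - 1 = 4 / (n - 2)" using n by (simp add: pN n_def[symmetric] field_simps)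
  define c where "c = 2 * c0 * (p - 1)"
  have c: "c > 0" using c0_pos p by (simp add: c_def)
  \<comment> \<open>Chosen so that c e K^(p-1) = 1.\<close>
  define K where "K = (1 / (c * e)) powr (1 / (p - 1))"
  have K: "K > 0" using c e by (simp add: K_def)
  have Kp: "K powr (p - 1) = 1 / (c * e)" using p c e by (simp add: K_def powr_powr)
  define V where "V = measure lborel (cball (0::'a) 1)"
  define C where "C = K\<^sup>2 * 3 ^ DIM('a) * V / c"
  have C: "C \<ge> 0" using c by (simp add: C_def V_def)
  have "energy S \<le> e * energy (3 * S) + C" if S: "S \<ge> 1" for S
  proof -
    have pt: "1 / S\<^sup>2 * (v x)\<^sup>2 \<le> c * e * v x powr (p + 1) + K\<^sup>2 * S powr (- n)" for x
    \<comment> \<open>At this threshold c e v^(p-1) equals 1/S^2, because (p - 1)(n - 2)/2 =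
      2.\<close>
    proof (cases "v x \<ge> K * S powr (- (n - 2) / 2)")
      case True
      have pos: "K * S powr (- (n - 2) / 2) > 0" using K S by simp
      then have vp: "v x > 0" using True by linarith
      have "(K * S powr (- (n - 2) / 2)) powr (p - 1) \<le> v x powr (p - 1)"
        using True pos p by (intro powr_mono2) auto
      also have "(K * S powr (- (n - 2) / 2)) powr (p - 1) = 1 / (c * e) * S powr (- 2)"
      proof -
        have "- (n - 2) / 2 * (p - 1) = - 2" using n by (simp add: pn field_simps)
        then show ?thesis using K S by (simp add: powr_mult Kp powr_powr)
      qed
      also have "S powr (- 2) = 1 / S\<^sup>2" using S by (simp add: powr_minus powr_numeral divide_inverse)
      finally have "c * e * (1 / (c * e) * (1 / S\<^sup>2)) \<le> c * e * v x powr (p - 1)" using c e by (intro mult_left_mono) auto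
      then have "1 / S\<^sup>2 \<le> c * e * v x powr (p - 1)" using c e by simp
      then have "1 / S\<^sup>2 * (v x)\<^sup>2 \<le> c * e * v x powr (p - 1) * (v x)\<^sup>2" by (rule mult_right_mono) simp
      also have "v x powr (p - 1) * (v x)\<^sup>2 = v x powr (p + 1)"
      proof -
        have "v x powr (p + 1) = v x powr (p - 1) * v x powr 2" by (simp add: add.commute flip: powr_add)
        then show ?thesis using vp by (simp add: powr_numeral)
      qed
      then have "c * e * v x powr (p - 1) * (v x)\<^sup>2 = c * e * v x powr (p + 1)" by simp
      finally show ?thesis using K by (simp add: add_increasing2)
    next
      case False
      then have "(v x)\<^sup>2 \<le> (K * S powr (- (n - 2) / 2))\<^sup>2" using v_bounds(1) by (intro power_mono) auto
      also have "\<dots> = K\<^sup>2 * S powr (- (n - 2))"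
        using S by (simp add: power_mult_distrib power2_eq_square flip: powr_add)
      finally have "1 / S\<^sup>2 * (v x)\<^sup>2 \<le> 1 / S\<^sup>2 * (K\<^sup>2 * S powr (- (n - 2)))" by (intro mult_left_mono) auto
      also have "1 / S\<^sup>2 * (K\<^sup>2 * S powr (- (n - 2))) = K\<^sup>2 * S powr (- n)"
      proof -
        have "1 / S\<^sup>2 = S powr (- 2)" using S by (simp add: powr_minus powr_numeral divide_inverse)
        then show ?thesis by (simp add: mult.left_commute flip: powr_add)
      qed
      finally have "1 / S\<^sup>2 * (v x)\<^sup>2 \<le> K\<^sup>2 * S powr (- n)" .
      moreover have "0 \<le> c * e * v x powr (p + 1)" using c e by simp
      ultimately show ?thesis by linarith
    qed
    have "c * energy S \<le> c * (\<integral>x. v x powr (p + 1) * (cutoff S x)\<^sup>2 \<partial>lborel)"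
    proof (rule mult_left_mono)
      show "energy S \<le> (\<integral>x. v x powr (p + 1) * (cutoff S x)\<^sup>2 \<partial>lborel)"
        unfolding energy_def
      proof (intro integral_mono energy_integrable)
        show "integrable lborel (\<lambda>x. v x powr (p + 1) * (cutoff S x)\<^sup>2)"
          by (rule integrable_continuous_compact_support[of _ "cball 0 (2 * S)"])
             (use S p v_bounds(1) in \<open>auto intro!: continuous_intros continuous_on_powr' v_cont cutoff_cont cutoff_outside\<close>)
        fix x
        show "indicator (cball 0 S) x * v x powr (p + 1) \<le> v x powr (p + 1) * (cutoff S x)\<^sup>2"
          using S by (auto simp: indicator_def cutoff_inside)
      qed
    qed (use c in simp)
    also have "\<dots> \<le> 1 / S\<^sup>2 * (\<integral>x. indicator (cball 0 (3 * S)) x * (v x)\<^sup>2 \<partial>lborel)"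
      unfolding c_def by (rule energy_estimate[OF nz S])
    also have "\<dots> = (\<integral>x. indicator (cball 0 (3 * S)) x * (1 / S\<^sup>2 * (v x)\<^sup>2) \<partial>lborel)"
      unfolding integral_mult_right_zero[symmetric] by (simp add: ac_simps)
    also have "\<dots> \<le> (\<integral>x. c * e * (indicator (cball 0 (3 * S)) x * v x powr (p + 1)) + K\<^sup>2 * S powr (- n) * indicator (cball 0 (3 * S)) x \<partial>lborel)"
    proof (intro integral_mono Bochner_Integration.integrable_add integrable_mult_right energy_integrable indicator_cball_integrable)
      have "continuous_on (cball 0 (3 * S)) (\<lambda>x. 1 / S\<^sup>2 * (v x)\<^sup>2)"
        by (intro continuous_intros continuous_on_subset[OF v_cont]) auto
      then show "integrable lborel (\<lambda>x. indicator (cball 0 (3 * S)) x * (1 / S\<^sup>2 * (v x)\<^sup>2))"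
        using borel_integrable_compact[of "cball 0 (3 * S)" "\<lambda>x. 1 / S\<^sup>2 * (v x)\<^sup>2"] by auto
      fix x
      show "indicator (cball 0 (3 * S)) x * (1 / S\<^sup>2 * (v x)\<^sup>2) \<le> c * e * (indicator (cball 0 (3 * S)) x * v x powr (p + 1)) + K\<^sup>2 * S powr (- n) * indicator (cball 0 (3 * S)) x"
        using pt[of x] by (cases "x \<in> cball 0 (3 * S)") (auto simp: indicator_def)
    qed
    also have "\<dots> = c * e * energy (3 * S) + K\<^sup>2 * S powr (- n) * measure lborel (cball (0::'a) (3 * S))"
      unfolding Bochner_Integration.integral_add[OF integrable_mult_right[OF energy_integrable] integrable_mult_right[OF indicator_cball_integrable]]
        integral_mult_right_zero energy_def by simp
    also have "measure lborel (cball (0::'a) (3 * S)) = (3 * S) ^ DIM('a) * V"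
      unfolding V_def using S by (simp add: content_cball)
    also have "K\<^sup>2 * S powr (- n) * ((3 * S) ^ DIM('a) * V) = c * C"
    proof -
      have "S powr (- n) * S ^ DIM('a) = 1"
        using S by (simp add: n_def powr_minus powr_realpow)
      then have "K\<^sup>2 * S powr (- n) * ((3 * S) ^ DIM('a) * V) = K\<^sup>2 * 3 ^ DIM('a) * V"
        by (simp add: power_mult_distrib)
      then show ?thesis using c by (simp add: C_def)
    qed
    finally have "c * energy S \<le> c * (e * energy (3 * S) + C)" by (simp add: algebra_simps)
    then show ?thesis using c by (simp only: mult_le_cancel_left_pos)
  qed
  then show ?thesis using C by blast
qed

lemma energy_growth: "S \<ge> 0 \<Longrightarrow> energy S \<le> M powr (p + 1) * measure lborel (cball (0::'a) 1) * S ^ DIM('a)"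
proof -
  assume S: "S \<ge> 0"
  have "energy S \<le> (\<integral>x. M powr (p + 1) * indicator (cball (0::'a) S) x \<partial>lborel)"
    unfolding energy_def
  proof (intro integral_mono energy_integrable integrable_mult_right indicator_cball_integrable)
    fix x
    show "indicator (cball 0 S) x * v x powr (p + 1) \<le> M powr (p + 1) * indicator (cball 0 S) x"
      using v_bounds[of x] p by (auto simp: indicator_def intro!: powr_mono2)
  qed
  also have "\<dots> = M powr (p + 1) * measure lborel (cball (0::'a) 1) * S ^ DIM('a)"
    using S by (simp add: content_cball)
  finally show ?thesis .
qed

text \<open>Iterating the estimate over the radii 3^j S: the energy grows at most like the volume,
  and the small factor e beats this growth, so only the geometric series of the constants
  remains.\<close>

lemma energy_bounded:
  assumes nz: "v 0 \<noteq> 0" and N: "DIM('a) \<ge> 3" and pN: "p = (real DIM('a) + 2) / (real DIM('a) - 2)"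
  shows "\<exists>C. \<forall>S\<ge>1. energy S \<le> C"
proof -
  \<comment> \<open>Makes e * 3^N = 1/2, so the iterated main term is at most 2^(-j) times a
    constant; 2 e \<le> 1 lets the constants sum to at most 2 C.\<close>
  define e where "e = 1 / (2 * 3 ^ DIM('a) :: real)"
  have e: "e > 0" "2 * e \<le> 1" "e * 3 ^ DIM('a) = 1 / 2" by (auto simp: e_def)
  obtain C where C: "C \<ge> 0" "\<And>S. S \<ge> 1 \<Longrightarrow> energy S \<le> e * energy (3 * S) + C"
    using energy_le_energy[OF nz N pN e(1)] by blast
  define D where "D = M powr (p + 1) * measure lborel (cball (0::'a) 1)"
  have it: "energy S \<le> e ^ j * energy (3 ^ j * S) + 2 * C * (1 - e ^ j)" if S: "S \<ge> 1" for S j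
  proof (induction j)
    case 0 then show ?case by simp
  next
    case (Suc j)
    have "1 * 1 \<le> 3 ^ j * S" using S by (intro mult_mono) auto
    then have "energy (3 ^ j * S) \<le> e * energy (3 ^ Suc j * S) + C" using C(2)[of "3 ^ j * S"] by (simp add: mult.assoc)
    then have "e ^ j * energy (3 ^ j * S) \<le> e ^ j * (e * energy (3 ^ Suc j * S) + C)" using e by (intro mult_left_mono) auto
    moreover have "e ^ j * C * (2 * e) \<le> e ^ j * C * 1" using e C by (intro mult_left_mono) auto
    ultimately show ?case using Suc by (simp add: algebra_simps)
  qed
  have "energy S \<le> 2 * C" if S: "S \<ge> 1" for S
  proof (rule LIMSEQ_le_const)
    have "(\<lambda>j. (1/2) ^ j * (D * S ^ DIM('a)) + 2 * C) \<longlonglongrightarrow> 0 * (D * S ^ DIM('a)) + 2 * C"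
      by (intro tendsto_intros LIMSEQ_power_zero) auto
    then show "(\<lambda>j. (1/2) ^ j * (D * S ^ DIM('a)) + 2 * C) \<longlonglongrightarrow> 2 * C" by simp
    have "energy S \<le> (1/2) ^ j * (D * S ^ DIM('a)) + 2 * C" for j
    proof -
      have "e ^ j * energy (3 ^ j * S) \<le> e ^ j * (D * (3 ^ j * S) ^ DIM('a))"
        using energy_growth[of "3 ^ j * S"] S e by (intro mult_left_mono) (auto simp: D_def)
      also have "\<dots> = (e * 3 ^ DIM('a)) ^ j * (D * S ^ DIM('a))"
        by (simp add: power_mult_distrib mult.commute flip: power_mult)
      finally have "e ^ j * energy (3 ^ j * S) \<le> (1/2) ^ j * (D * S ^ DIM('a))" unfolding e(3) .
      moreover have "2 * C * (1 - e ^ j) \<le> 2 * C * 1" using C e by (intro mult_left_mono) auto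
      ultimately show ?thesis using it[OF S, of j] by linarith
    qed
    then show "\<exists>N. \<forall>j\<ge>N. energy S \<le> (1/2) ^ j * (D * S ^ DIM('a)) + 2 * C" by blast
  qed
  then show ?thesis by blast
qed

text \<open>If u were nonzero, v would be positive and constant along \<open>b\<close>; infinitely
  many disjoint balls along that line would carry the same amount of energy, against its
  boundedness.\<close>

theorem profile_zero:
  assumes N: "DIM('a) \<ge> 3" and pN: "p = (real DIM('a) + 2) / (real DIM('a) - 2)"
  shows "u x = 0"
proof (rule ccontr)
  assume "u x \<noteq> 0"
  then have "v x \<noteq> 0" using u_le_v[of x 0] u_nonneg[of x] by auto
  then have nz: "v 0 \<noteq> 0" using v_pos_or_zero[of 0 x] by blast
  obtain C where C: "\<And>S. S \<ge> 1 \<Longrightarrow> energy S \<le> C" using energy_bounded[OF nz N pN] by blast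
  have v0: "v 0 > 0" using nz v_bounds(1)[of 0] by simp
  obtain d0 where d0: "d0 > 0" "\<And>x y. dist x y < d0 \<Longrightarrow> \<bar>v x - v y\<bar> \<le> v 0 / 2" using v_modulus[of "v 0 / 2"] v0 by auto
  define m where "m = v 0 / 2"
  have m: "m > 0" using v0 by (simp add: m_def)
  \<comment> \<open>The spacing 2 d0 makes balls of radius d0 disjoint, and v \<ge> v(0)/2 on each
    since v equals v(0) at its centre.\<close>
  define B where "B j = ball ((real j * (2 * d0)) *\<^sub>R b) d0" for j :: nat
  have low: "m \<le> v y" if "y \<in> B j" for y j
  proof -
    have "dist ((real j * (2 * d0)) *\<^sub>R b) y < d0" using that by (simp add: B_def)
    from d0(2)[OF this] have "\<bar>v (0 + (real j * (2 * d0)) *\<^sub>R b) - v y\<bar> \<le> v 0 / 2" by simp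
    then show ?thesis unfolding v_shift m_def by linarith
  qed
  define V where "V = measure lborel (ball (0::'a) d0)"
  have V: "V > 0" using d0 by (simp add: V_def content_ball_pos)
  have disj: "disjoint_family_on B UNIV"
    unfolding disjoint_family_on_def
  proof (intro ballI impI)
    fix i j :: nat assume "i \<noteq> j"
    have "dist ((real i * (2 * d0)) *\<^sub>R b) ((real j * (2 * d0)) *\<^sub>R b) = \<bar>real i - real j\<bar> * (2 * d0)"
      using b d0 by (simp add: dist_norm flip: scaleR_left_diff_distrib left_diff_distrib) (simp add: abs_mult)
    moreover have "\<bar>real i - real j\<bar> \<ge> 1" using \<open>i \<noteq> j\<close> by linarith
    then have "\<bar>real i - real j\<bar> * (2 * d0) \<ge> 1 * (2 * d0)" using d0 by (intro mult_right_mono) auto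
    ultimately show "B i \<inter> B j = {}" unfolding B_def by (intro disjoint_ballI) simp
  qed
  have big: "real k * (m powr (p + 1) * V) \<le> C" for k :: nat
  proof -
    define S where "S = real k * (2 * d0) + d0 + 1"
    have S: "S \<ge> 1" using d0 by (simp add: S_def)
    have sub: "B j \<subseteq> cball 0 S" if "j < k" for j
    proof
      fix y assume "y \<in> B j"
      then have 1: "norm (y - (real j * (2 * d0)) *\<^sub>R b) < d0" by (simp add: B_def dist_norm norm_minus_commute)
      have "norm y \<le> norm (y - (real j * (2 * d0)) *\<^sub>R b) + norm ((real j * (2 * d0)) *\<^sub>R b)"
        by (metis diff_add_cancel norm_triangle_ineq)
      moreover have "norm ((real j * (2 * d0)) *\<^sub>R b) = real j * (2 * d0)" using b d0 by simp
      moreover have "real j * (2 * d0) \<le> real k * (2 * d0)" using that d0 by (intro mult_right_mono) auto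
      ultimately have "norm y \<le> S" using 1 unfolding S_def by linarith
      then show "y \<in> cball 0 S" by simp
    qed
    have mB: "measure lborel (B j) = V" for j unfolding B_def V_def using d0 by (simp add: content_ball)
    have fB: "integrable lborel (\<lambda>y. m powr (p + 1) * indicator (B j) y)" for j
      unfolding B_def by (intro integrable_mult_right integrable_real_indicator)
        (auto simp: emeasure_lborel_ball_finite[unfolded infinity_ennreal_def])
    have "real k * (m powr (p + 1) * V) = (\<Sum>j<k. (\<integral>y. m powr (p + 1) * indicator (B j) y \<partial>lborel))"
      by (simp add: mB)
    also have "\<dots> = (\<integral>y. (\<Sum>j<k. m powr (p + 1) * indicator (B j) y) \<partial>lborel)"
      by (rule Bochner_Integration.integral_sum[symmetric]) (rule fB)
    also have "\<dots> \<le> energy S" unfolding energy_def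
    proof (intro integral_mono Bochner_Integration.integrable_sum fB energy_integrable)
      fix y
      have "indicator (\<Union>j<k. B j) y = (\<Sum>j<k. indicator (B j) y :: real)"
        using disjoint_family_on_mono[OF _ disj, of "{..<k}"] by (intro indicator_UN_disjoint) auto
      then have "(\<Sum>j<k. m powr (p + 1) * indicator (B j) y) = m powr (p + 1) * indicator (\<Union>j<k. B j) y"
        by (simp only: sum_distrib_left)
      also have "\<dots> \<le> indicator (cball 0 S) y * v y powr (p + 1)"
      proof (cases "y \<in> (\<Union>j<k. B j)")
        case True
        then obtain j where j: "j < k" "y \<in> B j" by blast
        have "m powr (p + 1) \<le> v y powr (p + 1)" using low[OF j(2)] m p by (intro powr_mono2) auto
        then show ?thesis using True sub[OF j(1)] j(2) by (auto simp: indicator_def)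
      qed simp
      finally show "(\<Sum>j<k. m powr (p + 1) * indicator (B j) y) \<le> indicator (cball 0 S) y * v y powr (p + 1)" .
    qed
    also have "\<dots> \<le> C" by (rule C[OF S])
    finally show ?thesis .
  qed
  have c: "m powr (p + 1) * V > 0" using m V by simp
  obtain k :: nat where "C / (m powr (p + 1) * V) < real k" using reals_Archimedean2 by blast
  then have "C < real k * (m powr (p + 1) * V)" using c by (simp add: pos_divide_less_eq)
  then show False using big[of k] by simp
qed

end

section \<open>Weak solutions near the boundary\<close>

lemma flat_1_le: "flat 1 t \<le> 1" by (simp add: flat_def)

lemma flat_1_nonneg: "0 \<le> flat 1 t" by (simp add: flat_def)

lemma flat_1_mono: "t \<le> t' \<Longrightarrow> flat 1 t \<le> flat 1 t'"
  by (auto simp: flat_def frac_le)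

lemma flat_deriv_1_nonneg: "0 \<le> flat (flat_deriv 1) t"
  by (simp add: flat_deriv_1 flat_def)

lemma flat_deriv_1_le: "flat (flat_deriv 1) t \<le> 2"
proof (cases "t > 0")
  case True
  define y where "y = 1 / t"
  have y: "y > 0" using True by (simp add: y_def)
  have "1 + y + y\<^sup>2 / 2 \<le> exp y" using y by (intro exp_lower_Taylor_quadratic) simp
  then have "y\<^sup>2 \<le> 2 * exp y" using y by linarith
  then have "y\<^sup>2 * exp (- y) \<le> 2 * exp y * exp (- y)" by (intro mult_right_mono) auto
  also have "\<dots> = 2" by (simp add: mult.assoc flip: exp_add)
  finally show ?thesis using True by (simp add: flat_deriv_1 flat_def y_def power2_eq_square)
qed (simp add: flat_def)

lemma flat_1_lipschitz: "\<bar>flat 1 t - flat 1 t'\<bar> \<le> 2 * \<bar>t - t'\<bar>"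
proof -
  have "norm (flat 1 t - flat 1 t') \<le> 2 * norm (t - t')"
    by (rule field_differentiable_bound[of UNIV "flat 1" "flat (flat_deriv 1)"])
       (auto intro: DERIV_flat simp: flat_deriv_1_nonneg flat_deriv_1_le)
  then show ?thesis by simp
qed

text \<open>The second derivative has the sign of 1/t - 2, so exp(-1/t) is convex up to t = 1/2.
  This is the origin of the 1/2 in the ramp functions below.\<close>

lemma flat_deriv_deriv_1_nonneg: "t \<le> 1/2 \<Longrightarrow> 0 \<le> flat (flat_deriv (flat_deriv 1)) t"
proof (cases "t > 0")
  case True
  assume "t \<le> 1/2"
  then have y: "1 / t \<ge> 2" using True by (simp add: field_simps)
  have "poly (flat_deriv (flat_deriv 1)) (1/t) = (1/t)^2 * ((1/t) * ((1/t) - 2))"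
    by (simp add: flat_deriv_1 flat_deriv_def pderiv_pCons power2_eq_square algebra_simps)
  also have "\<dots> \<ge> 0" using y True by (intro mult_nonneg_nonneg) auto
  finally show ?thesis using True by (simp add: flat_def)
qed (simp add: flat_def)

text \<open>With s the height these are smooth cutoffs vanishing for n s \<le> 1. Their derivative,
  multiplied by s, tends to 0, which is what a factor vanishing linearly at the boundary can
  exploit.\<close>

lemma flat_1_tendsto:
  assumes "s > 0"
  shows "(\<lambda>n. flat 1 (-1 + real n * s)) \<longlonglongrightarrow> 1"
    and "(\<lambda>n. (real n * s) * flat (flat_deriv 1) (-1 + real n * s)) \<longlonglongrightarrow> 0"
proof -
  have top: "filterlim (\<lambda>n. -1 + real n * s) at_top sequentially"
    by (intro filterlim_tendsto_add_at_top[OF tendsto_const] filterlim_at_top_mult_tendsto_pos[OF tendsto_const assms] filterlim_real_sequentially)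
  have inv: "(\<lambda>n. inverse (-1 + real n * s)) \<longlonglongrightarrow> 0"
    by (rule filterlim_compose[OF tendsto_inverse_0 filterlim_mono[OF top at_top_le_at_infinity order_refl]])
  have ev: "\<forall>\<^sub>F n in sequentially. 0 < -1 + real n * s"
    using top unfolding filterlim_at_top_dense by blast
  have "(\<lambda>n. exp (- inverse (-1 + real n * s))) \<longlonglongrightarrow> exp (- 0)" by (intro tendsto_intros inv)
  then have "(\<lambda>n. exp (- inverse (-1 + real n * s))) \<longlonglongrightarrow> 1" by simp
  then show "(\<lambda>n. flat 1 (-1 + real n * s)) \<longlonglongrightarrow> 1"
    by (rule Lim_transform_eventually) (use ev in eventually_elim, simp add: flat_def divide_inverse)
  have "(\<lambda>n. (inverse (-1 + real n * s) + (inverse (-1 + real n * s))\<^sup>2) * exp (- inverse (-1 + real n * s))) \<longlonglongrightarrow> (0 + 0\<^sup>2) * exp (- 0)"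
    by (intro tendsto_intros inv)
  then have "(\<lambda>n. (inverse (-1 + real n * s) + (inverse (-1 + real n * s))\<^sup>2) * exp (- inverse (-1 + real n * s))) \<longlonglongrightarrow> 0" by simp
  then show "(\<lambda>n. (real n * s) * flat (flat_deriv 1) (-1 + real n * s)) \<longlonglongrightarrow> 0"
  proof (rule Lim_transform_eventually)
    show "\<forall>\<^sub>F n in sequentially. (inverse (-1 + real n * s) + (inverse (-1 + real n * s))\<^sup>2) * exp (- inverse (-1 + real n * s)) = (real n * s) * flat (flat_deriv 1) (-1 + real n * s)"
      using ev
    proof eventually_elim
      case (elim n)
      define t where "t = -1 + real n * s"
      have ns: "real n * s = t + 1" by (simp add: t_def)
      have "t > 0" using elim by (simp add: t_def)
      then have "(t + 1) * (inverse t)\<^sup>2 = inverse t + (inverse t)\<^sup>2"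
        by (simp add: field_simps power2_eq_square)
      then show ?case using elim unfolding t_def[symmetric] ns
        by (simp add: flat_deriv_1 flat_def divide_inverse power2_eq_square mult.assoc[symmetric])
    qed
  qed
qed

text \<open>The uniform bound that accompanies the second limit of \<open>flat_1_tendsto\<close> in
  dominated convergence, with t + 1 = n s.\<close>

lemma flat_deriv_1_moment: "\<bar>(t + 1) * flat (flat_deriv 1) t\<bar> \<le> 4"
proof (cases "t > 0")
  case True
  define y where "y = 1 / t"
  have y: "y > 0" using True by (simp add: y_def)
  have "1 + y + y\<^sup>2 / 2 \<le> exp y" using y by (intro exp_lower_Taylor_quadratic) simp
  then have "y + y\<^sup>2 \<le> 4 * exp y" using y by (smt (verit) zero_le_power2 field_sum_of_halves)
  then have "(y + y\<^sup>2) * exp (- y) \<le> 4 * exp y * exp (- y)" by (intro mult_right_mono) auto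
  also have "\<dots> = 4" by (simp add: mult.assoc flip: exp_add)
  finally have "(y + y\<^sup>2) * exp (- y) \<le> 4" .
  moreover have "(t + 1) * flat (flat_deriv 1) t = (y + y\<^sup>2) * exp (- y)"
    using True by (simp add: flat_deriv_1 flat_def y_def field_simps power2_eq_square)
  ultimately show ?thesis using y by simp
qed (simp add: flat_def)

lemma pderiv_dir_mult:
  assumes "f \<in> smooth_class" "g \<in> smooth_class"
  shows "pderiv_dir (\<lambda>x. f x * g x) c x = f x * pderiv_dir g c x + pderiv_dir f c x * g x"
  by (rule pderiv_dir_eqI, intro has_derivative_mult smooth_class_has_derivative assms)

lemma smooth_class_flat_affine: "(\<lambda>x. flat q (A + B * (x \<bullet> a))) \<in> smooth_class"
  by (intro smooth_class.intros)

lemma pderiv_dir_flat_affine: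
  "pderiv_dir (\<lambda>x. flat q (A + B * (x \<bullet> a))) c x = flat (flat_deriv q) (A + B * (x \<bullet> a)) * (B * (c \<bullet> a))"
  by (rule pderiv_dir_eqI, rule has_derivative_flat) (auto intro!: derivative_eq_intros)

lemma integral_tendsto_bounded_factor:
  fixes g :: "'a::euclidean_space \<Rightarrow> real"
  assumes g: "integrable lborel g" and [measurable]: "\<And>n. w n \<in> borel_measurable borel" "w' \<in> borel_measurable borel"
    and C: "\<And>n x. \<bar>w n x\<bar> \<le> C" and lim: "\<And>x. (\<lambda>n. w n x) \<longlonglongrightarrow> w' x"
  shows "(\<lambda>n. \<integral>x. w n x * g x \<partial>lborel) \<longlonglongrightarrow> (\<integral>x. w' x * g x \<partial>lborel)"
proof (rule integral_dominated_convergence[where w="\<lambda>x. C * \<bar>g x\<bar>"])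
  have [measurable]: "g \<in> borel_measurable borel" using g by auto
  show "(\<lambda>x. w' x * g x) \<in> borel_measurable lborel" "\<And>n. (\<lambda>x. w n x * g x) \<in> borel_measurable lborel" by measurable
  show "integrable lborel (\<lambda>x. C * \<bar>g x\<bar>)" using g by (intro integrable_mult_right integrable_abs)
  show "AE x in lborel. (\<lambda>n. w n x * g x) \<longlonglongrightarrow> w' x * g x" by (intro AE_I2 tendsto_mult_right lim)
  show "AE x in lborel. norm (w n x * g x) \<le> C * \<bar>g x\<bar>" for n
    using C by (intro AE_I2) (auto simp: abs_mult intro!: mult_right_mono)
qed

lemma loc_integrable_times:
  fixes g \<psi> :: "'a::euclidean_space \<Rightarrow> real"
  assumes "loc_integrable g UNIV" "continuous_on UNIV \<psi>" "compact K" "\<And>x. x \<notin> K \<Longrightarrow> \<psi> x = 0"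
  shows "integrable lborel (\<lambda>x. g x * \<psi> x)"
proof -
  obtain B where B: "\<And>x. \<bar>\<psi> x\<bar> \<le> B" using continuous_compact_support_bounded[OF assms(2-4)] by blast
  have "set_integrable lborel K g" using assms by (auto simp: loc_integrable_def)
  then have "integrable lborel (\<lambda>x. indicator K x * g x)" by (simp add: set_integrable_def)
  then have "integrable lborel (\<lambda>x. \<psi> x * (indicator K x * g x))"
    using assms(2) B by (intro integrable_bounded_times[of \<psi> B]) (auto intro: borel_measurable_continuous_onI)
  moreover have "\<psi> x * (indicator K x * g x) = g x * \<psi> x" for x using assms(4)[of x] by (auto simp: indicator_def)
  ultimately show ?thesis by simp
qed

text \<open>Each truncation to a ball is measurable, and the function is their pointwise
  limit.\<close>

lemma loc_integrable_measurable:
  fixes g :: "'a::euclidean_space \<Rightarrow> real"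
  assumes "loc_integrable g UNIV"
  shows "g \<in> borel_measurable borel"
proof (rule borel_measurable_LIMSEQ_real[where u="\<lambda>n x. indicator (cball 0 (real n)) x * g x"])
  show "(\<lambda>x. indicator (cball 0 (real n)) x * g x) \<in> borel_measurable borel" for n
  proof -
    have "set_integrable lborel (cball 0 (real n)) g" using assms by (auto simp: loc_integrable_def)
    then have "(\<lambda>x. indicator (cball 0 (real n)) x *\<^sub>R g x) \<in> borel_measurable lborel" unfolding set_integrable_def by (rule borel_measurable_integrable)
    then show ?thesis by simp
  qed
  fix x :: 'a
  obtain n0 :: nat where n0: "norm x \<le> real n0" using real_arch_simple by blast
  have "\<forall>\<^sub>F n in sequentially. indicator (cball 0 (real n)) x * g x = g x"
    using eventually_ge_at_top[of n0] by eventually_elim (use n0 in \<open>auto simp: indicator_def\<close>)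
  then show "(\<lambda>n. indicator (cball 0 (real n)) x * g x) \<longlonglongrightarrow> g x" by (rule tendsto_eventually)
qed

text \<open>The gradient is tested on the whole space, across the boundary: that the zero extension
  has a locally integrable weak gradient is the Dirichlet condition. The equation is tested only
  with supports strictly inside. Supports are given by an explicit compact set, which is convenient
  for products of cutoffs.\<close>

locale weak_half_space = bounded_profile b p l q s P M U
  for b :: "'a::euclidean_space" and p :: real and l :: nat and q s :: "nat \<Rightarrow> real"
    and P :: "nat \<Rightarrow> 'a" and M :: real and U :: "'a \<Rightarrow> real" +
  fixes G :: "'a \<Rightarrow> 'a"
  assumes U_meas [measurable]: "U \<in> borel_measurable borel"
    and U_outside: "\<And>x. x \<bullet> b \<le> 0 \<Longrightarrow> U x = 0"
    and G_loc: "\<And>c. c \<in> Basis \<Longrightarrow> loc_integrable (\<lambda>x. G x \<bullet> c) UNIV"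
    and weak_grad: "\<And>\<phi> K c. \<phi> \<in> smooth_class \<Longrightarrow> compact K \<Longrightarrow> (\<And>x. x \<notin> K \<Longrightarrow> \<phi> x = 0) \<Longrightarrow> c \<in> Basis \<Longrightarrow>
       (\<integral>x. U x * pderiv_dir \<phi> c x \<partial>lborel) = - (\<integral>x. (G x \<bullet> c) * \<phi> x \<partial>lborel)"
    and weak_eq: "\<And>\<phi> K. \<phi> \<in> smooth_class \<Longrightarrow> compact K \<Longrightarrow> K \<subseteq> {x. 0 < x \<bullet> b} \<Longrightarrow> (\<And>x. x \<notin> K \<Longrightarrow> \<phi> x = 0) \<Longrightarrow>
       (\<integral>x. G x \<bullet> grad \<phi> x \<partial>lborel) = (\<integral>x. rhs p l q s P U x * \<phi> x \<partial>lborel)"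
begin

lemma U_abs: "\<bar>U x\<bar> \<le> M" using u_nonneg[of x] u_le[of x] by simp

lemma G_inner_grad: "G x \<bullet> grad \<phi> x = (\<Sum>c\<in>Basis. (G x \<bullet> c) * pderiv_dir \<phi> c x)"
  by (simp add: grad_def inner_sum_right mult.commute)

lemma G_grad_integrable:
  assumes "\<phi> \<in> smooth_class" "compact K" "\<And>x. x \<notin> K \<Longrightarrow> \<phi> x = 0" "c \<in> Basis"
  shows "integrable lborel (\<lambda>x. (G x \<bullet> c) * pderiv_dir \<phi> c' x)"
  using loc_integrable_times[OF G_loc[OF assms(4)] smooth_class_continuous[OF smooth_class_pderiv_dir[OF assms(1)]] assms(2)
      test_fun_pderiv_dir(2)[OF assms(1,2) subset_UNIV assms(3)]] .

lemma weak_lap: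
  assumes "\<phi> \<in> smooth_class" "compact K" "\<And>x. x \<notin> K \<Longrightarrow> \<phi> x = 0"
  shows "(\<integral>x. U x * lap \<phi> x \<partial>lborel) = - (\<integral>x. G x \<bullet> grad \<phi> x \<partial>lborel)"
proof -
  note pd = smooth_class_pderiv_dir[OF assms(1)]
  note out = test_fun_pderiv_dir(2)[OF assms(1,2) subset_UNIV assms(3)]
  have iU: "integrable lborel (\<lambda>x. U x * pderiv_dir (pderiv_dir \<phi> c) c x)" for c
    by (intro integrable_bounded_times[OF U_meas U_abs] integrable_continuous_compact_support[OF _ assms(2)]
        smooth_class_continuous[OF smooth_class_pderiv_dir[OF pd]] test_fun_pderiv_dir(2)[OF pd assms(2) subset_UNIV out])
  have "(\<integral>x. U x * lap \<phi> x \<partial>lborel) = (\<Sum>c\<in>Basis. \<integral>x. U x * pderiv_dir (pderiv_dir \<phi> c) c x \<partial>lborel)"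
    unfolding lap_def sum_distrib_left by (rule Bochner_Integration.integral_sum) (rule iU)
  also have "\<dots> = (\<Sum>c\<in>Basis. - (\<integral>x. (G x \<bullet> c) * pderiv_dir \<phi> c x \<partial>lborel))"
    by (intro sum.cong refl weak_grad[OF pd assms(2) out])
  also have "\<dots> = - (\<integral>x. G x \<bullet> grad \<phi> x \<partial>lborel)"
    unfolding G_inner_grad sum_negf
    by (subst Bochner_Integration.integral_sum) (auto intro!: G_grad_integrable[OF assms])
  finally show ?thesis .
qed

abbreviation "upper \<equiv> {x. 0 < x \<bullet> b}"

lemma upper_meas [measurable]: "upper \<in> sets borel"
  by (rule borel_open) (intro open_Collect_less continuous_intros)

text \<open>The weak gradient vanishes below the boundary, which is how the boundary condition enters.\<close>

lemma G_upper:
  assumes \<psi>: "\<psi> \<in> smooth_class" "compact K" "\<And>x. x \<notin> K \<Longrightarrow> \<psi> x = 0" and c: "c \<in> Basis"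
  shows "(\<integral>x. indicator upper x * ((G x \<bullet> c) * \<psi> x) \<partial>lborel) = (\<integral>x. (G x \<bullet> c) * \<psi> x \<partial>lborel)"
proof -
  \<comment> \<open>Smoothed indicators of height below -1/n; they converge to the indicator of the
    open lower half-space.\<close>
  define al where "al n x = flat 1 (-1 + (- real n) * (x \<bullet> b))" for n :: nat and x :: 'a
  have al: "al n \<in> smooth_class" for n unfolding al_def[abs_def] by (rule smooth_class_flat_affine)
  have int: "integrable lborel (\<lambda>x. (G x \<bullet> c) * \<psi> x)"
    by (rule loc_integrable_times[OF G_loc[OF c] smooth_class_continuous[OF \<psi>(1)] \<psi>(2,3)])
  have zero: "(\<integral>x. al n x * ((G x \<bullet> c) * \<psi> x) \<partial>lborel) = 0" for n
  proof -
    have sm: "(\<lambda>x. al n x * \<psi> x) \<in> smooth_class" by (intro smooth_class.mult al \<psi>)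
    define K' where "K' = K \<inter> {x. real n * (x \<bullet> b) \<le> -1}"
    have K': "compact K'" unfolding K'_def
      by (intro compact_Int_closed \<psi>(2) closed_Collect_le continuous_intros)
    have out: "al n x * \<psi> x = 0" if "x \<notin> K'" for x
      using that \<psi>(3)[of x] by (auto simp: K'_def al_def intro!: flat_eq_0)
    have "U x * pderiv_dir (\<lambda>x. al n x * \<psi> x) c x = 0" for x
    proof (cases "x \<in> K'")
      case True
      then have "real n * (x \<bullet> b) \<le> -1" by (simp add: K'_def)
      then have "x \<bullet> b \<le> 0" by (smt (verit) mult_nonneg_nonneg of_nat_0_le_iff)
      then show ?thesis by (simp add: U_outside)
    next
      case False
      then show ?thesis using test_fun_pderiv_dir(2)[OF sm K' subset_UNIV out] by simp
    qed
    then have "(\<integral>x. U x * pderiv_dir (\<lambda>x. al n x * \<psi> x) c x \<partial>lborel) = 0" by (simp only: integral_zero)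
    then have "(\<integral>x. (G x \<bullet> c) * (al n x * \<psi> x) \<partial>lborel) = 0"
      using weak_grad[OF sm K' out c] by simp
    then show ?thesis by (simp add: ac_simps)
  qed
  have "(\<lambda>n. \<integral>x. al n x * ((G x \<bullet> c) * \<psi> x) \<partial>lborel) \<longlonglongrightarrow> (\<integral>x. indicator {x. x \<bullet> b < 0} x * ((G x \<bullet> c) * \<psi> x) \<partial>lborel)"
  proof (rule integral_tendsto_bounded_factor[OF int, where C=1])
    show "al n \<in> borel_measurable borel" for n
      using smooth_class_continuous[OF al] by (rule borel_measurable_continuous_onI)
    have "open {x. x \<bullet> b < 0}" by (intro open_Collect_less continuous_intros)
    then show "(\<lambda>x. indicator {x. x \<bullet> b < 0} x :: real) \<in> borel_measurable borel" by simp
    show "\<bar>al n x\<bar> \<le> 1" for n x by (simp add: al_def flat_1_nonneg flat_1_le)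
    show "(\<lambda>n. al n x) \<longlonglongrightarrow> indicator {x. x \<bullet> b < 0} x" for x
    proof (cases "x \<bullet> b < 0")
      case True
      then show ?thesis using flat_1_tendsto(1)[of "- (x \<bullet> b)"] by (simp add: al_def)
    next
      case False
      have "al n x = 0" for n
      proof -
        have "0 \<le> real n * (x \<bullet> b)" using False by simp
        then show ?thesis unfolding al_def by (intro flat_eq_0) simp
      qed
      then show ?thesis using False by simp
    qed
  qed
  then have low: "(\<integral>x. indicator {x. x \<bullet> b < 0} x * ((G x \<bullet> c) * \<psi> x) \<partial>lborel) = 0"
    unfolding zero by (simp add: LIMSEQ_const_iff)
  have i1: "integrable lborel (\<lambda>x. indicator upper x * ((G x \<bullet> c) * \<psi> x))"
    by (rule integrable_bounded_times[OF _ _ int, where M=1]) (auto simp: indicator_def)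
  have op: "{x. x \<bullet> b < 0} \<in> sets borel" by (rule borel_open) (intro open_Collect_less continuous_intros)
  have i2: "integrable lborel (\<lambda>x. indicator {x. x \<bullet> b < 0} x * ((G x \<bullet> c) * \<psi> x))"
    by (rule integrable_bounded_times[OF _ _ int, where M=1]) (use op in \<open>auto simp: indicator_def\<close>)
  \<comment> \<open>Only the boundary hyperplane is left between the two open half-spaces, and it is
    a null set.\<close>
  have "AE x in lborel. x \<bullet> b \<noteq> 0"
  proof -
    have "{x. x \<bullet> b = 0} \<in> null_sets lebesgue"
      using negligible_standard_hyperplane[OF b, of 0] by (simp add: negligible_iff_null_sets)
    then have "AE x in lebesgue. x \<bullet> b \<noteq> 0" by (intro AE_I'[of "{x. x \<bullet> b = 0}"]) auto
    then show ?thesis by (simp add: AE_completion_iff)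
  qed
  then have "(\<integral>x. (G x \<bullet> c) * \<psi> x \<partial>lborel)
     = (\<integral>x. indicator upper x * ((G x \<bullet> c) * \<psi> x) + indicator {x. x \<bullet> b < 0} x * ((G x \<bullet> c) * \<psi> x) \<partial>lborel)"
    using int i1 i2 by (intro integral_cong_AE) (auto simp: indicator_def elim!: eventually_mono)
  also have "\<dots> = (\<integral>x. indicator upper x * ((G x \<bullet> c) * \<psi> x) \<partial>lborel)"
    using low by (simp add: Bochner_Integration.integral_add[OF i1 i2])
  finally show ?thesis ..
qed

text \<open>A weak form of zero trace. Testing the derivative in direction \<open>b\<close> with
  \<zeta> times a profile falling across the layer gives n times the layer integral on one side, and
  on the other an integral of a fixed integrable function over the strip S n, which shrinks to
  nothing. By \<open>G_upper\<close> no gradient below the boundary contributes.\<close>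

lemma U_small_near_boundary:
  assumes \<zeta>: "\<zeta> \<in> smooth_class" "compact K" "\<And>x. x \<notin> K \<Longrightarrow> \<zeta> x = 0" and \<zeta>_nn: "\<And>x. 0 \<le> \<zeta> x"
  shows "(\<lambda>n. real n * (\<integral>x. indicator {x. 0 < x \<bullet> b \<and> real n * (x \<bullet> b) < 1} x * (U x * \<zeta> x) \<partial>lborel)) \<longlonglongrightarrow> 0"
proof -
  define S where "S n = {x. 0 < x \<bullet> b \<and> real n * (x \<bullet> b) < 2}" for n
  define T where "T n = {x. 0 < x \<bullet> b \<and> real n * (x \<bullet> b) < 1}" for n
  have Sm [measurable]: "S n \<in> sets borel" "T n \<in> sets borel" for n unfolding S_def T_def
    by (auto intro!: borel_open open_Collect_conj open_Collect_less continuous_intros)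
  define h where "h x = M * \<bar>pderiv_dir \<zeta> b x\<bar> + \<bar>(G x \<bullet> b) * \<zeta> x\<bar>" for x
  note out = test_fun_pderiv_dir(2)[OF \<zeta>(1,2) subset_UNIV \<zeta>(3)]
  have iG: "integrable lborel (\<lambda>x. (G x \<bullet> b) * \<zeta> x)"
    by (rule loc_integrable_times[OF G_loc[OF b] smooth_class_continuous[OF \<zeta>(1)] \<zeta>(2,3)])
  have iz: "integrable lborel (pderiv_dir \<zeta> b)"
    by (rule integrable_continuous_compact_support[OF smooth_class_continuous[OF smooth_class_pderiv_dir[OF \<zeta>(1)]] \<zeta>(2) out])
  have izz: "integrable lborel \<zeta>"
    by (rule integrable_continuous_compact_support[OF smooth_class_continuous[OF \<zeta>(1)] \<zeta>(2,3)])
  have ih: "integrable lborel h" unfolding h_def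
    by (intro Bochner_Integration.integrable_add integrable_mult_right integrable_abs iz iG)
  have bound: "real n * (\<integral>x. indicator (T n) x * (U x * \<zeta> x) \<partial>lborel) \<le> 4 * exp 1 * (\<integral>x. indicator (S n) x * h x \<partial>lborel)"
    if n: "n > 0" for n :: nat
  proof -
    \<comment> \<open>Vanishes where n (x \<bullet> b) \<ge> 2 and has derivative -n B' in direction
      \<open>b\<close>; B' is bounded below on the layer n (x \<bullet> b) < 1.\<close>
    define B where "B x = flat 1 (2 + (- real n) * (x \<bullet> b))" for x
    define B' where "B' x = flat (flat_deriv 1) (2 + (- real n) * (x \<bullet> b))" for x
    have Bs: "B \<in> smooth_class" "B' \<in> smooth_class" unfolding B_def[abs_def] B'_def[abs_def] by (rule smooth_class_flat_affine)+
    have [measurable]: "B \<in> borel_measurable borel" "B' \<in> borel_measurable borel" "\<zeta> \<in> borel_measurable borel"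
      using Bs \<zeta>(1) smooth_class_continuous by (auto intro: borel_measurable_continuous_onI)
    have pB: "pderiv_dir B b x = - real n * B' x" for x
      unfolding B_def[abs_def] B'_def pderiv_dir_flat_affine using b by simp
    have sm: "(\<lambda>x. \<zeta> x * B x) \<in> smooth_class" by (intro smooth_class.mult \<zeta> Bs)
    have so: "\<zeta> x * B x = 0" if "x \<notin> K" for x using \<zeta>(3)[OF that] by simp
    have Bb: "0 \<le> B x" "B x \<le> 1" "0 \<le> B' x" "B' x \<le> 2" for x
      by (auto simp: B_def B'_def flat_1_nonneg flat_1_le flat_deriv_1_nonneg flat_deriv_1_le)
    have UB: "\<bar>U x * B x\<bar> \<le> M * 1" "\<bar>U x * B' x\<bar> \<le> M * 2" for x
      unfolding abs_mult using U_abs[of x] Bb[of x] M by (auto intro!: mult_mono simp del: mult_1_right)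
    have i1: "integrable lborel (\<lambda>x. (U x * B x) * pderiv_dir \<zeta> b x)"
      by (rule integrable_bounded_times[OF _ UB(1) iz]) measurable
    have i2: "integrable lborel (\<lambda>x. (U x * B' x) * \<zeta> x)"
      by (rule integrable_bounded_times[OF _ UB(2) izz]) measurable
    have "(\<integral>x. U x * pderiv_dir (\<lambda>x. \<zeta> x * B x) b x \<partial>lborel) = (\<integral>x. (U x * B x) * pderiv_dir \<zeta> b x - real n * ((U x * B' x) * \<zeta> x) \<partial>lborel)"
      unfolding pderiv_dir_mult[OF \<zeta>(1) Bs(1)] pB by (intro Bochner_Integration.integral_cong) (auto simp: algebra_simps)
    also have "\<dots> = (\<integral>x. (U x * B x) * pderiv_dir \<zeta> b x \<partial>lborel) - real n * (\<integral>x. (U x * B' x) * \<zeta> x \<partial>lborel)"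
      unfolding Bochner_Integration.integral_diff[OF i1 integrable_mult_right[OF i2]] by simp
    finally have e1: "real n * (\<integral>x. (U x * B' x) * \<zeta> x \<partial>lborel) = (\<integral>x. (U x * B x) * pderiv_dir \<zeta> b x \<partial>lborel) + (\<integral>x. (G x \<bullet> b) * (\<zeta> x * B x) \<partial>lborel)"
      using weak_grad[OF sm \<zeta>(2) so b] by linarith
    also have "(\<integral>x. (G x \<bullet> b) * (\<zeta> x * B x) \<partial>lborel) = (\<integral>x. indicator upper x * ((G x \<bullet> b) * (\<zeta> x * B x)) \<partial>lborel)"
      using G_upper[OF sm \<zeta>(2) so b] by simp
    also have "(\<integral>x. (U x * B x) * pderiv_dir \<zeta> b x \<partial>lborel) + (\<integral>x. indicator upper x * ((G x \<bullet> b) * (\<zeta> x * B x)) \<partial>lborel)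
        = (\<integral>x. (U x * B x) * pderiv_dir \<zeta> b x + indicator upper x * ((G x \<bullet> b) * (\<zeta> x * B x)) \<partial>lborel)"
    proof (rule Bochner_Integration.integral_add[symmetric, OF i1])
      have "integrable lborel (\<lambda>x. (indicator upper x * B x) * ((G x \<bullet> b) * \<zeta> x))"
        by (rule integrable_bounded_times[OF _ _ iG, where M=1]) (measurable, auto simp: indicator_def Bb)
      then show "integrable lborel (\<lambda>x. indicator upper x * ((G x \<bullet> b) * (\<zeta> x * B x)))" by (simp add: ac_simps)
    qed
    also have "\<dots> \<le> (\<integral>x. indicator (S n) x * h x \<partial>lborel)"
    proof (rule integral_mono)
      show "integrable lborel (\<lambda>x. indicator (S n) x * h x)"
        by (rule integrable_bounded_times[OF _ _ ih, where M=1]) (auto simp: indicator_def)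
      have "integrable lborel (\<lambda>x. (indicator upper x * B x) * ((G x \<bullet> b) * \<zeta> x))"
        by (rule integrable_bounded_times[OF _ _ iG, where M=1]) (measurable, auto simp: indicator_def Bb)
      then have "integrable lborel (\<lambda>x. indicator upper x * ((G x \<bullet> b) * (\<zeta> x * B x)))" by (simp add: ac_simps)
      then show "integrable lborel (\<lambda>x. (U x * B x) * pderiv_dir \<zeta> b x + indicator upper x * ((G x \<bullet> b) * (\<zeta> x * B x)))"
        by (rule Bochner_Integration.integrable_add[OF i1])
      fix x
      show "(U x * B x) * pderiv_dir \<zeta> b x + indicator upper x * ((G x \<bullet> b) * (\<zeta> x * B x)) \<le> indicator (S n) x * h x"
      proof (cases "x \<in> S n")
        case True
        have B1: "0 \<le> B x" "B x \<le> 1" by (auto simp: B_def flat_1_nonneg flat_1_le)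
        have "(U x * B x) * pderiv_dir \<zeta> b x \<le> M * \<bar>pderiv_dir \<zeta> b x\<bar>"
        proof -
          have "(U x * B x) * pderiv_dir \<zeta> b x \<le> (U x * B x) * \<bar>pderiv_dir \<zeta> b x\<bar>" using u_nonneg B1 by (intro mult_left_mono) auto
          also have "\<dots> \<le> (M * 1) * \<bar>pderiv_dir \<zeta> b x\<bar>" using u_nonneg[of x] u_le[of x] B1 M by (intro mult_right_mono mult_mono) auto
          finally show ?thesis by simp
        qed
        moreover have "(G x \<bullet> b) * (\<zeta> x * B x) \<le> \<bar>(G x \<bullet> b) * \<zeta> x\<bar>"
        proof -
          have "(G x \<bullet> b) * (\<zeta> x * B x) \<le> \<bar>(G x \<bullet> b) * \<zeta> x\<bar> * B x"
            using mult_right_mono[OF abs_ge_self[of "(G x \<bullet> b) * \<zeta> x"] B1(1)] by (simp add: mult.assoc)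
          also have "\<dots> \<le> \<bar>(G x \<bullet> b) * \<zeta> x\<bar> * 1" using B1 by (intro mult_left_mono) auto
          finally show ?thesis by simp
        qed
        ultimately show ?thesis using True by (simp add: h_def S_def)
      next
        case False
        then have "x \<bullet> b \<le> 0 \<or> B x = 0" by (auto simp: S_def B_def intro!: flat_eq_0)
        then show ?thesis using False U_outside[of x] by (auto simp: indicator_def)
      qed
    qed
    finally have up: "real n * (\<integral>x. (U x * B' x) * \<zeta> x \<partial>lborel) \<le> (\<integral>x. indicator (S n) x * h x \<partial>lborel)" .
    have "(\<integral>x. indicator (T n) x * (U x * \<zeta> x) \<partial>lborel) \<le> (\<integral>x. 4 * exp 1 * ((U x * B' x) * \<zeta> x) \<partial>lborel)"
    proof (rule integral_mono)
      show "integrable lborel (\<lambda>x. 4 * exp 1 * ((U x * B' x) * \<zeta> x))" by (intro integrable_mult_right i2)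
      have "integrable lborel (\<lambda>x. (indicator (T n) x * U x) * \<zeta> x)"
        by (rule integrable_bounded_times[OF _ _ izz, where M=M]) (use U_abs M in \<open>auto simp: indicator_def\<close>)
      then show "integrable lborel (\<lambda>x. indicator (T n) x * (U x * \<zeta> x))" by (simp add: mult.assoc)
      fix x
      show "indicator (T n) x * (U x * \<zeta> x) \<le> 4 * exp 1 * ((U x * B' x) * \<zeta> x)"
      proof (cases "x \<in> T n")
        case True
        define t where "t = 2 + (- real n) * (x \<bullet> b)"
        have "real n * (x \<bullet> b) > 0" using True n by (simp add: T_def)
        then have t: "1 < t" "t < 2" using True by (auto simp: T_def t_def)
        \<comment> \<open>For t between 1 and 2 the value (1/t)^2 exp(-1/t) is at least 1/(4
          e).\<close>
        have "1 \<le> 4 * exp 1 * B' x"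
        proof -
          have y: "1/2 \<le> 1/t" "1/t \<le> 1" using t by (auto simp: field_simps)
          then have "(1/2) * (1/2) * exp (-1) \<le> (1/t) * (1/t) * exp (-(1/t))" using t by (intro mult_mono) auto
          also have "\<dots> = B' x" using t unfolding B'_def t_def[symmetric] by (simp add: flat_deriv_1 flat_def)
          finally have "4 * exp 1 * ((1/2) * (1/2) * exp (-1)) \<le> 4 * exp 1 * B' x" by (intro mult_left_mono) auto
          then show ?thesis by (simp add: exp_minus)
        qed
        from mult_right_mono[OF this, of "U x * \<zeta> x"] show ?thesis
          using True u_nonneg[of x] \<zeta>_nn[of x] by (simp add: ac_simps)
      next
        case False
        then show ?thesis using u_nonneg[of x] \<zeta>_nn[of x] by (simp add: B'_def flat_deriv_1_nonneg)
      qed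
    qed
    then have "real n * (\<integral>x. indicator (T n) x * (U x * \<zeta> x) \<partial>lborel) \<le> real n * (4 * exp 1 * (\<integral>x. (U x * B' x) * \<zeta> x \<partial>lborel))"
      by (intro mult_left_mono) (auto simp only: integral_mult_right_zero of_nat_0_le_iff)
    also have "\<dots> \<le> 4 * exp 1 * (\<integral>x. indicator (S n) x * h x \<partial>lborel)"
      using mult_left_mono[OF up, of "4 * exp 1"] by (simp add: ac_simps)
    finally show ?thesis .
  qed
  have "(\<lambda>n. \<integral>x. indicator (S n) x * h x \<partial>lborel) \<longlonglongrightarrow> (\<integral>x. 0 * h x \<partial>lborel)"
  proof (rule integral_tendsto_bounded_factor[OF ih, where C=1])
    show "(\<lambda>n. indicator (S n) x :: real) \<longlonglongrightarrow> 0" for x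
    proof (cases "0 < x \<bullet> b")
      case True
      obtain n0 :: nat where n0: "2 / (x \<bullet> b) < real n0" using reals_Archimedean2 by blast
      have "x \<notin> S n" if "n \<ge> n0" for n
      proof -
        have "2 / (x \<bullet> b) < real n" using n0 that by (meson less_le_trans of_nat_le_iff)
        then show ?thesis using True by (simp add: S_def pos_divide_less_eq)
      qed
      then have "\<forall>\<^sub>F n in sequentially. (indicator (S n) x :: real) = 0"
        by (intro eventually_sequentiallyI[of n0]) simp
      then show ?thesis by (rule tendsto_eventually)
    next
      case False then show ?thesis by (simp add: S_def)
    qed
  qed (auto simp: indicator_def)
  then have "(\<lambda>n. \<integral>x. indicator (S n) x * h x \<partial>lborel) \<longlonglongrightarrow> 0" by simp
  then have "(\<lambda>n. 4 * exp 1 * (\<integral>x. indicator (S n) x * h x \<partial>lborel)) \<longlonglongrightarrow> 4 * exp 1 * 0" by (intro tendsto_intros)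
  then have lim: "(\<lambda>n. 4 * exp 1 * (\<integral>x. indicator (S n) x * h x \<partial>lborel)) \<longlonglongrightarrow> 0" by simp
  show ?thesis
  proof (rule tendsto_sandwich[OF _ _ tendsto_const lim])
    show "\<forall>\<^sub>F n in sequentially. real n * (\<integral>x. indicator {x. 0 < x \<bullet> b \<and> real n * (x \<bullet> b) < 1} x * (U x * \<zeta> x) \<partial>lborel) \<le> 4 * exp 1 * (\<integral>x. indicator (S n) x * h x \<partial>lborel)"
      using bound unfolding T_def by (intro eventually_sequentiallyI[of 1]) simp
    show "\<forall>\<^sub>F n in sequentially. 0 \<le> real n * (\<integral>x. indicator {x. 0 < x \<bullet> b \<and> real n * (x \<bullet> b) < 1} x * (U x * \<zeta> x) \<partial>lborel)"
      using u_nonneg \<zeta>_nn by (intro always_eventually allI mult_nonneg_nonneg Bochner_Integration.integral_nonneg) auto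
  qed
qed

end

text \<open>A bump of radius 2 r stays above a positive constant on the ball of radius r that
  contains the support, so a multiple of it dominates.\<close>

lemma smooth_majorant:
  fixes f :: "'a::euclidean_space \<Rightarrow> real"
  assumes "continuous_on UNIV f" "compact K" "\<And>x. x \<notin> K \<Longrightarrow> f x = 0"
  obtains \<zeta> K' where "\<zeta> \<in> smooth_class" "compact K'" "\<And>x. x \<notin> K' \<Longrightarrow> \<zeta> x = 0" "\<And>x. 0 \<le> \<zeta> x" "\<And>x. \<bar>f x\<bar> \<le> \<zeta> x"
proof -
  obtain B where B: "B > 0" "\<And>x. \<bar>f x\<bar> \<le> B" using continuous_compact_support_bounded[OF assms] by blast
  obtain r where r: "r > 0" "K \<subseteq> cball 0 r"
  proof -
    obtain r where "r > 0" "\<And>x. x \<in> K \<Longrightarrow> norm x \<le> r" using compact_imp_bounded[OF assms(2)] unfolding bounded_pos by blast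
    then show ?thesis using that by (auto simp: subset_iff)
  qed
  \<comment> \<open>On radius r the argument of the bump is at least 3/4, and exp(-4/3) is the value
    of \<open>flat 1\<close> there.\<close>
  define C where "C = B / exp (-(4/3))"
  define \<zeta> where "\<zeta> x = C * flat 1 (1 - 1 / (2 * r)\<^sup>2 * (norm (x - 0))\<^sup>2)" for x :: 'a
  have C: "C > 0" using B by (simp add: C_def)
  show ?thesis
  proof (rule that)
    show "\<zeta> \<in> smooth_class" unfolding \<zeta>_def[abs_def]
      by (intro smooth_class.mult smooth_class.flat smooth_class.const smooth_class_diff smooth_class_norm_diff_square)
    show "compact (cball (0::'a) (2 * r))" by simp
    show "\<zeta> x = 0" if "x \<notin> cball 0 (2 * r)" for x
    proof -
      have "(2 * r)\<^sup>2 \<le> (norm x)\<^sup>2" using that r by (intro power_mono) auto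
      then show ?thesis using r by (simp add: \<zeta>_def flat_eq_0 field_simps)
    qed
    show nn: "0 \<le> \<zeta> x" for x using C by (simp add: \<zeta>_def flat_1_nonneg)
    show "\<bar>f x\<bar> \<le> \<zeta> x" for x
    proof (cases "x \<in> K")
      case True
      then have "norm x \<le> r" using r by auto
      then have "(norm x)\<^sup>2 \<le> r\<^sup>2" by (intro power_mono) auto
      then have "1 / (2 * r)\<^sup>2 * (norm x)\<^sup>2 \<le> 1 / (2 * r)\<^sup>2 * r\<^sup>2" by (intro mult_left_mono) auto
      also have "\<dots> = 1 / 4" using r by (simp add: power_mult_distrib)
      finally have "3/4 \<le> 1 - 1 / (2 * r)\<^sup>2 * (norm (x - 0))\<^sup>2" by simp
      then have "flat 1 (3/4) \<le> flat 1 (1 - 1 / (2 * r)\<^sup>2 * (norm (x - 0))\<^sup>2)" by (rule flat_1_mono)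
      then have "C * flat 1 (3/4) \<le> \<zeta> x" unfolding \<zeta>_def using C by (intro mult_left_mono) auto
      moreover have "C * flat 1 (3/4) = B" by (simp add: C_def flat_def)
      ultimately show ?thesis using B(2)[of x] by simp
    qed (use assms(3) nn in auto)
  qed
qed

lemma smooth_class_measurable: "f \<in> smooth_class \<Longrightarrow> f \<in> borel_measurable borel"
  by (rule borel_measurable_continuous_onI) (rule smooth_class_continuous)

context weak_half_space
begin

lemma G_grad_upper:
  assumes "\<phi> \<in> smooth_class" "compact K" "\<And>x. x \<notin> K \<Longrightarrow> \<phi> x = 0"
  shows "(\<integral>x. indicator upper x * (G x \<bullet> grad \<phi> x) \<partial>lborel) = (\<integral>x. G x \<bullet> grad \<phi> x \<partial>lborel)"
proof -
  have i: "integrable lborel (\<lambda>x. indicator upper x * ((G x \<bullet> c) * pderiv_dir \<phi> c x))" if "c \<in> Basis" for c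
    by (rule integrable_bounded_times[OF _ _ G_grad_integrable[OF assms that], where M=1]) (auto simp: indicator_def)
  have "(\<integral>x. indicator upper x * (G x \<bullet> grad \<phi> x) \<partial>lborel) = (\<Sum>c\<in>Basis. \<integral>x. indicator upper x * ((G x \<bullet> c) * pderiv_dir \<phi> c x) \<partial>lborel)"
    unfolding G_inner_grad sum_distrib_left by (rule Bochner_Integration.integral_sum) (rule i)
  also have "\<dots> = (\<Sum>c\<in>Basis. \<integral>x. (G x \<bullet> c) * pderiv_dir \<phi> c x \<partial>lborel)"
    by (intro sum.cong refl G_upper[OF smooth_class_pderiv_dir[OF assms(1)] assms(2) test_fun_pderiv_dir(2)[OF assms(1,2) subset_UNIV assms(3)]])
  also have "\<dots> = (\<integral>x. G x \<bullet> grad \<phi> x \<partial>lborel)"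
    unfolding G_inner_grad by (rule Bochner_Integration.integral_sum[symmetric]) (rule G_grad_integrable[OF assms])
  finally show ?thesis .
qed

lemma rhs_le: "rhs p l q s P U x \<le> M powr p"
proof -
  have "U x powr p \<le> M powr p" using u_nonneg u_le p by (intro powr_mono2) auto
  moreover have "0 \<le> (\<Sum>i<l. U x powr q i / norm (x - P i) powr s i)" by (intro sum_nonneg) auto
  ultimately show ?thesis unfolding rhs_def by linarith
qed

section \<open>The zero extension is a subsolution across the boundary\<close>

definition ramp_scale :: real where "ramp_scale = flat 1 (1/2)"
text \<open>As a function of the height it rises from 0 at the boundary to 1 at height 1/(2 n), and
  it is concave there because \<open>flat 1\<close> is convex up to 1/2. Concavity fixes the sign of
  the term with the second derivative.\<close>

definition ramp :: "nat \<Rightarrow> 'a \<Rightarrow> real" where "ramp n x = 1 - 1 / ramp_scale * flat 1 (1/2 + (- real n) * (x \<bullet> b))"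
definition ramp' :: "nat \<Rightarrow> 'a \<Rightarrow> real" where "ramp' n x = real n / ramp_scale * flat (flat_deriv 1) (1/2 + (- real n) * (x \<bullet> b))"

lemma ramp_scale: "ramp_scale > 0" by (simp add: ramp_scale_def flat_def)

lemma ramp_smooth: "ramp n \<in> smooth_class" "ramp' n \<in> smooth_class"
  unfolding ramp_def[abs_def] ramp'_def[abs_def]
  by (intro smooth_class_diff smooth_class_cmult smooth_class_flat_affine smooth_class.const)+

lemma pderiv_ramp: "pderiv_dir (ramp n) c x = ramp' n x * (c \<bullet> b)"
proof -
  have "(ramp n has_derivative (\<lambda>v. 0 - 1 / ramp_scale * (flat (flat_deriv 1) (1/2 + (- real n) * (x \<bullet> b)) * ((- real n) * (v \<bullet> b))))) (at x)"
    unfolding ramp_def[abs_def]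
    by (intro has_derivative_diff has_derivative_const has_derivative_mult_right has_derivative_flat)
       (auto intro!: derivative_eq_intros)
  from pderiv_dir_eqI[OF this] show ?thesis by (simp add: ramp'_def)
qed

lemma pderiv_ramp': "pderiv_dir (ramp' n) b x = - ((real n)\<^sup>2 / ramp_scale * flat (flat_deriv (flat_deriv 1)) (1/2 + (- real n) * (x \<bullet> b)))"
proof -
  have "(ramp' n has_derivative (\<lambda>v. real n / ramp_scale * (flat (flat_deriv (flat_deriv 1)) (1/2 + (- real n) * (x \<bullet> b)) * ((- real n) * (v \<bullet> b))))) (at x)"
    unfolding ramp'_def[abs_def]
    by (intro has_derivative_mult_right has_derivative_flat) (auto intro!: derivative_eq_intros)
  from pderiv_dir_eqI[OF this] show ?thesis using b by (simp add: power2_eq_square)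
qed

lemma ramp_bounds:
  assumes "0 \<le> x \<bullet> b"
  shows "0 \<le> ramp n x" "ramp n x \<le> 1" "ramp n x \<le> 2 * real n / ramp_scale * (x \<bullet> b)"
proof -
  define t where "t = 1/2 + (- real n) * (x \<bullet> b)"
  have nx: "0 \<le> real n * (x \<bullet> b)" using assms by simp
  have "flat 1 t \<le> ramp_scale" unfolding ramp_scale_def by (rule flat_1_mono) (use nx in \<open>simp add: t_def\<close>)
  then show "0 \<le> ramp n x" using ramp_scale unfolding ramp_def t_def[symmetric] by simp
  show "ramp n x \<le> 1" using ramp_scale flat_1_nonneg[of t] unfolding ramp_def t_def[symmetric] by simp
  have "ramp_scale - flat 1 t \<le> 2 * (real n * (x \<bullet> b))"
    using flat_1_lipschitz[of "1/2" t] nx unfolding ramp_scale_def t_def by (auto simp: abs_le_iff)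
  then have "(ramp_scale - flat 1 t) / ramp_scale \<le> 2 * (real n * (x \<bullet> b)) / ramp_scale" using ramp_scale by (intro divide_right_mono) auto
  moreover have "ramp n x = (ramp_scale - flat 1 t) / ramp_scale" using ramp_scale unfolding ramp_def t_def[symmetric] by (simp add: diff_divide_distrib)
  ultimately show "ramp n x \<le> 2 * real n / ramp_scale * (x \<bullet> b)" by simp
qed

lemma ramp'_bounds: "0 \<le> ramp' n x" "ramp' n x \<le> 2 * real n / ramp_scale"
proof -
  show "0 \<le> ramp' n x" unfolding ramp'_def using ramp_scale by (simp add: flat_deriv_1_nonneg)
  have "ramp' n x \<le> real n / ramp_scale * 2" unfolding ramp'_def using ramp_scale by (intro mult_left_mono flat_deriv_1_le) auto
  then show "ramp' n x \<le> 2 * real n / ramp_scale" by (simp add: mult.commute)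
qed

text \<open>The equation is tested with \<phi> times a ramp times a further cutoff at height 1/m,
  since test functions must have support inside. As m grows, the derivative of that cutoff
  disappears because the ramp vanishes linearly. The right-hand side is only bounded from above, by
  M^p.\<close>

lemma subsolution_step:
  assumes \<phi>: "\<phi> \<in> smooth_class" "compact K" "\<And>x. x \<notin> K \<Longrightarrow> \<phi> x = 0" and \<phi>_nn: "\<And>x. 0 \<le> \<phi> x"
  shows "(\<integral>x. indicator upper x * ramp n x * (G x \<bullet> grad \<phi> x) \<partial>lborel) + (\<integral>x. indicator upper x * ramp' n x * ((G x \<bullet> b) * \<phi> x) \<partial>lborel)
     \<le> M powr p * (\<integral>x. \<phi> x \<partial>lborel)"
proof -
  define al where "al m x = flat 1 (-1 + real m * (x \<bullet> b))" for m :: nat and x :: 'a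
  define al' where "al' m x = real m * flat (flat_deriv 1) (-1 + real m * (x \<bullet> b))" for m :: nat and x :: 'a
  have als: "al m \<in> smooth_class" "al' m \<in> smooth_class" for m unfolding al_def[abs_def] al'_def[abs_def]
    by (intro smooth_class_cmult smooth_class_flat_affine)+
  have pal: "pderiv_dir (al m) c x = al' m x * (c \<bullet> b)" for m c x
    unfolding al_def[abs_def] al'_def pderiv_dir_flat_affine by simp
  have [measurable]: "al m \<in> borel_measurable borel" "al' m \<in> borel_measurable borel" "ramp n \<in> borel_measurable borel" "ramp' n \<in> borel_measurable borel" for m
    by (intro smooth_class_measurable als ramp_smooth)+
  have al0: "al m x = 0" "al' m x = 0" if "x \<bullet> b \<le> 0" for m x
  proof -
    have "real m * (x \<bullet> b) \<le> 0" using that by (simp add: mult_nonneg_nonpos)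
    then show "al m x = 0" "al' m x = 0" by (auto simp: al_def al'_def flat_eq_0)
  qed
  have alb: "0 \<le> al m x" "al m x \<le> 1" "0 \<le> al' m x" for m x
    by (auto simp: al_def al'_def flat_1_nonneg flat_1_le flat_deriv_1_nonneg)
  have iGg: "integrable lborel (\<lambda>x. G x \<bullet> grad \<phi> x)" unfolding G_inner_grad
    by (intro Bochner_Integration.integrable_sum G_grad_integrable[OF \<phi>])
  have iGb: "integrable lborel (\<lambda>x. (G x \<bullet> b) * \<phi> x)"
    by (rule loc_integrable_times[OF G_loc[OF b] smooth_class_continuous[OF \<phi>(1)] \<phi>(2,3)])
  have i\<phi>: "integrable lborel \<phi>"
    by (rule integrable_continuous_compact_support[OF smooth_class_continuous[OF \<phi>(1)] \<phi>(2,3)])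
  define w1 where "w1 m x = al m x * ramp n x" for m x
  define w2 where "w2 m x = al' m x * ramp n x + al m x * ramp' n x" for m x
  have w1b: "\<bar>w1 m x\<bar> \<le> 1" for m x
  proof (cases "x \<bullet> b \<le> 0")
    case False
    have "al m x * ramp n x \<le> 1 * 1" using alb ramp_bounds[of x n] False by (intro mult_mono) auto
    then show ?thesis using alb(1)[of m x] ramp_bounds(1)[of x n] False by (simp add: w1_def)
  qed (simp add: w1_def al0)
  define C where "C = 8 * real n / ramp_scale + 2 * real n / ramp_scale"
  have C0: "C \<ge> 0" using ramp_scale by (simp add: C_def)
  \<comment> \<open>The derivative of the cutoff is of order m, but the ramp is at most a multiple
    of the height; the product is governed by the moment bound and tends to 0.\<close>
  have w2_al': "\<bar>al' m x * ramp n x\<bar> \<le> (2 * real n / ramp_scale) * \<bar>(real m * (x \<bullet> b)) * flat (flat_deriv 1) (-1 + real m * (x \<bullet> b))\<bar>" if "x \<bullet> b > 0" for m x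
  proof -
    have "al' m x * ramp n x \<le> al' m x * (2 * real n / ramp_scale * (x \<bullet> b))" using alb ramp_bounds[of x n] that by (intro mult_left_mono) auto
    also have "\<dots> = (2 * real n / ramp_scale) * ((real m * (x \<bullet> b)) * flat (flat_deriv 1) (-1 + real m * (x \<bullet> b)))" by (simp add: al'_def)
    also have "\<dots> \<le> (2 * real n / ramp_scale) * \<bar>(real m * (x \<bullet> b)) * flat (flat_deriv 1) (-1 + real m * (x \<bullet> b))\<bar>" using ramp_scale by (intro mult_left_mono) auto
    finally show ?thesis using alb(3)[of m x] ramp_bounds(1)[of x n] that by simp
  qed
  have w2b: "\<bar>w2 m x\<bar> \<le> C" for m x
  proof (cases "x \<bullet> b \<le> 0")
    case True then show ?thesis using C0 by (simp add: w2_def al0)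
  next
    case False
    have "\<bar>(real m * (x \<bullet> b)) * flat (flat_deriv 1) (-1 + real m * (x \<bullet> b))\<bar> \<le> 4"
      using flat_deriv_1_moment[of "-1 + real m * (x \<bullet> b)"] by simp
    then have "(2 * real n / ramp_scale) * \<bar>(real m * (x \<bullet> b)) * flat (flat_deriv 1) (-1 + real m * (x \<bullet> b))\<bar> \<le> (2 * real n / ramp_scale) * 4"
      using ramp_scale by (intro mult_left_mono) auto
    then have "\<bar>al' m x * ramp n x\<bar> \<le> 8 * real n / ramp_scale" using w2_al'[of x m] False by simp
    moreover have "al m x * ramp' n x \<le> 1 * (2 * real n / ramp_scale)" using alb ramp'_bounds by (intro mult_mono) auto
    moreover have "0 \<le> al m x * ramp' n x" using alb ramp'_bounds by simp
    ultimately show ?thesis unfolding w2_def C_def by linarith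
  qed
  have lim1: "(\<lambda>m. \<integral>x. w1 m x * (G x \<bullet> grad \<phi> x) \<partial>lborel) \<longlonglongrightarrow> (\<integral>x. (indicator upper x * ramp n x) * (G x \<bullet> grad \<phi> x) \<partial>lborel)"
  proof (rule integral_tendsto_bounded_factor[OF iGg _ _ w1b])
    show "w1 m \<in> borel_measurable borel" for m unfolding w1_def by measurable
    show "(\<lambda>x. indicator upper x * ramp n x) \<in> borel_measurable borel" by measurable
    show "(\<lambda>m. w1 m x) \<longlonglongrightarrow> indicator upper x * ramp n x" for x
    proof (cases "0 < x \<bullet> b")
      case True
      then show ?thesis using tendsto_mult_right[OF flat_1_tendsto(1)[OF True], of "ramp n x"] by (simp add: w1_def al_def)
    qed (simp add: w1_def al0)
  qed
  have lim2: "(\<lambda>m. \<integral>x. w2 m x * ((G x \<bullet> b) * \<phi> x) \<partial>lborel) \<longlonglongrightarrow> (\<integral>x. (indicator upper x * ramp' n x) * ((G x \<bullet> b) * \<phi> x) \<partial>lborel)"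
  proof (rule integral_tendsto_bounded_factor[OF iGb _ _ w2b])
    show "w2 m \<in> borel_measurable borel" for m unfolding w2_def by measurable
    show "(\<lambda>x. indicator upper x * ramp' n x) \<in> borel_measurable borel" by measurable
    show "(\<lambda>m. w2 m x) \<longlonglongrightarrow> indicator upper x * ramp' n x" for x
    proof (cases "0 < x \<bullet> b")
      case True
      have "(\<lambda>m. (2 * real n / ramp_scale) * \<bar>(real m * (x \<bullet> b)) * flat (flat_deriv 1) (-1 + real m * (x \<bullet> b))\<bar>) \<longlonglongrightarrow> (2 * real n / ramp_scale) * \<bar>0\<bar>"
        by (intro tendsto_intros flat_1_tendsto True)
      then have "(\<lambda>m. (2 * real n / ramp_scale) * \<bar>(real m * (x \<bullet> b)) * flat (flat_deriv 1) (-1 + real m * (x \<bullet> b))\<bar>) \<longlonglongrightarrow> 0" by simp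
      then have "(\<lambda>m. al' m x * ramp n x) \<longlonglongrightarrow> 0"
        by (rule Lim_null_comparison[rotated]) (use w2_al'[OF True] in auto)
      moreover have "(\<lambda>m. al m x * ramp' n x) \<longlonglongrightarrow> 1 * ramp' n x" unfolding al_def by (intro tendsto_intros flat_1_tendsto True)
      ultimately have "(\<lambda>m. al' m x * ramp n x + al m x * ramp' n x) \<longlonglongrightarrow> 0 + 1 * ramp' n x" by (rule tendsto_add)
      then show ?thesis using True by (simp add: w2_def)
    qed (simp add: w2_def al0)
  qed
  have bound: "(\<integral>x. w1 m x * (G x \<bullet> grad \<phi> x) \<partial>lborel) + (\<integral>x. w2 m x * ((G x \<bullet> b) * \<phi> x) \<partial>lborel) \<le> M powr p * (\<integral>x. \<phi> x \<partial>lborel)" if m: "m > 0" for m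
  proof -
    define \<xi> where "\<xi> x = \<phi> x * (al m x * ramp n x)" for x
    have sm: "\<xi> \<in> smooth_class" unfolding \<xi>_def[abs_def] by (intro smooth_class.mult \<phi> als ramp_smooth)
    have sab: "(\<lambda>x. al m x * ramp n x) \<in> smooth_class" by (intro smooth_class.mult als ramp_smooth)
    define K' where "K' = K \<inter> {x. 1 \<le> real m * (x \<bullet> b)}"
    have K': "compact K'" unfolding K'_def by (intro compact_Int_closed \<phi>(2) closed_Collect_le continuous_intros)
    have K'u: "K' \<subseteq> {x. 0 < x \<bullet> b}" using m by (auto simp: K'_def) (smt (verit) mult_nonneg_nonpos of_nat_0_le_iff)
    have out: "\<xi> x = 0" if "x \<notin> K'" for x
      using that \<phi>(3)[of x] by (auto simp: K'_def \<xi>_def al_def flat_eq_0)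
    have pd: "pderiv_dir \<xi> c x = w1 m x * pderiv_dir \<phi> c x + w2 m x * \<phi> x * (c \<bullet> b)" for c x
      unfolding \<xi>_def[abs_def] pderiv_dir_mult[OF \<phi>(1) sab] pderiv_dir_mult[OF als(1) ramp_smooth(1)] pal pderiv_ramp
      by (simp add: w1_def w2_def algebra_simps)
    have Gx: "G x \<bullet> grad \<xi> x = w1 m x * (G x \<bullet> grad \<phi> x) + w2 m x * ((G x \<bullet> b) * \<phi> x)" for x
    proof -
      have "(\<Sum>c\<in>Basis. (G x \<bullet> c) * (c \<bullet> b)) = G x \<bullet> b"
        using euclidean_inner[of "G x" b] by (simp add: inner_commute)
      moreover have "(\<Sum>c\<in>Basis. (G x \<bullet> c) * (w2 m x * \<phi> x * (c \<bullet> b))) = w2 m x * \<phi> x * (\<Sum>c\<in>Basis. (G x \<bullet> c) * (c \<bullet> b))"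
        by (simp add: sum_distrib_left ac_simps)
      ultimately have "(\<Sum>c\<in>Basis. (G x \<bullet> c) * (w2 m x * \<phi> x * (c \<bullet> b))) = w2 m x * \<phi> x * (G x \<bullet> b)"
        by simp
      moreover have "(\<Sum>c\<in>Basis. (G x \<bullet> c) * (w1 m x * pderiv_dir \<phi> c x)) = w1 m x * (\<Sum>c\<in>Basis. (G x \<bullet> c) * pderiv_dir \<phi> c x)"
        by (simp add: sum_distrib_left mult.left_commute)
      ultimately show ?thesis unfolding G_inner_grad pd distrib_left sum.distrib by (simp add: ac_simps)
    qed
    have i1: "integrable lborel (\<lambda>x. w1 m x * (G x \<bullet> grad \<phi> x))" "integrable lborel (\<lambda>x. w2 m x * ((G x \<bullet> b) * \<phi> x))"
      using integrable_bounded_times[OF _ w1b iGg] integrable_bounded_times[OF _ w2b iGb] unfolding w1_def[abs_def] w2_def[abs_def] by auto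
    have "(\<integral>x. w1 m x * (G x \<bullet> grad \<phi> x) \<partial>lborel) + (\<integral>x. w2 m x * ((G x \<bullet> b) * \<phi> x) \<partial>lborel) = (\<integral>x. G x \<bullet> grad \<xi> x \<partial>lborel)"
      unfolding Gx by (rule Bochner_Integration.integral_add[OF i1, symmetric])
    also have "\<dots> = (\<integral>x. rhs p l q s P U x * \<xi> x \<partial>lborel)" by (rule weak_eq[OF sm K' K'u out])
    also have "\<dots> \<le> (\<integral>x. M powr p * \<phi> x \<partial>lborel)"
    proof (rule integral_mono')
      show "integrable lborel (\<lambda>x. M powr p * \<phi> x)" by (intro integrable_mult_right i\<phi>)
      fix x
      show "0 \<le> M powr p * \<phi> x" using \<phi>_nn by simp
      show "rhs p l q s P U x * \<xi> x \<le> M powr p * \<phi> x"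
      proof -
        have w: "0 \<le> w1 m x" "w1 m x \<le> 1"
          using w1b[of m x] alb[of m x] ramp_bounds(1)[of x n] al0[of x m] unfolding w1_def by (auto, cases "0 \<le> x \<bullet> b") auto
        have "rhs p l q s P U x * \<xi> x \<le> M powr p * \<xi> x"
          using w \<phi>_nn[of x] by (intro mult_right_mono rhs_le) (simp add: \<xi>_def w1_def)
        also have "\<dots> \<le> M powr p * \<phi> x"
        proof (rule mult_left_mono)
          show "\<xi> x \<le> \<phi> x" using mult_left_mono[OF w(2) \<phi>_nn[of x]] by (simp add: \<xi>_def w1_def)
        qed simp
        finally show ?thesis .
      qed
    qed
    finally show ?thesis by simp
  qed
  show ?thesis
    by (rule LIMSEQ_le_const2[OF tendsto_add[OF lim1 lim2]]) (use bound in \<open>auto intro!: exI[of _ 1]\<close>)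
qed

text \<open>In the limit of steep ramps the term with the derivative of the ramp must not be too
  negative. Integrated by parts it is minus an integral of U against two terms: one carries the
  second derivative of the concave ramp and has the right sign, the other is of order n on a layer
  of width 1/n, where the zero trace makes it vanish.\<close>

lemma subsolution:
  assumes \<phi>: "\<phi> \<in> smooth_class" "compact K" "\<And>x. x \<notin> K \<Longrightarrow> \<phi> x = 0" and \<phi>_nn: "\<And>x. 0 \<le> \<phi> x"
  shows "- (M powr p) * (\<integral>x. \<phi> x \<partial>lborel) \<le> (\<integral>x. U x * lap \<phi> x \<partial>lborel)"
proof -
  note pd = smooth_class_pderiv_dir[OF \<phi>(1)]
  note pout = test_fun_pderiv_dir(2)[OF \<phi>(1,2) subset_UNIV \<phi>(3)]
  \<comment> \<open>The vanishing of layer integrals was shown for nonnegative smooth weights;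
    \<zeta> is such a weight dominating the derivative of \<phi>.\<close>
  obtain \<zeta> K' where \<zeta>: "\<zeta> \<in> smooth_class" "compact K'" "\<And>x. x \<notin> K' \<Longrightarrow> \<zeta> x = 0" "\<And>x. 0 \<le> \<zeta> x" "\<And>x. \<bar>pderiv_dir \<phi> b x\<bar> \<le> \<zeta> x"
    using smooth_majorant[OF smooth_class_continuous[OF pd] \<phi>(2) pout] by blast
  define J where "J n = real n * (\<integral>x. indicator {x. 0 < x \<bullet> b \<and> real n * (x \<bullet> b) < 1} x * (U x * \<zeta> x) \<partial>lborel)" for n
  have J: "J \<longlonglongrightarrow> 0" unfolding J_def[abs_def] by (rule U_small_near_boundary[OF \<zeta>(1-4)])
  have Tm [measurable]: "{x. 0 < x \<bullet> b \<and> real n * (x \<bullet> b) < 1} \<in> sets borel" for n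
    by (intro borel_open open_Collect_conj open_Collect_less continuous_intros)
  have ramp_m [measurable]: "ramp n \<in> borel_measurable borel" "ramp' n \<in> borel_measurable borel" for n
    by (intro smooth_class_measurable ramp_smooth)+
  have low: "- (2 / ramp_scale * J n) \<le> (\<integral>x. indicator upper x * ramp' n x * ((G x \<bullet> b) * \<phi> x) \<partial>lborel)" for n
  proof -
    have sm: "(\<lambda>x. \<phi> x * ramp' n x) \<in> smooth_class" by (intro smooth_class.mult \<phi> ramp_smooth)
    have so: "\<phi> x * ramp' n x = 0" if "x \<notin> K" for x using \<phi>(3)[OF that] by simp
    have "(\<integral>x. indicator upper x * ramp' n x * ((G x \<bullet> b) * \<phi> x) \<partial>lborel) = (\<integral>x. indicator upper x * ((G x \<bullet> b) * (\<phi> x * ramp' n x)) \<partial>lborel)"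
      by (simp add: ac_simps)
    also have "\<dots> = - (\<integral>x. U x * pderiv_dir (\<lambda>x. \<phi> x * ramp' n x) b x \<partial>lborel)"
      using G_upper[OF sm \<phi>(2) so b] weak_grad[OF sm \<phi>(2) so b] by linarith
    also have "\<dots> \<ge> - (\<integral>x. 2 * real n / ramp_scale * (indicator {x. 0 < x \<bullet> b \<and> real n * (x \<bullet> b) < 1} x * (U x * \<zeta> x)) \<partial>lborel)"
    proof -
      have "integrable lborel (\<lambda>x. (indicator {x. 0 < x \<bullet> b \<and> real n * (x \<bullet> b) < 1} x * U x) * \<zeta> x)"
        by (rule integrable_bounded_times[OF _ _ integrable_continuous_compact_support[OF smooth_class_continuous[OF \<zeta>(1)] \<zeta>(2,3)], where M=M])
           (use U_abs M in \<open>auto simp: indicator_def\<close>)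
      then have i: "integrable lborel (\<lambda>x. 2 * real n / ramp_scale * (indicator {x. 0 < x \<bullet> b \<and> real n * (x \<bullet> b) < 1} x * (U x * \<zeta> x)))"
        by (intro integrable_mult_right) (simp add: mult.assoc)
      have "(\<integral>x. U x * pderiv_dir (\<lambda>x. \<phi> x * ramp' n x) b x \<partial>lborel) \<le> (\<integral>x. 2 * real n / ramp_scale * (indicator {x. 0 < x \<bullet> b \<and> real n * (x \<bullet> b) < 1} x * (U x * \<zeta> x)) \<partial>lborel)"
      proof (rule integral_mono'[OF i])
        fix x
        show "0 \<le> 2 * real n / ramp_scale * (indicator {x. 0 < x \<bullet> b \<and> real n * (x \<bullet> b) < 1} x * (U x * \<zeta> x))"
          using ramp_scale u_nonneg[of x] \<zeta>(4)[of x] by simp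
        show "U x * pderiv_dir (\<lambda>x. \<phi> x * ramp' n x) b x \<le> 2 * real n / ramp_scale * (indicator {x. 0 < x \<bullet> b \<and> real n * (x \<bullet> b) < 1} x * (U x * \<zeta> x))"
        proof (cases "0 < x \<bullet> b")
          case False then show ?thesis using U_outside[of x] by simp
        next
          case True
          then have nx: "0 \<le> real n * (x \<bullet> b)" by simp
          \<comment> \<open>Concavity of the ramp; at nonnegative height the argument of
            \<open>flat\<close> is at most 1/2.\<close>
          have "pderiv_dir (ramp' n) b x \<le> 0" unfolding pderiv_ramp'
            using ramp_scale flat_deriv_deriv_1_nonneg[of "1/2 + (- real n) * (x \<bullet> b)"] nx by simp
          then have "\<phi> x * pderiv_dir (ramp' n) b x \<le> 0" using \<phi>_nn by (simp add: mult_nonneg_nonpos)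
          then have 1: "pderiv_dir (\<lambda>x. \<phi> x * ramp' n x) b x \<le> pderiv_dir \<phi> b x * ramp' n x"
            unfolding pderiv_dir_mult[OF \<phi>(1) ramp_smooth(2)] by simp
          show ?thesis
          proof (cases "real n * (x \<bullet> b) < 1")
            case nsmall: True
            have "pderiv_dir \<phi> b x * ramp' n x \<le> \<zeta> x * ramp' n x" using \<zeta>(5)[of x] ramp'_bounds by (intro mult_right_mono) auto
            also have "\<dots> \<le> \<zeta> x * (2 * real n / ramp_scale)" using \<zeta>(4) ramp'_bounds by (intro mult_left_mono) auto
            finally have "U x * pderiv_dir (\<lambda>x. \<phi> x * ramp' n x) b x \<le> U x * (\<zeta> x * (2 * real n / ramp_scale))"
              using 1 u_nonneg by (intro mult_left_mono) auto
            then show ?thesis using True nsmall by (simp add: ac_simps)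
          next
            case False
            then have "ramp' n x = 0" unfolding ramp'_def by (simp add: flat_eq_0)
            then show ?thesis using 1 False u_nonneg[of x] by (simp add: mult_nonneg_nonpos)
          qed
        qed
      qed
      then show ?thesis by simp
    qed
    finally show ?thesis by (simp add: J_def)
  qed
  have iGg: "integrable lborel (\<lambda>x. G x \<bullet> grad \<phi> x)" unfolding G_inner_grad
    by (intro Bochner_Integration.integrable_sum G_grad_integrable[OF \<phi>])
  have up: "(\<integral>x. indicator upper x * ramp n x * (G x \<bullet> grad \<phi> x) \<partial>lborel) \<le> M powr p * (\<integral>x. \<phi> x \<partial>lborel) + 2 / ramp_scale * J n" for n
    using subsolution_step[OF \<phi> \<phi>_nn, of n] low[of n] by linarith
  have "(\<lambda>n. \<integral>x. (indicator upper x * ramp n x) * (G x \<bullet> grad \<phi> x) \<partial>lborel) \<longlonglongrightarrow> (\<integral>x. indicator upper x * (G x \<bullet> grad \<phi> x) \<partial>lborel)"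
  proof (rule integral_tendsto_bounded_factor[OF iGg, where C=1])
    show "\<bar>indicator upper x * ramp n x\<bar> \<le> 1" for n x using ramp_bounds(1,2)[of x n] by (auto simp: indicator_def)
    show "(\<lambda>n. indicator upper x * ramp n x) \<longlonglongrightarrow> indicator upper x" for x
    proof (cases "0 < x \<bullet> b")
      case True
      obtain n0 :: nat where n0: "1 / (x \<bullet> b) < real n0" using reals_Archimedean2 by blast
      have "ramp n x = 1" if "n \<ge> n0" for n
      proof -
        have "1 / (x \<bullet> b) < real n" using n0 that by (meson less_le_trans of_nat_le_iff)
        then have "1 < real n * (x \<bullet> b)" using True by (simp add: pos_divide_less_eq)
        then show ?thesis by (simp add: ramp_def flat_eq_0)
      qed
      then have "\<forall>\<^sub>F n in sequentially. indicator upper x * ramp n x = indicator upper x"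
        by (intro eventually_sequentiallyI[of n0]) simp
      then show ?thesis by (rule tendsto_eventually)
    qed simp
  qed measurable
  moreover have "(\<lambda>n. M powr p * (\<integral>x. \<phi> x \<partial>lborel) + 2 / ramp_scale * J n) \<longlonglongrightarrow> M powr p * (\<integral>x. \<phi> x \<partial>lborel) + 2 / ramp_scale * 0"
    by (intro tendsto_intros J)
  ultimately have "(\<integral>x. indicator upper x * (G x \<bullet> grad \<phi> x) \<partial>lborel) \<le> M powr p * (\<integral>x. \<phi> x \<partial>lborel) + 2 / ramp_scale * 0"
    by (rule LIMSEQ_le) (use up in auto)
  then show ?thesis using G_grad_upper[OF \<phi>] weak_lap[OF \<phi>] by simp
qed

end

section \<open>The continuous representative\<close>

lemma rho_modulus:
  assumes "e > 0"
  shows "\<exists>d>0. \<forall>y \<xi>::'a::euclidean_space. norm \<xi> < d \<longrightarrow> \<bar>rho (y + \<xi>) - rho y\<bar> < e"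
proof -
  have "uniformly_continuous_on (cball 0 3) (rho :: 'a \<Rightarrow> real)"
    by (intro compact_uniformly_continuous continuous_on_rho) auto
  then obtain d where d: "d > 0" "\<And>x y::'a. norm x \<le> 3 \<Longrightarrow> norm y \<le> 3 \<Longrightarrow> dist y x < d \<Longrightarrow> dist (rho y) (rho x) < e"
    using assms unfolding uniformly_continuous_on_def by (metis mem_cball_0)
  have "\<bar>rho (y + \<xi>) - rho y\<bar> < e" if "norm \<xi> < min d 1" for y \<xi> :: 'a
  proof (cases "norm y \<le> 2")
    case True
    have "norm (y + \<xi>) \<le> 3" using norm_triangle_ineq[of y \<xi>] True that by simp
    then show ?thesis using d(2)[of y "y + \<xi>"] True that by (simp add: dist_norm)
  next
    case False
    have "norm y \<le> norm (y + \<xi>) + norm \<xi>" using norm_triangle_ineq4[of "y + \<xi>" \<xi>] by simp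
    then have "norm (y + \<xi>) \<ge> 1" using False that by simp
    then show ?thesis using False assms by (simp add: rho_outside)
  qed
  then show ?thesis using d(1) by (intro exI[of _ "min d 1"]) auto
qed

text \<open>Moving the centre by t \<xi> can be shifted onto the kernel, whose uniform continuity
  then suffices; no regularity of u is used.\<close>

lemma avg_bounded_uniformly_continuous:
  fixes u :: "'a::euclidean_space \<Rightarrow> real"
  assumes [measurable]: "u \<in> borel_measurable borel" and M: "\<And>x. \<bar>u x\<bar> \<le> M" and t: "t > 0"
  shows "uniformly_continuous_on UNIV (avg u t)"
  unfolding uniformly_continuous_on_def
proof (intro allI impI)
  fix e :: real assume e: "e > 0"
  define V where "V = measure lborel (cball (0::'a) 2)"
  have V: "V \<ge> 0" by (simp add: V_def)
  have M0: "M \<ge> 0" using M[of 0] by linarith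
  define e' where "e' = e / (2 * (M * V + 1))"
  have e': "e' > 0" using e M0 V by (simp add: e'_def add_nonneg_pos)
  obtain d where d: "d > 0" "\<And>y \<xi>::'a. norm \<xi> < d \<Longrightarrow> \<bar>rho (y + \<xi>) - rho y\<bar> < e'" using rho_modulus[OF e'] by blast
  define d' where "d' = min d 1"
  have "dist (avg u t x') (avg u t x) < e" if "dist x' x < t * d'" for x x'
  proof -
    define \<xi> where "\<xi> = (1/t) *\<^sub>R (x' - x)"
    have \<xi>: "norm \<xi> < d'" using that t by (simp add: \<xi>_def dist_norm pos_divide_less_eq mult.commute)
    have x': "x' = x + t *\<^sub>R \<xi>" using t by (simp add: \<xi>_def)
    have "avg u t x' = (\<integral>y. u (x + t *\<^sub>R (y + \<xi>)) * rho ((y + \<xi>) + (- \<xi>)) \<partial>lborel)"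
      by (simp add: avg_def x' algebra_simps)
    also have "\<dots> = (\<integral>y. u (x + t *\<^sub>R y) * rho (y + (- \<xi>)) \<partial>lborel)"
      by (rule integral_translate[of "\<lambda>y. u (x + t *\<^sub>R y) * rho (y + (- \<xi>))"]) measurable
    finally have a: "avg u t x' = (\<integral>y. u (x + t *\<^sub>R y) * rho (y + (- \<xi>)) \<partial>lborel)" .
    have um: "(\<lambda>y. u (x + t *\<^sub>R y)) \<in> borel_measurable borel" by measurable
    have i1: "integrable lborel (\<lambda>y. u (x + t *\<^sub>R y) * rho (y + (- \<xi>)))"
      by (rule integrable_bounded_times[OF um M integrable_translate[OF integrable_rho]])
    have i2: "integrable lborel (\<lambda>y. u (x + t *\<^sub>R y) * rho y)"
      by (rule integrable_bounded_times[OF um M integrable_rho])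
    define D where "D y = u (x + t *\<^sub>R y) * rho (y + (- \<xi>)) - u (x + t *\<^sub>R y) * rho y" for y
    have iD: "integrable lborel D" unfolding D_def by (rule Bochner_Integration.integrable_diff[OF i1 i2])
    have "avg u t x' - avg u t x = (\<integral>y. D y \<partial>lborel)"
      unfolding a avg_def[of u t x] D_def by (rule Bochner_Integration.integral_diff[OF i1 i2, symmetric])
    then have "\<bar>avg u t x' - avg u t x\<bar> \<le> (\<integral>y. \<bar>D y\<bar> \<partial>lborel)" by simp
    also have "\<dots> \<le> (\<integral>y. M * e' * indicator (cball (0::'a) 2) y \<partial>lborel)"
    proof (rule integral_mono)
      show "integrable lborel (\<lambda>y. \<bar>D y\<bar>)" using iD by (rule integrable_abs)
      show "integrable lborel (\<lambda>y::'a. M * e' * indicator (cball 0 2) y)"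
        by (intro integrable_mult_right integrable_real_indicator) (auto simp: emeasure_lborel_cball_finite[unfolded infinity_ennreal_def])
      fix y :: 'a
      show "\<bar>D y\<bar> \<le> M * e' * indicator (cball 0 2) y"
      proof (cases "norm y \<le> 2")
        case True
        have "\<bar>u (x + t *\<^sub>R y)\<bar> * \<bar>rho (y + (- \<xi>)) - rho y\<bar> \<le> M * e'"
          using M d(2)[of "- \<xi>" y] \<xi> M0 by (intro mult_mono) (auto simp: d'_def)
        then show ?thesis using True by (simp add: D_def abs_mult[symmetric] right_diff_distrib)
      next
        case False
        have "norm y \<le> norm (y + (- \<xi>)) + norm \<xi>" using norm_triangle_ineq[of "y + (- \<xi>)" \<xi>] by simp
        then have "norm (y + (- \<xi>)) \<ge> 1" using False \<xi> by (simp add: d'_def)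
        then show ?thesis using False by (simp add: D_def rho_outside)
      qed
    qed
    also have "\<dots> = M * e' * V" by (simp add: V_def)
    also have "\<dots> < e"
    proof -
      have MV: "0 \<le> M * V" using M0 V by simp
      have "M * e' * V = e * (M * V / (2 * (M * V + 1)))" by (simp add: e'_def)
      also have "\<dots> < e * 1" using e MV by (intro mult_strict_left_mono) (auto simp: divide_less_eq)
      finally show ?thesis by simp
    qed
    finally show ?thesis by (simp add: dist_real_def)
  qed
  then show "\<exists>d>0. \<forall>x\<in>UNIV. \<forall>x'\<in>UNIV. dist x' x < d \<longrightarrow> dist (avg u t x') (avg u t x) < e"
    using t d(1) by (intro exI[of _ "t * d'"]) (auto simp: d'_def)
qed

lemma avg_bounded:
  fixes u :: "'a::euclidean_space \<Rightarrow> real"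
  assumes [measurable]: "u \<in> borel_measurable borel" and "\<And>x. 0 \<le> u x" "\<And>x. u x \<le> M"
  shows "0 \<le> avg u t x" "avg u t x \<le> M"
proof -
  have um: "(\<lambda>y. u (x + t *\<^sub>R y)) \<in> borel_measurable borel" by measurable
  have i: "integrable lborel (\<lambda>y. u (x + t *\<^sub>R y) * rho y)"
    using assms by (intro integrable_bounded_times[OF um _ integrable_rho, of M]) auto
  show "0 \<le> avg u t x" unfolding avg_def using assms rho_nonneg by (intro Bochner_Integration.integral_nonneg mult_nonneg_nonneg)
  have "avg u t x \<le> (\<integral>y. M * rho (y::'a) \<partial>lborel)" unfolding avg_def
    by (intro integral_mono i integrable_mult_right integrable_rho mult_right_mono assms rho_nonneg)
  then show "avg u t x \<le> M" by (simp add: integral_rho)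
qed

text \<open>Fubini together with the symmetry of the kernel in its two points: averaging is
  self-adjoint.\<close>

lemma avg_duality:
  fixes U I :: "'a::euclidean_space \<Rightarrow> real"
  assumes [measurable]: "U \<in> borel_measurable borel" "I \<in> borel_measurable borel"
    and M: "\<And>x. \<bar>U x\<bar> \<le> M" and I1: "\<And>x. \<bar>I x\<bar> \<le> 1" and r: "\<And>x. x \<notin> cball 0 r \<Longrightarrow> I x = 0" and t: "t > 0"
  shows "(\<integral>x. I x * avg U t x \<partial>lborel) = (\<integral>z. U z * avg I t z \<partial>lborel)"
proof -
  define k where "k w = rho ((1/t) *\<^sub>R w) / t ^ DIM('a)" for w :: 'a
  have km [measurable]: "k \<in> borel_measurable borel" unfolding k_def by measurable
  have ks: "k (z - x) = k (x - z)" for x z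
    unfolding k_def by (simp add: rho_cong_norm[of "(1/t) *\<^sub>R (z - x)" "(1/t) *\<^sub>R (x - z)"] norm_minus_commute)
  have k0: "k w = 0" if "norm w \<ge> t" for w using that t by (simp add: k_def rho_outside)
  have kc: "continuous_on UNIV k" unfolding k_def using t
    by (intro continuous_intros continuous_on_compose2[OF continuous_on_rho[of UNIV]]) auto
  obtain B where B: "B > 0" "\<And>w. \<bar>k w\<bar> \<le> B"
    using continuous_compact_support_bounded[OF kc, of "cball 0 t"] k0 by auto
  have M0: "M \<ge> 0" using M[of 0] by linarith
  let ?h = "\<lambda>(x, z). I x * (U z * k (z - x))"
  let ?S = "cball (0::'a) r \<times> cball (0::'a) (r + t)"
  have "integrable (lborel \<Otimes>\<^sub>M lborel) ?h"
    unfolding lborel_prod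
  proof (rule Bochner_Integration.integrable_bound[where f="\<lambda>xz. M * B * indicator ?S xz"])
    have "compact ?S" by (intro compact_Times) auto
    then show "integrable lborel (\<lambda>xz. M * B * indicator ?S xz :: real)"
      by (intro integrable_mult_right integrable_real_indicator)
         (auto simp: emeasure_compact_finite[unfolded infinity_ennreal_def] compact_imp_closed borel_closed)
    show "?h \<in> borel_measurable lborel" by (simp add: borel_prod[symmetric])
    show "AE xz in lborel. norm (?h xz) \<le> norm (M * B * indicator ?S xz)"
    proof (rule AE_I2)
      fix xz :: "'a \<times> 'a"
      obtain x z where xz: "xz = (x, z)" by (cases xz)
      show "norm (?h xz) \<le> norm (M * B * indicator ?S xz)"
      proof (cases "xz \<in> ?S")
        case True
        have "\<bar>I x\<bar> * (\<bar>U z\<bar> * \<bar>k (z - x)\<bar>) \<le> 1 * (M * B)"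
          using I1 M B M0 by (intro mult_mono) auto
        then show ?thesis using True M0 B(1) by (simp add: xz abs_mult)
      next
        case False
        have "I x = 0 \<or> k (z - x) = 0"
        proof (cases "x \<in> cball 0 r")
          case True
          then have "norm z > r + t" using False by (auto simp: xz)
          moreover have "norm z \<le> norm (z - x) + norm x" by (metis diff_add_cancel norm_triangle_ineq)
          ultimately have "norm (z - x) \<ge> t" using True by simp
          then show ?thesis using k0 by blast
        qed (use r in auto)
        then show ?thesis by (auto simp: xz)
      qed
    qed
  qed
  then have "(\<integral>z. (\<integral>x. I x * (U z * k (z - x)) \<partial>lborel) \<partial>lborel) = (\<integral>x. (\<integral>z. I x * (U z * k (z - x)) \<partial>lborel) \<partial>lborel)"
    by (rule lborel_pair.Fubini_integral)
  moreover have "(\<integral>z. I x * (U z * k (z - x)) \<partial>lborel) = I x * avg U t x" for x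
    unfolding avg_eq_convolution[OF assms(1) t] k_def by simp
  moreover have "(\<integral>x. I x * (U z * k (z - x)) \<partial>lborel) = U z * avg I t z" for z
  proof -
    have "(\<integral>x. I x * (U z * k (z - x)) \<partial>lborel) = (\<integral>x. U z * (I x * k (x - z)) \<partial>lborel)" by (simp add: ks[of z] ac_simps)
    then show ?thesis unfolding avg_eq_convolution[OF assms(2) t] k_def by simp
  qed
  ultimately show ?thesis by (simp only:)
qed

context weak_half_space
begin

text \<open>For balls inside the half-space \<open>scaled_Theta\<close> is an admissible test
  function, so the equation evaluates the derivative of the average.\<close>

lemma U_deriv:
  assumes t: "0 < t" "t < x \<bullet> b"
  shows "((\<lambda>t. avg U t x) has_real_derivative - (t * avgT F t x)) (at t)"
proof -
  note sm = scaled_Theta_smooth[OF t(1), of x]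
  have sub: "cball x t \<subseteq> {y. 0 < y \<bullet> b}"
  proof
    fix y assume "y \<in> cball x t"
    then have "norm (y - x) \<le> t" by (simp add: dist_norm norm_minus_commute)
    then show "y \<in> {y. 0 < y \<bullet> b}" using Basis_le_norm[OF b, of "y - x"] t by (simp add: inner_diff_left)
  qed
  have "(\<integral>z. U z * lap (scaled_Theta t x) z \<partial>lborel) = - (\<integral>z. G z \<bullet> grad (scaled_Theta t x) z \<partial>lborel)"
    by (rule weak_lap[OF sm compact_cball scaled_Theta_outside[OF t(1)]])
  also have "(\<integral>z. G z \<bullet> grad (scaled_Theta t x) z \<partial>lborel) = avgT F t x"
    using weak_eq[OF sm compact_cball sub scaled_Theta_outside[OF t(1)]]
    by (simp add: avgT_eq_convolution[OF rhs_measurable[OF U_meas] t(1)])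
  finally show ?thesis using DERIV_avg[OF U_meas U_abs t(1), of x] by simp
qed

text \<open>For balls that cross the boundary only the subsolution inequality is available; up to a
  multiple of t^2 the average is still nondecreasing in t.\<close>

lemma U_deriv_lower:
  assumes t: "0 < t"
  shows "\<exists>D. ((\<lambda>t. avg U t x) has_real_derivative D) (at t) \<and> - (M powr p * Theta_mass TYPE('a)) * t \<le> D"
proof -
  have "- (M powr p) * (\<integral>z. scaled_Theta t x z \<partial>lborel) \<le> (\<integral>z. U z * lap (scaled_Theta t x) z \<partial>lborel)"
    by (rule subsolution[OF scaled_Theta_smooth[OF t] compact_cball scaled_Theta_outside[OF t] scaled_Theta_nonneg[OF t]])
  moreover have "(\<integral>z. scaled_Theta t x z \<partial>lborel) = Theta_mass TYPE('a)"
    using avgT_eq_convolution[of "\<lambda>_. 1" t x] t by (simp add: avgT_const)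
  ultimately have "t * (- (M powr p) * Theta_mass TYPE('a)) \<le> t * (\<integral>z. U z * lap (scaled_Theta t x) z \<partial>lborel)"
    using t by (intro mult_left_mono) auto
  then show ?thesis using DERIV_avg[OF U_meas U_abs t, of x] by (auto simp: ac_simps)
qed

section \<open>Pointwise limits of averages in the interior\<close>

definition avg_modulus :: "real \<Rightarrow> real" where "avg_modulus h = rhs_bound (h / 2) * Theta_mass TYPE('a)"

lemma avg_modulus_nonneg: "h > 0 \<Longrightarrow> 0 \<le> avg_modulus h"
proof -
  assume "h > 0"
  then have "\<bar>F (h *\<^sub>R b)\<bar> \<le> rhs_bound (h / 2)" using b by (intro F_bound) auto
  then have "0 \<le> rhs_bound (h / 2)" by linarith
  then show ?thesis unfolding avg_modulus_def using Theta_mass_pos[where 'a='a] by simp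
qed

text \<open>Radii below h/2 keep the ball above height h/2, where the right-hand side is bounded;
  the mean value inequality in t does the rest.\<close>

lemma avg_U_close:
  assumes h: "0 < h" "h \<le> x \<bullet> b" and t: "0 < r" "r \<le> t" "t < h / 2"
  shows "\<bar>avg U t x - avg U r x\<bar> \<le> avg_modulus h * t\<^sup>2"
proof -
  have "norm (avg U t x - avg U r x) \<le> (t * avg_modulus h) * norm (t - r)"
  proof (rule field_differentiable_bound[of "{r..t}"])
    fix y assume y: "y \<in> {r..t}"
    then have y': "0 < y" "y < x \<bullet> b" using t h by auto
    show "((\<lambda>t. avg U t x) has_field_derivative - (y * avgT F y x)) (at y within {r..t})"
      by (rule has_field_derivative_at_within[OF U_deriv[OF y']])
    have bd: "\<bar>F z\<bar> \<le> rhs_bound (h / 2)" if "z \<in> ball x y" for z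
      using inner_ball[OF that] h t y by (intro F_bound) auto
    have "avgT F y x \<le> rhs_bound (h / 2) * Theta_mass TYPE('a)" "- rhs_bound (h / 2) * Theta_mass TYPE('a) \<le> avgT F y x"
      using bd y' by (intro avgT_le[where C="rhs_bound (h/2)"] avgT_ge[where C="rhs_bound (h/2)"] rhs_measurable U_meas; force simp: abs_le_iff)+
    then have "\<bar>avgT F y x\<bar> \<le> avg_modulus h" by (simp add: avg_modulus_def abs_le_iff)
    then have "y * \<bar>avgT F y x\<bar> \<le> t * avg_modulus h" using y y' avg_modulus_nonneg[OF h(1)] by (intro mult_mono) auto
    then show "norm (- (y * avgT F y x)) \<le> t * avg_modulus h" using y' by (simp add: abs_mult)
  qed (use t in auto)
  also have "\<dots> \<le> (t * avg_modulus h) * t" using t avg_modulus_nonneg[OF h(1)] by (intro mult_left_mono) auto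
  finally show ?thesis by (simp add: power2_eq_square ac_simps)
qed

definition scale :: "nat \<Rightarrow> real" where "scale n = 1 / real (Suc n)"

lemma scale: "scale n > 0" "scale \<longlonglongrightarrow> 0"
  unfolding scale_def[abs_def] using LIMSEQ_inverse_real_of_nat by (auto simp: inverse_eq_divide)

text \<open>Set to 0 on the boundary and below, so that continuity at the boundary becomes a
  statement about decay from above.\<close>

definition u_rep :: "'a \<Rightarrow> real" where
  "u_rep x = (if x \<bullet> b > 0 then lim (\<lambda>n. avg U (scale n) x) else 0)"

lemma u_rep_lim:
  assumes "x \<bullet> b > 0"
  shows "(\<lambda>n. avg U (scale n) x) \<longlonglongrightarrow> u_rep x"
proof -
  define h where "h = x \<bullet> b"
  have h: "h > 0" using assms by (simp add: h_def)
  have "Cauchy (\<lambda>n. avg U (scale n) x)"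
  proof (rule metric_CauchyI)
    fix e :: real assume e: "e > 0"
    have "(\<lambda>n. avg_modulus h * (scale n)\<^sup>2) \<longlonglongrightarrow> avg_modulus h * 0\<^sup>2" by (intro tendsto_intros scale)
    then have "\<forall>\<^sub>F n in sequentially. avg_modulus h * (scale n)\<^sup>2 < e" using e by (auto intro: order_tendstoD)
    moreover have "\<forall>\<^sub>F n in sequentially. scale n < h / 2" using order_tendstoD(2)[OF scale(2), of "h / 2"] h by simp
    ultimately obtain N where N: "\<And>n. n \<ge> N \<Longrightarrow> avg_modulus h * (scale n)\<^sup>2 < e \<and> scale n < h / 2"
      using eventually_conj unfolding eventually_sequentially by (metis le_trans nle_le)
    have "dist (avg U (scale m) x) (avg U (scale n) x) < e" if "m \<ge> N" "n \<ge> N" for m n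
    proof (cases "scale m \<le> scale n")
      case True
      then show ?thesis using avg_U_close[OF h _ scale(1)[of m] True, of x] N[OF that(2)] by (simp add: h_def dist_real_def abs_minus_commute)
    next
      case False
      then show ?thesis using avg_U_close[OF h _ scale(1)[of n], of x "scale m"] N[OF that(1)] by (simp add: h_def dist_real_def)
    qed
    then show "\<exists>N. \<forall>m\<ge>N. \<forall>n\<ge>N. dist (avg U (scale m) x) (avg U (scale n) x) < e" by blast
  qed
  then show ?thesis using assms by (simp add: u_rep_def Cauchy_convergent_iff convergent_LIMSEQ_iff)
qed

lemma u_rep_bounds: "0 \<le> u_rep x" "u_rep x \<le> M"
proof -
  show "0 \<le> u_rep x"
  proof (cases "x \<bullet> b > 0")
    case True
    show ?thesis by (rule LIMSEQ_le_const[OF u_rep_lim[OF True]]) (use avg_bounded(1)[OF U_meas u_nonneg u_le] in auto)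
  qed (simp add: u_rep_def)
  show "u_rep x \<le> M"
  proof (cases "x \<bullet> b > 0")
    case True
    show ?thesis by (rule LIMSEQ_le_const2[OF u_rep_lim[OF True]]) (use avg_bounded(2)[OF U_meas u_nonneg u_le] in auto)
  qed (use M in \<open>simp add: u_rep_def\<close>)
qed

lemma u_rep_close:
  assumes h: "0 < h" "h \<le> x \<bullet> b" and t: "0 < t" "t < h / 2"
  shows "\<bar>u_rep x - avg U t x\<bar> \<le> avg_modulus h * t\<^sup>2"
proof (rule LIMSEQ_le_const2)
  have "x \<bullet> b > 0" using h by simp
  then show "(\<lambda>n. \<bar>avg U (scale n) x - avg U t x\<bar>) \<longlonglongrightarrow> \<bar>u_rep x - avg U t x\<bar>" by (intro tendsto_intros u_rep_lim)
  have "\<forall>\<^sub>F n in sequentially. scale n < t" using scale(2) t by (auto intro: order_tendstoD)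
  then have "\<forall>\<^sub>F n in sequentially. \<bar>avg U (scale n) x - avg U t x\<bar> \<le> avg_modulus h * t\<^sup>2"
    by eventually_elim (use avg_U_close[OF h scale(1) _ t(2)] in \<open>auto simp: abs_minus_commute less_imp_le\<close>)
  then show "\<exists>N. \<forall>n\<ge>N. \<bar>avg U (scale n) x - avg U t x\<bar> \<le> avg_modulus h * t\<^sup>2" by (simp add: eventually_sequentially)
qed

lemma avg_U_uc: "t > 0 \<Longrightarrow> uniformly_continuous_on UNIV (avg U t)"
  by (rule avg_bounded_uniformly_continuous[OF U_meas U_abs])

lemma avg_U_meas [measurable]: "avg U (scale n) \<in> borel_measurable borel"
  by (intro borel_measurable_continuous_onI uniformly_continuous_imp_continuous avg_U_uc scale)

lemma u_rep_meas [measurable]: "u_rep \<in> borel_measurable borel"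
proof (rule borel_measurable_LIMSEQ_real[where u="\<lambda>n x. indicator upper x * avg U (scale n) x"])
  show "(\<lambda>n. indicator upper x * avg U (scale n) x) \<longlonglongrightarrow> u_rep x" for x
    using u_rep_lim[of x] by (cases "x \<bullet> b > 0") (auto simp: u_rep_def)
qed measurable

text \<open>By duality the average is moved onto the indicator of the box, whose averages are
  eventually constant at every point off the frontier.\<close>

lemma box_integral_eq:
  assumes sub: "cbox a c \<subseteq> upper"
  shows "(\<integral>x. indicator (cbox a c) x * u_rep x \<partial>lborel) = (\<integral>x. indicator (cbox a c) x * U x \<partial>lborel)"
proof -
  define I where "I = (indicator (cbox a c) :: 'a \<Rightarrow> real)"
  have [measurable]: "I \<in> borel_measurable borel" unfolding I_def by measurable
  obtain r where r: "r > 0" "cbox a c \<subseteq> cball 0 r"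
  proof -
    obtain r where "r > 0" "\<And>x. x \<in> cbox a c \<Longrightarrow> norm x \<le> r" using bounded_cbox[of a c] unfolding bounded_pos by blast
    then show ?thesis using that by (auto simp: subset_iff)
  qed
  have I01: "0 \<le> I x" "I x \<le> 1" for x by (auto simp: I_def)
  have Iout: "I x = 0" if "x \<notin> cball 0 r" for x using that r(2) by (auto simp: I_def indicator_def)
  have intI: "integrable lborel I" unfolding I_def
    by (intro integrable_real_indicator) (auto simp: emeasure_compact_finite[unfolded infinity_ennreal_def])
  have 1: "(\<lambda>n. \<integral>x. I x * avg U (scale n) x \<partial>lborel) \<longlonglongrightarrow> (\<integral>x. I x * u_rep x \<partial>lborel)"
  proof (rule integral_dominated_convergence[where w="\<lambda>x. M * I x"])
    show "integrable lborel (\<lambda>x. M * I x)" by (intro integrable_mult_right intI)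
    show "AE x in lborel. (\<lambda>n. I x * avg U (scale n) x) \<longlonglongrightarrow> I x * u_rep x"
    proof (rule AE_I2)
      fix x show "(\<lambda>n. I x * avg U (scale n) x) \<longlonglongrightarrow> I x * u_rep x"
      proof (cases "x \<in> cbox a c")
        case True
        then show ?thesis using sub by (intro tendsto_mult_left u_rep_lim) auto
      qed (simp add: I_def)
    qed
    show "AE x in lborel. norm (I x * avg U (scale n) x) \<le> M * I x" for n
      unfolding mult.commute[of M] using avg_bounded[OF U_meas u_nonneg u_le, of "scale n"] I01
      by (intro AE_I2) (auto simp: abs_mult intro!: mult_left_mono)
  qed measurable
  have avgI: "0 \<le> avg I t z" "avg I t z \<le> 1" for t z using avg_bounded[of I 1 t z] I01 by simp_all
  have 2: "(\<lambda>n. \<integral>z. U z * avg I (scale n) z \<partial>lborel) \<longlonglongrightarrow> (\<integral>z. U z * I z \<partial>lborel)"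
  proof (rule integral_dominated_convergence[where w="\<lambda>z. M * indicator (cball 0 (r + 1)) z"])
    show "integrable lborel (\<lambda>z::'a. M * indicator (cball 0 (r + 1)) z)"
      by (intro integrable_mult_right integrable_real_indicator) (auto simp: emeasure_lborel_cball_finite[unfolded infinity_ennreal_def])
    have [measurable]: "avg I (scale n) \<in> borel_measurable borel" for n
      by (rule borel_measurable_continuous_onI, rule uniformly_continuous_imp_continuous,
          rule avg_bounded_uniformly_continuous[where M=1]) (auto simp: I01 scale)
    show "(\<lambda>z. U z * avg I (scale n) z) \<in> borel_measurable lborel" for n by measurable
    \<comment> \<open>The frontier is null; elsewhere the indicator is locally constant, so small
      averages reproduce it exactly.\<close>
    have "cbox a c - box a c \<in> null_sets lebesgue"
      using negligible_frontier_interval[of a c] by (simp add: negligible_iff_null_sets)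
    then have "AE z in lebesgue. z \<notin> cbox a c - box a c" by (rule AE_not_in)
    then have "AE z in lborel. z \<notin> cbox a c - box a c" by (simp add: AE_completion_iff)
    then show "AE z in lborel. (\<lambda>n. U z * avg I (scale n) z) \<longlonglongrightarrow> U z * I z"
    proof (rule eventually_mono)
      fix z assume z: "z \<notin> cbox a c - box a c"
      have "\<exists>d>0. \<forall>y\<in>ball z d. I y = I z"
      proof (cases "z \<in> cbox a c")
        case True
        then have "z \<in> box a c" using z by blast
        then obtain d where "d > 0" "ball z d \<subseteq> box a c" using open_box open_contains_ball by metis
        then show ?thesis using True box_subset_cbox[of a c] by (intro exI[of _ d]) (auto simp: I_def indicator_def)
      next
        case False
        then have "z \<in> - cbox a c" "open (- cbox a c)" by (auto simp: open_Compl closed_cbox)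
        then obtain d where "d > 0" "ball z d \<subseteq> - cbox a c" using open_contains_ball by metis
        then show ?thesis using False by (intro exI[of _ d]) (auto simp: I_def indicator_def)
      qed
      then obtain d where d: "d > 0" "\<And>y. y \<in> ball z d \<Longrightarrow> I y = I z" by blast
      have "avg I t z = I z" if t: "0 < t" "t < d" for t
      proof -
        have "I (z + t *\<^sub>R y) * rho y = I z * rho y" for y
        proof (cases "norm y < 1")
          case True
          have "t * norm y < d" using True t by (smt (verit) mult_less_cancel_left2)
          then have "z + t *\<^sub>R y \<in> ball z d" using t by (simp add: dist_norm)
          then show ?thesis using d(2) by simp
        qed (simp add: rho_outside)
        then show ?thesis by (simp only: avg_def integral_mult_right_zero integral_rho mult_1_right)
      qed
      moreover have "\<forall>\<^sub>F n in sequentially. scale n < d" using scale(2) d(1) by (auto intro: order_tendstoD)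
      ultimately have "\<forall>\<^sub>F n in sequentially. avg I (scale n) z = I z" using scale(1) by (auto elim!: eventually_mono)
      then show "(\<lambda>n. U z * avg I (scale n) z) \<longlonglongrightarrow> U z * I z" by (intro tendsto_mult_left tendsto_eventually)
    qed
    show "AE z in lborel. norm (U z * avg I (scale n) z) \<le> M * indicator (cball 0 (r + 1)) z" for n
    proof (rule AE_I2)
      fix z
      show "norm (U z * avg I (scale n) z) \<le> M * indicator (cball 0 (r + 1)) z"
      proof (cases "z \<in> cball 0 (r + 1)")
        case True
        have "\<bar>U z\<bar> * \<bar>avg I (scale n) z\<bar> \<le> M * 1" using U_abs[of z] avgI[of "scale n" z] M by (intro mult_mono) auto
        then show ?thesis using True by (simp add: abs_mult)
      next
        case False
        have "I (z + scale n *\<^sub>R y) * rho y = 0" for y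
        proof (cases "norm y < 1")
          case True
          have "scale n \<le> 1" by (simp add: scale_def)
          then have "norm (scale n *\<^sub>R y) \<le> 1" using True scale(1)[of n] by (simp add: mult_le_one)
          moreover have "norm z \<le> norm (z + scale n *\<^sub>R y) + norm (scale n *\<^sub>R y)" using norm_triangle_ineq4[of "z + scale n *\<^sub>R y" "scale n *\<^sub>R y"] by simp
          ultimately have "z + scale n *\<^sub>R y \<notin> cball 0 r" using False by auto
          then show ?thesis using Iout by simp
        qed (simp add: rho_outside)
        then have "avg I (scale n) z = 0" by (simp only: avg_def integral_zero)
        then show ?thesis using False by simp
      qed
    qed
  qed measurable
  have "(\<integral>x. I x * avg U (scale n) x \<partial>lborel) = (\<integral>z. U z * avg I (scale n) z \<partial>lborel)" for n
    by (rule avg_duality[OF _ _ U_abs _ Iout scale(1)]) (auto simp: I01)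
  then have "(\<integral>x. I x * u_rep x \<partial>lborel) = (\<integral>z. U z * I z \<partial>lborel)" using LIMSEQ_unique[OF 1] 2 by simp
  then show ?thesis by (simp add: I_def mult.commute)
qed

text \<open>Equal integrals over boxes inside the half-space give equality almost everywhere, by
  differentiation along the cubes with lower corner x; these extend upwards and so remain in the
  half-space. Below the boundary both functions are 0.\<close>

lemma u_rep_AE: "AE x in lborel. u_rep x = U x"
proof -
  define D where "D x = u_rep x - U x" for x
  have Dm [measurable]: "D \<in> borel_measurable borel" unfolding D_def by measurable
  have Db: "\<bar>D x\<bar> \<le> M" for x unfolding D_def using u_rep_bounds[of x] u_nonneg[of x] u_le[of x] by linarith
  have iB: "integrable lborel (indicator (cbox a c) :: 'a \<Rightarrow> real)" for a c
    by (intro integrable_real_indicator) (auto simp: emeasure_compact_finite[unfolded infinity_ennreal_def])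
  have set_int: "set_integrable lborel (cbox a c) D" for a c
  proof -
    have "integrable lborel (\<lambda>x. D x * indicator (cbox a c) x)" by (rule integrable_bounded_times[OF Dm Db iB])
    then show ?thesis by (simp add: set_integrable_def mult.commute)
  qed
  have int_on: "D integrable_on cbox a c" for a c
    using set_borel_integral_eq_integral(1)[OF set_int] .
  obtain N where N: "negligible N"
       "\<And>x e. x \<notin> N \<Longrightarrow> 0 < e \<Longrightarrow> \<exists>d>0. \<forall>h. 0 < h \<and> h < d \<longrightarrow> norm (integral (cbox x (x + h *\<^sub>R One)) D /\<^sub>R h ^ DIM('a) - D x) < e"
    using integrable_ccontinuous_explicit[OF int_on] by blast
  have "D x = 0" if x: "x \<notin> N" "x \<bullet> b > 0" for x
  proof (rule ccontr)
    assume "D x \<noteq> 0"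
    then obtain d where d: "d > 0" "\<And>h. 0 < h \<Longrightarrow> h < d \<Longrightarrow> norm (integral (cbox x (x + h *\<^sub>R One)) D /\<^sub>R h ^ DIM('a) - D x) < \<bar>D x\<bar>"
      using N(2)[OF x(1), of "\<bar>D x\<bar>"] by auto
    define B where "B = cbox x (x + (d / 2) *\<^sub>R One)"
    have sub: "B \<subseteq> upper" using x(2) b by (auto simp: B_def mem_box intro: less_le_trans)
    have "integral B D = (\<integral>x. indicator B x * D x \<partial>lborel)"
      using set_borel_integral_eq_integral(2)[OF set_int, of x "x + (d / 2) *\<^sub>R One"] by (simp add: B_def set_lebesgue_integral_def)
    also have "\<dots> = (\<integral>x. indicator B x * u_rep x - indicator B x * U x \<partial>lborel)" by (simp add: D_def right_diff_distrib)
    also have "\<dots> = (\<integral>x. indicator B x * u_rep x \<partial>lborel) - (\<integral>x. indicator B x * U x \<partial>lborel)"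
    proof (rule Bochner_Integration.integral_diff)
      show "integrable lborel (\<lambda>x. indicator B x * u_rep x)"
        using integrable_bounded_times[OF u_rep_meas _ iB, of M] u_rep_bounds by (simp add: B_def mult.commute)
      show "integrable lborel (\<lambda>x. indicator B x * U x)"
        using integrable_bounded_times[OF U_meas U_abs iB] by (simp add: B_def mult.commute)
    qed
    also have "\<dots> = 0" using box_integral_eq[of x "x + (d / 2) *\<^sub>R One"] sub by (simp add: B_def)
    finally have "integral B D = 0" .
    then show False using d(2)[of "d / 2"] d(1) by (simp add: B_def)
  qed
  then have zero: "u_rep x = U x" if "x \<notin> N" for x
    using that U_outside[of x] by (cases "x \<bullet> b > 0") (auto simp: D_def u_rep_def)
  have "N \<in> null_sets lebesgue" using N(1) by (simp add: negligible_iff_null_sets)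
  then have "AE x in lebesgue. u_rep x = U x" using zero by (intro AE_I'[of N]) auto
  then show ?thesis by (simp add: AE_completion_iff)
qed

lemma avg_U_eq: "t > 0 \<Longrightarrow> avg U t x = avg u_rep t x"
  unfolding avg_eq_convolution[OF U_meas] avg_eq_convolution[OF u_rep_meas]
  using u_rep_AE by (intro integral_cong_AE) (measurable, auto elim!: eventually_mono)

lemma avgT_rhs_eq:
  assumes t: "t > 0"
  shows "avgT F t x = avgT (rhs p l q s P u_rep) t x"
proof -
  have [measurable]: "scaled_Theta t x \<in> borel_measurable borel" by (rule smooth_class_measurable[OF scaled_Theta_smooth[OF t]])
  show ?thesis
    unfolding avgT_eq_convolution[OF rhs_measurable[OF U_meas] t] avgT_eq_convolution[OF rhs_measurable[OF u_rep_meas] t]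
    using u_rep_AE by (intro integral_cong_AE) (measurable, auto elim!: eventually_mono simp: rhs_def)
qed

section \<open>Decay at the boundary and uniform continuity\<close>

lemma u_rep_submean:
  assumes x: "x \<bullet> b > 0" and t: "t > 0"
  shows "u_rep x \<le> avg U t x + M powr p * Theta_mass TYPE('a) * t\<^sup>2 / 2"
proof (rule LIMSEQ_le_const2)
  define C where "C = M powr p * Theta_mass TYPE('a)"
  define f where "f t = avg U t x + C * t\<^sup>2 / 2" for t
  have mono: "f r \<le> f t" if r: "0 < r" "r \<le> t" for r
  proof (rule DERIV_nonneg_imp_nondecreasing[OF r(2)])
    fix y assume "r \<le> y" "y \<le> t"
    then have y: "y > 0" using r by simp
    obtain D where D: "((\<lambda>t. avg U t x) has_real_derivative D) (at y)" "- C * y \<le> D"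
      using U_deriv_lower[OF y, of x] by (auto simp: C_def)
    have "(f has_real_derivative D + C * y) (at y)" unfolding f_def[abs_def]
      by (auto intro!: derivative_eq_intros D)
    then show "\<exists>D. (f has_real_derivative D) (at y) \<and> 0 \<le> D" using D(2) by force
  qed
  have "(\<lambda>n. avg U (scale n) x + C * (scale n)\<^sup>2 / 2) \<longlonglongrightarrow> u_rep x + C * 0\<^sup>2 / 2"
    by (intro tendsto_intros u_rep_lim x scale) auto
  then show "(\<lambda>n. f (scale n)) \<longlonglongrightarrow> u_rep x" by (simp add: f_def)
  have "\<forall>\<^sub>F n in sequentially. scale n < t" using scale(2) t by (auto intro: order_tendstoD)
  then have "\<forall>\<^sub>F n in sequentially. f (scale n) \<le> avg U t x + M powr p * Theta_mass TYPE('a) * t\<^sup>2 / 2"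
    by eventually_elim (use mono[OF scale(1)] in \<open>auto simp: f_def C_def less_imp_le\<close>)
  then show "\<exists>N. \<forall>n\<ge>N. f (scale n) \<le> avg U t x + M powr p * Theta_mass TYPE('a) * t\<^sup>2 / 2" by (simp add: eventually_sequentially)
qed

text \<open>Let m(d) be the supremum up to height d. The average of radius 4 d around a point of
  height at most d sees only heights up to 5 d, and a fixed fraction k of its mass falls below the
  boundary, where u vanishes. The submean inequality gives m(d) \<le> (1 - k) m(5 d) + C d^2, so the
  limit at d = 0 must vanish.\<close>

lemma u_rep_small_near_boundary:
  assumes "e > 0"
  shows "\<exists>d>0. \<forall>x. x \<bullet> b < d \<longrightarrow> u_rep x < e"
proof -
  define S where "S d = {x. 0 < x \<bullet> b \<and> x \<bullet> b \<le> d}" for d :: real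
  define m where "m d = (SUP x\<in>S d. u_rep x)" for d
  have ne: "S d \<noteq> {}" if "d > 0" for d
  proof -
    have "d *\<^sub>R b \<in> S d" using b that by (simp add: S_def)
    then show ?thesis by blast
  qed
  have bdd: "bdd_above (u_rep ` S d)" for d using u_rep_bounds by (intro bdd_aboveI2)
  have u_rep_m: "u_rep x \<le> m d" if "x \<in> S d" for x d unfolding m_def by (rule cSUP_upper[OF that bdd])
  have m_nn: "0 \<le> m d" if "d > 0" for d
    using u_rep_m[of "d *\<^sub>R b" d] u_rep_bounds(1)[of "d *\<^sub>R b"] b that by (simp add: S_def)
  \<comment> \<open>For y in this set and x of height at most d, the point x + 4 d y has height at
    most 0.\<close>
  define A where "A = {y. y \<bullet> b \<le> - 1/4}"
  have Am [measurable]: "A \<in> sets borel" unfolding A_def by (intro borel_closed closed_Collect_le continuous_intros)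
  define k where "k = (\<integral>y. indicator A y * rho y \<partial>lborel)"
  have ik: "integrable lborel (\<lambda>y. indicator A y * rho y)"
    by (rule integrable_bounded_times[OF _ _ integrable_rho, where M=1]) (auto simp: indicator_def)
  have k: "k > 0"
  proof -
    obtain c where c: "c > 0" "\<And>y::'a. norm y \<le> 3/4 \<Longrightarrow> c \<le> rho y" using rho_lower_ex by blast
    let ?B = "ball ((- 1/2) *\<^sub>R b) (1/4)"
    have sub: "norm y \<le> 3/4 \<and> y \<in> A" if "y \<in> ?B" for y
    proof -
      have d: "norm (y - (- 1/2) *\<^sub>R b) < 1/4" using that by (simp add: dist_norm norm_minus_commute)
      have "norm y \<le> norm (y - (- 1/2) *\<^sub>R b) + norm ((- 1/2) *\<^sub>R b)" by (metis diff_add_cancel norm_triangle_ineq)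
      moreover have "norm ((- 1/2) *\<^sub>R b) = 1/2" using b by simp
      moreover have "\<bar>(y - (- 1/2) *\<^sub>R b) \<bullet> b\<bar> \<le> norm (y - (- 1/2) *\<^sub>R b)" using b Basis_le_norm by blast
      moreover have "(y - (- 1/2) *\<^sub>R b) \<bullet> b = y \<bullet> b + 1/2" using b by (simp add: inner_diff_left inner_add_left)
      ultimately show ?thesis using d unfolding A_def by (auto simp: abs_le_iff)
    qed
    have "0 < c * measure lborel ?B" using c by (simp add: content_ball_pos)
    also have "\<dots> = (\<integral>y. c * indicator ?B y \<partial>lborel)" by simp
    also have "\<dots> \<le> k" unfolding k_def
    proof (intro integral_mono ik integrable_mult_right integrable_real_indicator)
      fix y show "c * indicator ?B y \<le> indicator A y * rho y"
      proof (cases "y \<in> ?B")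
        case True
        then show ?thesis using sub[OF True] c(2)[of y] by simp
      qed (simp add: rho_nonneg)
    qed (auto simp: emeasure_lborel_ball_finite[unfolded infinity_ennreal_def])
    finally show ?thesis .
  qed
  \<comment> \<open>The 8 is half of the square of the radius factor 4.\<close>
  define C where "C = 8 * (M powr p * Theta_mass TYPE('a))"
  have C: "C \<ge> 0" using Theta_mass_pos[where 'a='a] by (simp add: C_def)
  have rec: "m d \<le> (1 - k) * m (5 * d) + C * d\<^sup>2" if d: "d > 0" for d
    unfolding m_def[of d]
  proof (rule cSUP_least[OF ne[OF d]])
    fix x assume x: "x \<in> S d"
    then have xb: "0 < x \<bullet> b" "x \<bullet> b \<le> d" by (auto simp: S_def)
    have "u_rep x \<le> avg U (4 * d) x + M powr p * Theta_mass TYPE('a) * (4 * d)\<^sup>2 / 2"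
      using d by (intro u_rep_submean xb) simp
    also have "avg U (4 * d) x = avg u_rep (4 * d) x" using d by (intro avg_U_eq) simp
    also have "avg u_rep (4 * d) x \<le> (\<integral>y. m (5 * d) * rho y - m (5 * d) * (indicator A y * rho y) \<partial>lborel)"
      unfolding avg_def
    proof (rule integral_mono)
      have "(\<lambda>y. u_rep (x + (4 * d) *\<^sub>R y)) \<in> borel_measurable borel" by measurable
      then show "integrable lborel (\<lambda>y. u_rep (x + (4 * d) *\<^sub>R y) * rho y)"
        by (rule integrable_bounded_times[OF _ _ integrable_rho, where M=M]) (use u_rep_bounds in auto)
      show "integrable lborel (\<lambda>y. m (5 * d) * rho y - m (5 * d) * (indicator A y * rho y))"
        by (intro Bochner_Integration.integrable_diff integrable_mult_right integrable_rho ik)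
      fix y
      show "u_rep (x + (4 * d) *\<^sub>R y) * rho y \<le> m (5 * d) * rho y - m (5 * d) * (indicator A y * rho y)"
      proof (cases "norm y < 1")
        case True
        have hb: "(x + (4 * d) *\<^sub>R y) \<bullet> b = x \<bullet> b + 4 * d * (y \<bullet> b)" by (simp add: inner_add_left)
        have "u_rep (x + (4 * d) *\<^sub>R y) \<le> m (5 * d) * (1 - indicator A y)"
        proof (cases "y \<in> A")
          case True
          then have "4 * d * (y \<bullet> b) \<le> 4 * d * (- 1/4)" unfolding A_def using d by (intro mult_left_mono) auto
          then have "(x + (4 * d) *\<^sub>R y) \<bullet> b \<le> 0" using xb unfolding hb by linarith
          then show ?thesis using True by (simp add: u_rep_def)
        next
          case False
          have "y \<bullet> b \<le> 1" using Basis_le_norm[OF b, of y] \<open>norm y < 1\<close> by linarith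
          then have "4 * d * (y \<bullet> b) \<le> 4 * d * 1" using d by (intro mult_left_mono) auto
          then have "(x + (4 * d) *\<^sub>R y) \<bullet> b \<le> 5 * d" using xb unfolding hb by linarith
          then have "u_rep (x + (4 * d) *\<^sub>R y) \<le> m (5 * d)"
            using u_rep_m[of "x + (4 * d) *\<^sub>R y" "5 * d"] m_nn[of "5 * d"] d
            by (cases "0 < (x + (4 * d) *\<^sub>R y) \<bullet> b") (auto simp: S_def u_rep_def)
          then show ?thesis using False by simp
        qed
        from mult_right_mono[OF this rho_nonneg[of y]] show ?thesis by (simp add: algebra_simps)
      qed (simp add: rho_outside)
    qed
    also have "\<dots> = (1 - k) * m (5 * d)"
      unfolding Bochner_Integration.integral_diff[OF integrable_mult_right[OF integrable_rho] integrable_mult_right[OF ik]]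
        integral_mult_right_zero integral_rho k_def[symmetric] by (simp add: algebra_simps)
    finally show "u_rep x \<le> (1 - k) * m (5 * d) + C * d\<^sup>2"
      by (simp add: C_def power_mult_distrib ac_simps)
  qed
  \<comment> \<open>\<open>m\<close> is monotone, so its infimum is its limit at 0; passing to the
    limit in the recursion gives k m0 \<le> 0.\<close>
  define m0 where "m0 = (INF d\<in>{0<..}. m d)"
  have bdb: "bdd_below (m ` {0<..})" using m_nn by (intro bdd_belowI2[where m=0]) auto
  have m0_le: "m0 \<le> m d" if "d > 0" for d unfolding m0_def using that by (intro cINF_lower bdb) simp
  have m_mono: "m d \<le> m d'" if "0 < d" "d \<le> d'" for d d'
    unfolding m_def using that by (intro cSUP_subset_mono ne bdd) (auto simp: S_def)
  have m0_nn: "0 \<le> m0" unfolding m0_def by (intro cINF_greatest) (auto simp: m_nn)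
  have "m0 \<le> (1 - k) * m0"
  proof (rule le_of_le_add_eps[where Z="\<bar>1 - k\<bar> + C"])
    fix e :: real assume e: "e > 0"
    have "(INF d\<in>{0<..}. m d) < m0 + e" using e by (simp add: m0_def)
    then obtain d1 where d1: "d1 > 0" "m d1 < m0 + e" using cINF_less_iff[OF _ bdb] by fastforce
    define d where "d = min (d1 / 5) (min 1 e)"
    have d: "0 < d" "5 * d \<le> d1" "d \<le> 1" "d \<le> e" using d1(1) e by (auto simp: d_def min_def)
    have "m (5 * d) < m0 + e" using m_mono[of "5 * d" d1] d d1(2) by simp
    then have "\<bar>m (5 * d) - m0\<bar> \<le> e" using m0_le[of "5 * d"] d by simp
    then have "\<bar>1 - k\<bar> * \<bar>m (5 * d) - m0\<bar> \<le> \<bar>1 - k\<bar> * e" by (intro mult_left_mono) auto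
    then have 1: "(1 - k) * (m (5 * d) - m0) \<le> \<bar>1 - k\<bar> * e" by (metis abs_le_D1 abs_mult)
    have "d * d \<le> 1 * e" using d by (intro mult_mono) auto
    then have 2: "C * d\<^sup>2 \<le> C * e" using C by (intro mult_left_mono) (auto simp: power2_eq_square)
    have "m0 \<le> (1 - k) * m (5 * d) + C * d\<^sup>2" using rec[OF d(1)] m0_le[OF d(1)] by linarith
    also have "(1 - k) * m (5 * d) = (1 - k) * m0 + (1 - k) * (m (5 * d) - m0)" by (simp add: algebra_simps)
    finally show "m0 \<le> (1 - k) * m0 + e * (\<bar>1 - k\<bar> + C)" using 1 2 by (simp add: algebra_simps)
  qed
  then have "k * m0 \<le> 0" by (simp add: algebra_simps)
  then have "m0 \<le> 0" using k by (simp add: mult_le_0_iff)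
  then have "(INF d\<in>{0<..}. m d) < e" using assms by (simp add: m0_def[symmetric])
  then obtain d where d: "d > 0" "m d < e" using cINF_less_iff[OF _ bdb] by fastforce
  have "u_rep x < e" if "x \<bullet> b < d" for x
    using u_rep_m[of x d] that d assms by (cases "0 < x \<bullet> b") (auto simp: S_def u_rep_def)
  then show ?thesis using d(1) by blast
qed

text \<open>If both points have height at least d, the function is uniformly close to an average,
  which is uniformly continuous; otherwise both points lie below height 2 d, where the values
  themselves are below e.\<close>

lemma u_rep_uc: "uniformly_continuous_on UNIV u_rep"
  unfolding uniformly_continuous_on_def
proof (intro allI impI)
  fix e :: real assume e: "e > 0"
  obtain d0 where d0: "d0 > 0" "\<And>x. x \<bullet> b < d0 \<Longrightarrow> u_rep x < e" using u_rep_small_near_boundary[OF e] by blast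
  define d where "d = d0 / 2"
  have d: "d > 0" using d0 by (simp add: d_def)
  \<comment> \<open>Makes the error avg_modulus d * t^2 of the approximation at most e/4 while
    keeping t below d/2.\<close>
  define t where "t = min (d / 4) (sqrt (e / (4 * (avg_modulus d + 1))))"
  have avg_modulus: "avg_modulus d \<ge> 0" by (rule avg_modulus_nonneg[OF d])
  have t: "0 < t" "t < d / 2" using d e avg_modulus by (auto simp: t_def min_def)
  have "t\<^sup>2 \<le> (sqrt (e / (4 * (avg_modulus d + 1))))\<^sup>2" using t by (intro power_mono) (auto simp: t_def)
  also have "\<dots> = e / (4 * (avg_modulus d + 1))" using e avg_modulus by simp
  finally have "avg_modulus d * t\<^sup>2 \<le> avg_modulus d * (e / (4 * (avg_modulus d + 1)))" using avg_modulus by (intro mult_left_mono)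
  also have "\<dots> = e / 4 * (avg_modulus d / (avg_modulus d + 1))" by simp
  also have "\<dots> \<le> e / 4 * 1" using e avg_modulus by (intro mult_left_mono) auto
  finally have avg_modulus_t: "avg_modulus d * t\<^sup>2 \<le> e / 4" by simp
  obtain r where r: "r > 0" "\<And>x x'. dist x' x < r \<Longrightarrow> dist (avg U t x') (avg U t x) < e / 4"
    using avg_U_uc[OF t(1)] e unfolding uniformly_continuous_on_def by (metis UNIV_I zero_less_divide_iff zero_less_numeral)
  have "dist (u_rep x') (u_rep x) < e" if dx: "dist x' x < min r d" for x x'
  proof (cases "d \<le> x \<bullet> b \<and> d \<le> x' \<bullet> b")
    case True
    have "\<bar>u_rep x - avg U t x\<bar> \<le> e / 4" "\<bar>u_rep x' - avg U t x'\<bar> \<le> e / 4"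
      using u_rep_close[OF d _ t, of x] u_rep_close[OF d _ t, of x'] True avg_modulus_t by auto
    moreover have "\<bar>avg U t x' - avg U t x\<bar> < e / 4" using r(2)[of x' x] dx by (simp add: dist_real_def)
    ultimately show ?thesis unfolding dist_real_def using e by linarith
  next
    case False
    have "\<bar>(x' - x) \<bullet> b\<bar> \<le> norm (x' - x)" by (rule Basis_le_norm[OF b])
    then have "\<bar>x' \<bullet> b - x \<bullet> b\<bar> < d" using dx by (simp add: inner_diff_left dist_norm)
    then have "x \<bullet> b < d0" "x' \<bullet> b < d0" using False d0(1) unfolding d_def by linarith+
    then have "u_rep x < e" "u_rep x' < e" using d0(2) by auto
    then show ?thesis using u_rep_bounds(1)[of x] u_rep_bounds(1)[of x'] by (simp add: dist_real_def abs_less_iff)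
  qed
  then show "\<exists>d>0. \<forall>x\<in>UNIV. \<forall>x'\<in>UNIV. dist x' x < d \<longrightarrow> dist (u_rep x') (u_rep x) < e"
    using r(1) d by (intro exI[of _ "min r d"]) auto
qed

lemma u_rep_profile: "half_space_profile b p l q s P M u_rep"
proof
  show "u_rep x = 0" if "x \<bullet> b \<le> 0" for x using that by (simp add: u_rep_def)
  fix x t assume t: "0 < (t::real)" "t < x \<bullet> b"
  have "((\<lambda>t. avg u_rep t x) has_real_derivative - (t * avgT F t x)) (at t)"
    by (rule has_field_derivative_transform_within_open[OF U_deriv[OF t], of "{0<..}"]) (use t avg_U_eq in auto)
  then show "((\<lambda>t. avg u_rep t x) has_real_derivative - (t * avgT (rhs p l q s P u_rep) t x)) (at t)"
    by (simp add: avgT_rhs_eq[OF t(1)])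
qed (use b p q s P M u_rep_bounds u_rep_uc in auto)

theorem U_zero:
  assumes "DIM('a) \<ge> 3" "p = (real DIM('a) + 2) / (real DIM('a) - 2)"
  shows "AE x in lborel. U x = 0"
  using u_rep_AE half_space_profile.profile_zero[OF u_rep_profile assms] by (auto elim!: eventually_mono)

end

section \<open>The theorem\<close>

theorem theorem2p2:
  fixes k :: "'n::finite"
    and l :: nat
    and s :: "nat \<Rightarrow> real"
    and P :: "nat \<Rightarrow> real^'n"
    and u :: "real^'n \<Rightarrow> real"
    and G :: "real^'n \<Rightarrow> real^'n"
    and M :: real
  assumes N3: "CARD('n) \<ge> 3"
    and l1: "l \<ge> 1"
    and s_range: "\<And>i. i < l \<Longrightarrow> 0 < s i \<and> s i \<le> 2"
    and P_bdry: "\<And>i. i < l \<Longrightarrow> P i $ k = 0"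
    and u_bdd: "AE x in lborel. x \<in> half_space k \<longrightarrow> 0 \<le> u x \<and> u x \<le> M"
    and u_H1: "H1_loc (\<lambda>x. if x \<in> half_space k then u x else 0) G UNIV"
    and u_eq: "\<And>\<phi>. test_fun \<phi> (half_space k) \<Longrightarrow>
        - (\<integral>x. G x \<bullet> grad \<phi> x \<partial>lborel)
        - (\<integral>x. (\<Sum>i<l. u x powr (crit_exp CARD('n) (s i) - 1) / norm (x - P i) powr (s i)) * \<phi> x \<partial>lborel)
        + (\<integral>x. u x powr ((real CARD('n) + 2) / (real CARD('n) - 2)) * \<phi> x \<partial>lborel) = 0"
  shows "AE x in lborel. x \<in> half_space k \<longrightarrow> u x = 0"
proof -
  define b where "b = (axis k 1 :: real^'n)"
  have b: "b \<in> Basis" by (simp add: b_def axis_in_Basis_iff)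
  have inner_b: "x \<bullet> b = x $ k" for x by (simp add: b_def inner_axis)
  have H: "x \<in> half_space k \<longleftrightarrow> 0 < x \<bullet> b" for x by (simp add: half_space_def inner_b)
  define p where "p = (real CARD('n) + 2) / (real CARD('n) - 2)"
  define q where "q i = crit_exp CARD('n) (s i) - 1" for i
  have N: "real CARD('n) \<ge> 3" using N3 by simp
  have p: "p > 1" unfolding p_def using N by (simp add: field_simps)
  have q: "1 \<le> q i" if "i < l" for i
    unfolding q_def crit_exp_def using s_range[OF that] N by (simp add: field_simps)
  \<comment> \<open>The profile locales require a strictly positive bound.\<close>
  define M' where "M' = max M 1"
  have M': "M' > 0" by (simp add: M'_def)
  define ub where "ub x = (if x \<in> half_space k then u x else 0)" for x
  have wg: "has_weak_gradient ub G UNIV" using u_H1 unfolding H1_loc_def ub_def[abs_def] by blast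
  have ub_meas [measurable]: "ub \<in> borel_measurable borel"
    using wg by (intro loc_integrable_measurable) (simp add: has_weak_gradient_def)
  \<comment> \<open>Truncation turns the almost everywhere bounds into bounds at every point and
    changes the function only on a null set.\<close>
  define U where "U x = (if x \<in> half_space k then max 0 (min M' (ub x)) else 0)" for x
  have Hm [measurable]: "half_space k \<in> sets borel"
    unfolding half_space_def by (intro borel_open open_Collect_less continuous_intros)
  have U_meas [measurable]: "U \<in> borel_measurable borel" unfolding U_def by measurable
  have U_AE: "AE x in lborel. ub x = U x \<and> (x \<in> half_space k \<longrightarrow> u x = U x)"
    using u_bdd by eventually_elim (auto simp: U_def ub_def M'_def)
  interpret weak_half_space b p l q s P M' U G
  proof
    show "U x = 0" if "x \<bullet> b \<le> 0" for x using that by (simp add: U_def H)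
    show "loc_integrable (\<lambda>x. G x \<bullet> c) UNIV" if "c \<in> Basis" for c
      using wg that by (simp add: has_weak_gradient_def)
    show "(\<integral>x. U x * pderiv_dir \<phi> c x \<partial>lborel) = - (\<integral>x. (G x \<bullet> c) * \<phi> x \<partial>lborel)"
      if \<phi>: "\<phi> \<in> smooth_class" "compact K" "\<And>x. x \<notin> K \<Longrightarrow> \<phi> x = 0" and c: "c \<in> Basis" for \<phi> K c
    proof -
      have [measurable]: "pderiv_dir \<phi> c \<in> borel_measurable borel"
        by (rule smooth_class_measurable[OF smooth_class_pderiv_dir[OF \<phi>(1)]])
      have "(\<integral>x. U x * pderiv_dir \<phi> c x \<partial>lborel) = (\<integral>x. ub x * pderiv_dir \<phi> c x \<partial>lborel)"
        using U_AE by (intro integral_cong_AE) (measurable, auto elim!: eventually_mono)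
      then show ?thesis using wg test_funI[OF \<phi>(1,2) subset_UNIV \<phi>(3)] c by (simp add: has_weak_gradient_def)
    qed
    show "(\<integral>x. G x \<bullet> grad \<phi> x \<partial>lborel) = (\<integral>x. rhs p l q s P U x * \<phi> x \<partial>lborel)"
      if \<phi>: "\<phi> \<in> smooth_class" "compact K" "K \<subseteq> {x. 0 < x \<bullet> b}" "\<And>x. x \<notin> K \<Longrightarrow> \<phi> x = 0" for \<phi> K
    proof -
      \<comment> \<open>The pointwise bounds on the right-hand side are needed to prove the equation
        for U, which is itself an obligation of the outer interpretation.\<close>
      interpret bp: bounded_profile b p l q s P M' U
        using b p q s_range P_bdry M' by unfold_locales (auto simp: inner_b U_def)
      have \<phi>m [measurable]: "\<phi> \<in> borel_measurable borel" by (rule smooth_class_measurable[OF \<phi>(1)])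
      have KH: "K \<subseteq> half_space k" using \<phi>(3) H by auto
      have \<phi>0: "\<phi> x = 0" if "x \<notin> half_space k" for x using that KH \<phi>(4) by blast
      define A where "A x = (\<Sum>i<l. U x powr q i / norm (x - P i) powr s i)" for x
      have Am [measurable]: "A \<in> borel_measurable borel" unfolding A_def by measurable
      have i\<phi>: "integrable lborel \<phi>"
        by (rule integrable_continuous_compact_support[OF smooth_class_continuous[OF \<phi>(1)] \<phi>(2,4)])
      \<comment> \<open>The compact support has positive height, which bounds the weights on it and
        allows the integral to be split.\<close>
      obtain h where h: "h > 0" "\<And>x. x \<in> K \<Longrightarrow> h \<le> x \<bullet> b"
      proof (cases "K = {}")
        case False
        have "continuous_on K (\<lambda>x. x \<bullet> b)" by (intro continuous_intros)
        then obtain x0 where x0: "x0 \<in> K" "\<And>y. y \<in> K \<Longrightarrow> x0 \<bullet> b \<le> y \<bullet> b"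
          using continuous_attains_inf[OF \<phi>(2) False, of "\<lambda>x. x \<bullet> b"] by blast
        then show ?thesis using that[of "x0 \<bullet> b"] \<phi>(3) by auto
      qed (use that[of 1] in auto)
      define C where "C = (\<Sum>i<l. M' powr q i / h powr s i)"
      have "integrable lborel (\<lambda>x. (indicator K x * A x) * \<phi> x)"
      proof (rule integrable_bounded_times[OF _ _ i\<phi>, where M="\<bar>C\<bar>"])
        show "(\<lambda>x. indicator K x * A x) \<in> borel_measurable borel"
          using borel_compact[OF \<phi>(2)] by measurable
        show "\<bar>indicator K x * A x\<bar> \<le> \<bar>C\<bar>" for x
          using bp.weighted_sum_bounds[OF h(1), of x] h(2)[of x] by (cases "x \<in> K") (auto simp: A_def C_def)
      qed
      moreover have "(indicator K x * A x) * \<phi> x = A x * \<phi> x" for x using \<phi>(4)[of x] by (auto simp: indicator_def)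
      ultimately have iA: "integrable lborel (\<lambda>x. A x * \<phi> x)" by simp
      have iU: "integrable lborel (\<lambda>x. U x powr p * \<phi> x)"
      proof (rule integrable_bounded_times[OF _ _ i\<phi>, where M="M' powr p"])
        show "\<bar>U x powr p\<bar> \<le> M' powr p" for x using bp.u_nonneg bp.u_le p by (simp add: powr_mono2)
      qed measurable
      \<comment> \<open>\<open>u\<close> is arbitrary outside the half-space. There \<phi> vanishes,
        so \<open>u\<close> is exchanged pointwise for the measurable \<open>ub\<close> before null
        sets are disregarded.\<close>
      have "(\<lambda>x. (\<Sum>i<l. u x powr q i / norm (x - P i) powr s i) * \<phi> x) = (\<lambda>x. (\<Sum>i<l. ub x powr q i / norm (x - P i) powr s i) * \<phi> x)"
        using \<phi>0 by (auto simp: ub_def fun_eq_iff)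
      moreover have "(\<integral>x. (\<Sum>i<l. ub x powr q i / norm (x - P i) powr s i) * \<phi> x \<partial>lborel) = (\<integral>x. A x * \<phi> x \<partial>lborel)"
        using U_AE by (intro integral_cong_AE) (measurable, auto elim!: eventually_mono simp: A_def)
      ultimately have 1: "(\<integral>x. (\<Sum>i<l. u x powr q i / norm (x - P i) powr s i) * \<phi> x \<partial>lborel) = (\<integral>x. A x * \<phi> x \<partial>lborel)"
        by simp
      have "(\<lambda>x. u x powr p * \<phi> x) = (\<lambda>x. ub x powr p * \<phi> x)"
        using \<phi>0 by (auto simp: ub_def fun_eq_iff)
      moreover have "(\<integral>x. ub x powr p * \<phi> x \<partial>lborel) = (\<integral>x. U x powr p * \<phi> x \<partial>lborel)"
        using U_AE by (intro integral_cong_AE) (measurable, auto elim!: eventually_mono)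
      ultimately have 2: "(\<integral>x. u x powr p * \<phi> x \<partial>lborel) = (\<integral>x. U x powr p * \<phi> x \<partial>lborel)" by simp
      have "(\<integral>x. rhs p l q s P U x * \<phi> x \<partial>lborel) = (\<integral>x. U x powr p * \<phi> x \<partial>lborel) - (\<integral>x. A x * \<phi> x \<partial>lborel)"
        using Bochner_Integration.integral_diff[OF iU iA] by (simp add: rhs_def A_def left_diff_distrib)
      moreover have "- (\<integral>x. G x \<bullet> grad \<phi> x \<partial>lborel)
          - (\<integral>x. (\<Sum>i<l. u x powr q i / norm (x - P i) powr s i) * \<phi> x \<partial>lborel) + (\<integral>x. u x powr p * \<phi> x \<partial>lborel) = 0"
        using u_eq[OF test_funI[OF \<phi>(1,2) KH \<phi>(4)]] unfolding q_def p_def .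
      ultimately show ?thesis unfolding 1 2 by linarith
    qed
  qed (use b p q s_range P_bdry M' in \<open>auto simp: inner_b U_def\<close>)
  have "AE x in lborel. U x = 0"
    using N3 by (intro U_zero) (auto simp: p_def)
  with U_AE show ?thesis by eventually_elim auto
qed

end
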